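(* Let $\alpha\in\mathbb{S}^1$ be a Liouville number, let $(\alpha_n)$, $\alpha_n=\frac{p_n}{q_n}$, and the associated modified maps $\overline{H}_{\mathbf{a},n}$ be as in the context, and for $\mathbf{a}\in\{0,1\}^{\mathbb{N}}$ let $\overline{H}_{\mathbf{a}}=\lim_{n\to\infty}\overline{H}_{\mathbf{a},n}$. Then for every $\mathbf{a}\in\{0,1\}^{\mathbb{N}}$ the homeomorphism $\overline{H}_{\mathbf{a}}$ is absolutely continuous.
   Context: $\mathbb{S}^1=\mathbb{R}/\mathbb{Z}$, $R_\alpha(x)=x+\alpha\bmod1$, $m$ is Lebesgue measure on $\mathbb{S}^1$. An irrational $\alpha$ is Liouville if for every $C>0$ and $n\in\mathbb{N}$ there are infinitely many pairs $p\in\mathbb{Z}$, $q\in\mathbb{N}$ with $0<|\alpha-p/q|<C/q^n$. $\|f\|_k=\max_{0\le i\le k}\max_x|D^if(x)|$, $d_k(f,g)=\max\{\|f-g\|_k,\|f^{-1}-g^{-1}\|_k\}$ (order-zero term measured by distance on the circle). Convergence in the $\mathrm{Diff}^\infty$-topology means convergence in $d_k$ for every $k\in\mathbb{N}$. $\mathcal{H}^\infty_\alpha$ is the set of orientation-preserving $C^\infty$ circle diffeomorphisms with rotation number $\alpha$. Construction: Fix a $C^\infty$ function $\psi:\mathbb{R}\to[0,1]$ with $\psi=0$ on $(-\infty,0]$, $\psi=1$ on $[1,\infty)$, strictly increasing on $[0,1]$. For $0<t<1/10$ put $A(x)=t(x-\frac14)+3t$, $B(x)=t^{-1}(x-\frac12)+\frac12$,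 $A'(x)=t(x-\frac34)+1-3t$, and let $\hat h_t:[0,1]\to[0,1]$ be the strictly increasing $C^\infty$ diffeomorphism equal to: $x$ on $[0,t]$; $(1-\psi(s))x+\psi(s)A(x)$ with $s=t^{-1}(x-t)$ on $[t,2t]$; $A(x)$ on $[2t,\frac{1-t+8t^2}{2}]$; $(1-\psi(s))A(x)+\psi(s)B(x)$ with $s=t^{-2}(x-\frac{1-t+8t^2}{2})$ on $[\frac{1-t+8t^2}{2},\frac{1-t+10t^2}{2}]$; $B(x)$ on $[\frac{1-t+10t^2}{2},\frac{1+t-10t^2}{2}]$; $(1-\psi(s))B(x)+\psi(s)A'(x)$ with $s=t^{-2}(x-\frac{1+t-10t^2}{2})$ on $[\frac{1+t-10t^2}{2},\frac{1+t-8t^2}{2}]$; $A'(x)$ on $[\frac{1+t-8t^2}{2},1-2t]$; $(1-\psi(s))A'(x)+\psi(s)x$ with $s=t^{-1}(x-1+2t)$ on $[1-2t,1-t]$; $x$ on $[1-t,1]$. Given positive integers $q_n$ (large enough that $t_n<1/10$), let $t_n=q_n^{1-2n}$ and let $\breve h_{t_n}$ be the circle diffeomorphism with $\breve h_{t_n}(x)=2^{-(n+1)}\hat h_{t_n}(2^{n+1}x)$ for $x\in[0,2^{-(n+1)}]$ and $\breve h_{t_n}(x)=x$ for $x\in[2^{-(n+1)},1]$. Let $\overline{h}_{q_n}$ be the lift of $\breve h_{t_n}$ by the $q_n$-fold covering $x\mapsto q_nx$ having a fixed point, i.e. $\overline h_{q_n}(x)=\frac{1}{q_n}(\ell+\breve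 h_{t_n}(q_nx-\ell))$ for $x\in[\frac{\ell}{q_n},\frac{\ell+1}{q_n}]$, $0\le\ell<q_n$. For $\mathbf{a}=(a_n)\in\{0,1\}^{\mathbb{N}}$ let $\overline h_{\mathbf{a},n}=\overline h_{q_n}$ if $a_n=0$ and $\overline h_{\mathbf{a},n}=\overline h_{q_n}^{-1}$ if $a_n=1$; let $\overline H_{\mathbf{a},0}=\mathrm{id}$ and $\overline H_{\mathbf{a},n}=\overline H_{\mathbf{a},n-1}\circ\overline h_{\mathbf{a},n}$. Standing assumption: the rationals $\alpha_n=p_n/q_n$ are chosen so that $|\alpha-\alpha_n|\to0$ monotonically, $q_{n+1}\ge q_n^{2n}$ for all $n\in\mathbb N$, and for every $\mathbf{a}$ both $\overline H_{\mathbf{a},n}\circ R_{\alpha_{n+1}}\circ\overline H_{\mathbf{a},n}^{-1}$ and $\overline H_{\mathbf{a},n}\circ R_{\alpha}\circ\overline H_{\mathbf{a},n}^{-1}$ converge in the $\mathrm{Diff}^\infty$-topology to the same diffeomorphism $\overline T_{\mathbf{a}}\in\mathcal{H}^\infty_\alpha$. Then $\overline H_{\mathbf{a},n}$ converges in $d_0$ to a homeomorphism $\overline H_{\mathbf{a}}$ with $\overline H_{\mathbf{a}}(0)=0$ and $\overline T_{\mathbf{a}}=\overline H_{\mathbf{a}}\circ R_\alpha\circ\overline H_{\mathbf{a}}^{-1}$, and the unique $\overline T_{\mathbf{a}}$-invariant Borel probability measure is $\mu_{\overline T_{\mathbf{a}}}=(\overline H_{\mathbf{a}})_*m$. $\overline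 H_{\mathbf{a}}$ is called absolutely continuous if $\mu_{\overline T_{\mathbf{a}}}$ is equivalent to $m$ (same null sets); in this case $\overline H_{\mathbf{a}}$ maps Lebesgue null sets to null sets. *)

theory Defs
  imports "HOL-Probability.Probability"
begin

text \<open>
  A point of the circle \<open>\<real>/\<int>\<close> is given by any real representative. An orientation-preserving
  circle map is given by a lift, i.e. a map \<open>F\<close> of the real line with
  \<open>F (x + 1) = F x + 1\<close>, determined up to an additive integer; the notions below do not
  depend on the choice of the lift. The lift of the inverse map is \<open>inv F\<close>.
\<close>

definition circle_dist :: "real \<Rightarrow> real \<Rightarrow> real" where
  "circle_dist x y = min (frac (x - y)) (1 - frac (x - y))"

definition rotation :: "real \<Rightarrow> real \<Rightarrow> real" where
  "rotation \<alpha> x = x + \<alpha>"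

definition circle_homeo :: "(real \<Rightarrow> real) \<Rightarrow> bool" where
  "circle_homeo F \<longleftrightarrow> continuous_on UNIV F \<and> strict_mono F \<and> (\<forall>x. F (x + 1) = F x + 1)"

definition smooth :: "(real \<Rightarrow> real) \<Rightarrow> bool" where
  "smooth f \<longleftrightarrow> (\<forall>k x. ((deriv ^^ k) f) field_differentiable (at x))"

definition circle_diffeo :: "(real \<Rightarrow> real) \<Rightarrow> bool" where
  "circle_diffeo F \<longleftrightarrow> circle_homeo F \<and> smooth F \<and> smooth (inv F)"

text \<open>A real representative of the rotation number, which is a point of the circle.\<close>

definition rotation_number :: "(real \<Rightarrow> real) \<Rightarrow> real" where
  "rotation_number F = lim (\<lambda>n. (F ^^ n) 0 / real n)"

definition diffeos_with_rotation_number :: "real \<Rightarrow> (real \<Rightarrow> real) set" where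
  "diffeos_with_rotation_number \<alpha> = {F. circle_diffeo F \<and> rotation_number F - \<alpha> \<in> \<int>}"

definition Ck_dist :: "nat \<Rightarrow> (real \<Rightarrow> real) \<Rightarrow> (real \<Rightarrow> real) \<Rightarrow> real" where
  "Ck_dist k F G = Max ((\<lambda>i. SUP x. if i = 0 then circle_dist (F x) (G x)
                                     else \<bar>(deriv ^^ i) (\<lambda>y. F y - G y) x\<bar>) ` {..k})"

definition diff_dist :: "nat \<Rightarrow> (real \<Rightarrow> real) \<Rightarrow> (real \<Rightarrow> real) \<Rightarrow> real" where
  "diff_dist k F G = max (Ck_dist k F G) (Ck_dist k (inv F) (inv G))"

definition Diff_converges :: "(nat \<Rightarrow> real \<Rightarrow> real) \<Rightarrow> (real \<Rightarrow> real) \<Rightarrow> bool" where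
  "Diff_converges F G \<longleftrightarrow> (\<forall>k. (\<lambda>n. diff_dist k (F n) G) \<longlonglongrightarrow> 0)"

definition liouville :: "real \<Rightarrow> bool" where
  "liouville \<alpha> \<longleftrightarrow> \<alpha> \<notin> \<rat> \<and>
     (\<forall>C>0. \<forall>n::nat. infinite {(p::int, q::nat). q > 0 \<and>
        0 < \<bar>\<alpha> - of_int p / real q\<bar> \<and> \<bar>\<alpha> - of_int p / real q\<bar> < C / real q ^ n})"

definition cutoff :: "(real \<Rightarrow> real) \<Rightarrow> bool" where
  "cutoff \<psi> \<longleftrightarrow> smooth \<psi> \<and> range \<psi> \<subseteq> {0..1} \<and> (\<forall>x\<le>0. \<psi> x = 0) \<and> (\<forall>x\<ge>1. \<psi> x = 1) \<and>
     strict_mono_on {0..1} \<psi>"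

text \<open>The two formulas valid at a common endpoint of two pieces agree there.\<close>

definition h_hat :: "(real \<Rightarrow> real) \<Rightarrow> real \<Rightarrow> real \<Rightarrow> real" where
  "h_hat \<psi> t x =
    (let A = (\<lambda>x. t * (x - 1/4) + 3 * t);
         B = (\<lambda>x. (x - 1/2) / t + 1/2);
         A' = (\<lambda>x. t * (x - 3/4) + 1 - 3 * t);
         blend = (\<lambda>s u v. (1 - \<psi> s) * u + \<psi> s * v)
     in if x \<le> t then x
        else if x \<le> 2 * t then blend ((x - t) / t) x (A x)
        else if x \<le> (1 - t + 8 * t^2) / 2 then A x
        else if x \<le> (1 - t + 10 * t^2) / 2
          then blend ((x - (1 - t + 8 * t^2) / 2) / t^2) (A x) (B x)
        else if x \<le> (1 + t - 10 * t^2) / 2 then B x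
        else if x \<le> (1 + t - 8 * t^2) / 2
          then blend ((x - (1 + t - 10 * t^2) / 2) / t^2) (B x) (A' x)
        else if x \<le> 1 - 2 * t then A' x
        else if x \<le> 1 - t then blend ((x - 1 + 2 * t) / t) (A' x) x
        else x)"

definition t_param :: "nat \<Rightarrow> nat \<Rightarrow> real" where
  "t_param Q n = real Q powi (1 - 2 * int n)"

text \<open>Meaningful on the fundamental domain \<open>[0,1]\<close> only; \<open>h_bar\<close> extends it periodically.\<close>

definition h_breve :: "(real \<Rightarrow> real) \<Rightarrow> nat \<Rightarrow> nat \<Rightarrow> real \<Rightarrow> real" where
  "h_breve \<psi> Q n x =
    (if x \<le> 1 / 2 ^ (n + 1) then h_hat \<psi> (t_param Q n) (2 ^ (n + 1) * x) / 2 ^ (n + 1) else x)"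

text \<open>With \<open>\<ell> = \<lfloor>Q x\<rfloor>\<close> ranging over all integers, the formula on \<open>[\<ell>/Q, (\<ell>+1)/Q]\<close> defines
  the lift to the real line that fixes 0.\<close>

definition h_bar :: "(real \<Rightarrow> real) \<Rightarrow> nat \<Rightarrow> nat \<Rightarrow> real \<Rightarrow> real" where
  "h_bar \<psi> Q n x =
    (of_int \<lfloor>real Q * x\<rfloor> + h_breve \<psi> Q n (real Q * x - of_int \<lfloor>real Q * x\<rfloor>)) / real Q"

text \<open>The symbols 0 and 1 of a sequence \<open>a\<close> are encoded as \<open>False\<close> and \<open>True\<close>. Sequences are
  indexed from 1; the values \<open>a 0\<close> and \<open>q 0\<close> are irrelevant.\<close>

definition h_seq :: "(real \<Rightarrow> real) \<Rightarrow> (nat \<Rightarrow> nat) \<Rightarrow> (nat \<Rightarrow> bool) \<Rightarrow> nat \<Rightarrow> real \<Rightarrow> real" where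
  "h_seq \<psi> q a n = (if a n then inv (h_bar \<psi> (q n) n) else h_bar \<psi> (q n) n)"

primrec H_seq :: "(real \<Rightarrow> real) \<Rightarrow> (nat \<Rightarrow> nat) \<Rightarrow> (nat \<Rightarrow> bool) \<Rightarrow> nat \<Rightarrow> real \<Rightarrow> real" where
  "H_seq \<psi> q a 0 = id"
| "H_seq \<psi> q a (Suc n) = H_seq \<psi> q a n \<circ> h_seq \<psi> q a (Suc n)"

text \<open>The \<open>d\<^sub>0\<close>-limit of the \<open>H_seq\<close> among circle homeomorphisms, as the lift fixing 0.\<close>

definition H_lim :: "(real \<Rightarrow> real) \<Rightarrow> (nat \<Rightarrow> nat) \<Rightarrow> (nat \<Rightarrow> bool) \<Rightarrow> real \<Rightarrow> real" where
  "H_lim \<psi> q a = (THE H. circle_homeo H \<and> H 0 = 0 \<and>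
     (\<lambda>n. diff_dist 0 (H_seq \<psi> q a n) H) \<longlonglongrightarrow> 0)"

text \<open>Measures on the circle live on the fundamental domain \<open>[0,1)\<close>, whose Borel sets correspond
  to those of the circle; the circle map with lift \<open>T\<close> acts there as \<open>x \<mapsto> frac (T x)\<close>.\<close>

definition circle_lebesgue :: "real measure" where
  "circle_lebesgue = restrict_space lborel {0..<1}"

definition invariant_prob :: "(real \<Rightarrow> real) \<Rightarrow> real measure \<Rightarrow> bool" where
  "invariant_prob T M \<longleftrightarrow> prob_space M \<and> sets M = sets circle_lebesgue \<and>
     distr M M (\<lambda>x. frac (T x)) = M"

definition invariant_measure :: "(real \<Rightarrow> real) \<Rightarrow> real measure" where
  "invariant_measure T = (THE M. invariant_prob T M)"

text \<open>Absolute continuity of a homeomorphism \<open>H\<close> that conjugates the rotation by \<open>\<alpha>\<close> to the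
  uniquely ergodic circle homeomorphism \<open>T\<close>.\<close>

definition absolutely_continuous_conjugacy ::
    "real \<Rightarrow> (real \<Rightarrow> real) \<Rightarrow> (real \<Rightarrow> real) \<Rightarrow> bool" where
  "absolutely_continuous_conjugacy \<alpha> T H \<longleftrightarrow>
     circle_homeo H \<and> (\<forall>x. T x - (H \<circ> rotation \<alpha> \<circ> inv H) x \<in> \<int>) \<and>
     (\<exists>!M. invariant_prob T M) \<and>
     null_sets (invariant_measure T) = null_sets circle_lebesgue"

end

theory Submission
  imports Defs
begin

text \<open>
  Write \<open>t\<close> for \<open>t_param (q n) n\<close>. The map \<open>h_bar\<close> of level \<open>n\<close> moves only points of a set
  \<open>E n\<close> of density \<open>1 / 2 ^ (n + 1)\<close> and period \<open>1 / q n\<close>, and apart from short transition zones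
  its slopes are \<open>t\<close>, \<open>1\<close> and \<open>1 / t\<close>. The limit \<open>H\<close> agrees with \<open>H n\<close> off the union
  \<open>F n\<close> of the \<open>E k\<close> with \<open>k > n\<close>. As \<open>H n\<close> is bi-Lipschitz, \<open>H\<close> and its inverse preserve null
  sets as soon as \<open>F n\<close> and \<open>H n ` F n\<close> have small measure for infinitely many \<open>n\<close>.

  The growth condition on \<open>q\<close> does not suffice for the second set: the components of
  \<open>E (n + 1)\<close> may be as long as the steep pieces of level \<open>n\<close> and sit inside them. The missing growth
  comes from the convergence in the \<open>C\<^sup>1\<close> topology, applied to the constant sequence \<open>a = 0\<close>. The
  conjugates of the rotations by \<open>\<alpha>\<close> and by \<open>p n / q n\<close> under \<open>H n\<close> have the same
  limit, so the slopes of \<open>H n\<close> at \<open>y\<close> and at \<open>y + \<alpha> - p n / q n\<close> are comparable. This forces \<open>\<alpha>\<close> to lie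
  within \<open>t\<^sup>2 / (2 ^ (n + 1) * q n)\<close> of a fraction with denominator \<open>q n\<close>. Since \<open>\<alpha>\<close>
  is irrational, this fraction changes infinitely often, and each change is a jump
  \<open>q n ^ (4 * n - 2) \<le> 2 * q (n + 1)\<close>. At the jumps \<open>F n\<close> is equidistributed at the scale on which
  \<open>H n\<close> has bounded distortion; the jumps also give the uniform convergence of \<open>H n\<close>.
\<close>

section \<open>The building block on the unit interval\<close>

text \<open>The comparison of slopes works because both conjugates are eventually C^1 close to a
  diffeomorphism whose slope is bounded below. Passing from \<open>H n\<close> to its last factor
  costs the square of the slope bound of \<open>H (n - 1)\<close>, and the growth of
  \<open>q\<close> keeps that bound below \<open>C ^ (n - 1) * q n\<close>. The slopes of the last
  factor differ by a factor of order \<open>1 / t = q n ^ (2 * n - 1)\<close>, which wins for large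
  \<open>n\<close>. Hence the shift cannot carry a point across the transition window between the
  slopes \<open>t\<close> and \<open>1 / t\<close>; on the line this window has length
  \<open>t\<^sup>2 / (2 ^ (n + 1) * q n)\<close>, the accuracy obtained for \<alpha>. Distinct
  fractions with denominators \<open>q n\<close> and \<open>q (n + 1)\<close> are at least
  \<open>1 / (q n * q (n + 1))\<close> apart, and \<open>t\<^sup>2 = 1 / q n ^ (4 * n - 2)\<close>
  supplies the exponent of a jump. This exponent is about twice that of the slope of level
  \<open>n\<close>; the surplus absorbs constants \<open>C ^ n\<close> and the distortion of
  \<open>H (n - 1)\<close>. Jumps concern only \<open>q\<close>, so those found from one sequence
  serve all sequences \<open>a\<close>; a block and its inverse obey the same estimates.\<close>

locale bounded_cutoff =
  fixes \<psi> \<psi>' :: "real \<Rightarrow> real" and M :: real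
  assumes psi_deriv: "\<And>x. (\<psi> has_real_derivative \<psi>' x) (at x)"
    and psi_left: "\<And>x. x \<le> 0 \<Longrightarrow> \<psi> x = 0"
    and psi_right: "\<And>x. x \<ge> 1 \<Longrightarrow> \<psi> x = 1"
    and psi_ge_0: "\<And>x. 0 \<le> \<psi> x"
    and psi_le_1: "\<And>x. \<psi> x \<le> 1"
    and psi'_ge_0: "\<And>x. 0 \<le> \<psi>' x"
    and psi'_le: "\<And>x. \<psi>' x \<le> M"
    and psi'_lipschitz: "\<And>x y. \<bar>\<psi>' x - \<psi>' y\<bar> \<le> M * \<bar>x - y\<bar>"

section \<open>Bounds for the cutoff and its derivatives\<close>

lemma bounded_of_compact_support:
  fixes f :: "real \<Rightarrow> real"
  assumes "continuous_on UNIV f" "\<And>x. x \<le> 0 \<Longrightarrow> f x = 0" "\<And>x. x \<ge> 1 \<Longrightarrow> f x = 0"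
  shows "\<exists>B. \<forall>x. \<bar>f x\<bar> \<le> B"
proof -
  have "compact (f ` {0..1})"
    by (rule compact_continuous_image) (auto intro: continuous_on_subset[OF assms(1)])
  then obtain B where B: "\<And>x. x \<in> {0..1} \<Longrightarrow> \<bar>f x\<bar> \<le> B"
    using compact_imp_bounded[of "f ` {0..1}"] unfolding bounded_iff by force
  have "\<bar>f x\<bar> \<le> B" for x
    using B[of x] B[of 0] assms(2)[of x] assms(3)[of x] by (cases "x \<in> {0..1}") auto
  then show ?thesis by blast
qed

text \<open>The two-sided derivative restricts to the half-line, where it is that of a constant. So
  \<open>x\<close> itself may be the boundary point of the constant region, as happens for the
  cutoff at 0 and 1.\<close>

lemma deriv_zero_of_locally_const_right:
  fixes f :: "real \<Rightarrow> real"
  assumes "(f has_real_derivative D) (at x)" "\<And>y. y \<ge> x \<Longrightarrow> f y = c"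
  shows "D = 0"
proof -
  have "(f has_real_derivative D) (at x within {x..})"
    using assms(1) has_field_derivative_at_within by blast
  moreover have "(f has_real_derivative 0) (at x within {x..})"
    by (rule has_field_derivative_transform_within[where f = "\<lambda>_. c" and d = 1])
      (auto simp: assms(2))
  moreover have "at x within {x..} \<noteq> bot"
    by (metis at_within_Icc_at_right at_within_eq_bot_iff trivial_limit_at_right_real at_within_Ici_at_right)
  ultimately show ?thesis by (rule has_field_derivative_unique)
qed

lemma deriv_zero_of_locally_const_left:
  fixes f :: "real \<Rightarrow> real"
  assumes "(f has_real_derivative D) (at x)" "\<And>y. y \<le> x \<Longrightarrow> f y = c"
  shows "D = 0"
proof -
  have "((\<lambda>y. f (- y)) has_real_derivative - D) (at (- x))"
    using assms(1) by (simp add: DERIV_mirror)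
  then have "- D = 0"
    by (rule deriv_zero_of_locally_const_right[where c = c]) (auto simp: assms(2))
  then show ?thesis by simp
qed

lemma smooth_deriv: "smooth f \<Longrightarrow> ((deriv ^^ k) f has_real_derivative (deriv ^^ Suc k) f x) (at x)"
  unfolding smooth_def by (simp add: DERIV_deriv_iff_field_differentiable)

text \<open>The first two derivatives vanish outside the open unit interval, so compactness bounds
  both. One constant serves as slope bound and, through the second derivative, as Lipschitz constant
  of the slope.\<close>

lemma bounded_cutoff_of_cutoff:
  assumes "cutoff \<psi>"
  shows "\<exists>M. bounded_cutoff \<psi> (deriv \<psi>) M"
proof -
  have sm: "smooth \<psi>" and rng: "range \<psi> \<subseteq> {0..1}"
    and l: "\<And>x. x \<le> 0 \<Longrightarrow> \<psi> x = 0" and r: "\<And>x. x \<ge> 1 \<Longrightarrow> \<psi> x = 1"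
    and mono: "strict_mono_on {0..1} \<psi>"
    using assms by (auto simp: cutoff_def)
  have d1: "(\<psi> has_real_derivative deriv \<psi> x) (at x)" for x
    using smooth_deriv[OF sm, of 0] by simp
  have d2: "(deriv \<psi> has_real_derivative deriv (deriv \<psi>) x) (at x)" for x
    using smooth_deriv[OF sm, of 1] by simp
  have d3: "(deriv (deriv \<psi>) has_real_derivative deriv (deriv (deriv \<psi>)) x) (at x)" for x
    using smooth_deriv[OF sm, of 2] by (simp add: numeral_2_eq_2)
  have z1: "deriv \<psi> x = 0" if "x \<le> 0 \<or> x \<ge> 1" for x
    using that deriv_zero_of_locally_const_left[OF d1, of x 0] l
      deriv_zero_of_locally_const_right[OF d1, of x 1] r by auto
  have z2: "deriv (deriv \<psi>) x = 0" if "x \<le> 0 \<or> x \<ge> 1" for x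
    using that deriv_zero_of_locally_const_left[OF d2, of x 0]
      deriv_zero_of_locally_const_right[OF d2, of x 0] z1 by auto
  have c1: "continuous_on UNIV (deriv \<psi>)" and c2: "continuous_on UNIV (deriv (deriv \<psi>))"
    using d2 d3 DERIV_continuous_on by (metis (no_types, lifting) has_field_derivative_at_within)+
  obtain B1 where B1: "\<And>x. \<bar>deriv \<psi> x\<bar> \<le> B1"
    using bounded_of_compact_support[OF c1] z1 by blast
  obtain B2 where B2: "\<And>x. \<bar>deriv (deriv \<psi>) x\<bar> \<le> B2"
    using bounded_of_compact_support[OF c2] z2 by blast
  have m: "mono \<psi>"
  proof (rule monoI)
    fix x y :: real assume xy: "x \<le> y"
    show "\<psi> x \<le> \<psi> y"
    proof (cases "x \<in> {0..1} \<and> y \<in> {0..1} \<and> x < y")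
      case True then show ?thesis using mono by (auto simp: strict_mono_on_def less_imp_le)
    next
      case False
      have "\<psi> x \<in> {0..1}" "\<psi> y \<in> {0..1}" using rng by blast+
      with False xy show ?thesis using l[of x] r[of y] by (cases "x = y") auto
    qed
  qed
  have pos: "0 \<le> deriv \<psi> x" for x
    using mono_on_imp_deriv_nonneg[OF _ d1, of UNIV x] m by simp
  have lip: "\<bar>deriv \<psi> x - deriv \<psi> y\<bar> \<le> B2 * \<bar>x - y\<bar>" for x y
    using field_differentiable_bound[of UNIV "deriv \<psi>" "deriv (deriv \<psi>)" B2 x y] d2 B2
    by (auto simp: has_field_derivative_at_within)
  show ?thesis
  proof (intro exI[of _ "max B1 B2"], unfold_locales)
    show "0 \<le> \<psi> x" "\<psi> x \<le> 1" for x
      using rng by (auto simp: image_subset_iff)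
    show "deriv \<psi> x \<le> max B1 B2" for x
      using B1[of x] by linarith
    show "\<bar>deriv \<psi> x - deriv \<psi> y\<bar> \<le> max B1 B2 * \<bar>x - y\<bar>" for x y
      by (rule order_trans[OF lip mult_right_mono]) auto
  qed (use d1 l r pos in blast)+
qed

text \<open>\<open>h_hat\<close> is the identity plus four terms of this kind: past its turn each of them adds the
  difference of two consecutive affine pieces. This makes smoothness at the break points evident.\<close>

definition blend_term :: "(real \<Rightarrow> real) \<Rightarrow> real \<Rightarrow> real \<Rightarrow> real \<Rightarrow> real \<Rightarrow> real \<Rightarrow> real" where
  "blend_term \<psi> a w m k x = \<psi> ((x - a) / w) * (m * x + k)"

definition blend_slope :: "(real \<Rightarrow> real) \<Rightarrow> (real \<Rightarrow> real) \<Rightarrow> real \<Rightarrow> real \<Rightarrow> real \<Rightarrow> real \<Rightarrow> real \<Rightarrow> real" where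
  "blend_slope \<psi> \<psi>' a w m k x = \<psi>' ((x - a) / w) / w * (m * x + k) + \<psi> ((x - a) / w) * m"

text \<open>The derivative of \<open>h_hat\<close>. The pairs of coefficients are those of
  \<open>A x - x\<close>, \<open>B x - A x\<close>, \<open>A' x - B x\<close> and
  \<open>x - A' x\<close>, the differences of consecutive affine pieces.\<close>

definition h_slope :: "(real \<Rightarrow> real) \<Rightarrow> (real \<Rightarrow> real) \<Rightarrow> real \<Rightarrow> real \<Rightarrow> real" where
  "h_slope \<psi> \<psi>' t x = 1
     + blend_slope \<psi> \<psi>' t t (t - 1) (11/4 * t) x
     + blend_slope \<psi> \<psi>' ((1 - t + 8 * t^2) / 2) (t^2) (1/t - t) (1/2 - 1/(2*t) - 11/4 * t) x
     + blend_slope \<psi> \<psi>' ((1 + t - 10 * t^2) / 2) (t^2) (t - 1/t) (1/2 + 1/(2*t) - 15/4 * t) x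
     + blend_slope \<psi> \<psi>' (1 - 2 * t) t (1 - t) (15/4 * t - 1) x"

text \<open>For the window estimates below: an affine function is trapped between its endpoint
  values, and its product term enters as the single variable \<open>X\<close>, which keeps the
  arithmetic linear.\<close>

lemma affine_sandwich:
  fixes X :: real
  assumes "L \<le> X" "X \<le> U" "L + K = e" "U + K = e'" "0 \<le> e" "e' \<le> d"
  shows "0 \<le> X + K \<and> X + K \<le> d"
  using assms by linarith

context bounded_cutoff
begin

lemma psi'_zero:
  assumes "x \<le> 0 \<or> x \<ge> 1"
  shows "\<psi>' x = 0"
  using assms
proof
  assume "x \<le> 0"
  then show ?thesis
    by (intro deriv_zero_of_locally_const_left[OF psi_deriv, where c = 0] psi_left) auto
next
  assume "x \<ge> 1"
  then show ?thesis
    by (intro deriv_zero_of_locally_const_right[OF psi_deriv, where c = 1] psi_right) auto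
qed

text \<open>The cutoff climbs by 1 over unit length, so it has slope 1 somewhere. This lets
  \<open>M\<close> absorb numerical constants later.\<close>

lemma M_ge_1: "M \<ge> 1"
proof -
  have "\<exists>z. z > 0 \<and> z < 1 \<and> \<psi> 1 - \<psi> 0 = (1 - 0) * \<psi>' z"
    by (rule MVT2) (auto intro: psi_deriv)
  then obtain z where "\<psi>' z = 1" using psi_left[of 0] psi_right[of 1] by auto
  then show ?thesis using psi'_le[of z] by simp
qed

lemma psi_lipschitz: "\<bar>\<psi> x - \<psi> y\<bar> \<le> M * \<bar>x - y\<bar>"
  using field_differentiable_bound[of UNIV \<psi> \<psi>' M x y] psi_deriv psi'_le psi'_ge_0
  by (auto simp: has_field_derivative_at_within)

lemma blend_term_left: "w > 0 \<Longrightarrow> x \<le> a \<Longrightarrow> blend_term \<psi> a w m k x = 0"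
  by (simp add: blend_term_def psi_left divide_nonpos_pos)

lemma blend_term_right: "w > 0 \<Longrightarrow> x \<ge> a + w \<Longrightarrow> blend_term \<psi> a w m k x = m * x + k"
  by (simp add: blend_term_def psi_right field_simps)

lemma blend_slope_left: "w > 0 \<Longrightarrow> x \<le> a \<Longrightarrow> blend_slope \<psi> \<psi>' a w m k x = 0"
  by (simp add: blend_slope_def psi_left psi'_zero divide_nonpos_pos)

lemma blend_slope_right: "w > 0 \<Longrightarrow> x \<ge> a + w \<Longrightarrow> blend_slope \<psi> \<psi>' a w m k x = m"
  by (simp add: blend_slope_def psi_right psi'_zero field_simps)

lemma blend_term_deriv:
  "w > 0 \<Longrightarrow> (blend_term \<psi> a w m k has_real_derivative blend_slope \<psi> \<psi>' a w m k x) (at x)"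
  unfolding blend_term_def[abs_def] blend_slope_def
proof -
  assume w: "w > 0"
  have "((\<lambda>x. (x - a) / w) has_real_derivative 1 / w) (at x)"
    using w by (auto intro!: derivative_eq_intros)
  from DERIV_chain2[OF psi_deriv this]
  have 1: "((\<lambda>x. \<psi> ((x - a) / w)) has_real_derivative \<psi>' ((x - a) / w) * (1 / w)) (at x)" .
  have 2: "((\<lambda>x. m * x + k) has_real_derivative m) (at x)"
    by (auto intro!: derivative_eq_intros)
  show "((\<lambda>x. \<psi> ((x - a) / w) * (m * x + k)) has_real_derivative
      \<psi>' ((x - a) / w) / w * (m * x + k) + \<psi> ((x - a) / w) * m) (at x)"
    using DERIV_mult[OF 1 2] by (simp add: algebra_simps)
qed

text \<open>The term with \<open>\<psi>'\<close> lives on the window only, so the sign and size of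
  the affine factor matter nowhere else.\<close>

lemma blend_slope_window_bounds:
  assumes "w > 0" "\<forall>x\<in>{a..a + w}. 0 \<le> m * x + k \<and> m * x + k \<le> d"
  shows "\<psi> ((x - a) / w) * m \<le> blend_slope \<psi> \<psi>' a w m k x"
    and "blend_slope \<psi> \<psi>' a w m k x \<le> \<psi> ((x - a) / w) * m + M * d / w"
proof -
  have d0: "d \<ge> 0" using bspec[OF assms(2), of a] assms(1) by auto
  have "0 \<le> \<psi>' ((x - a) / w) / w * (m * x + k) \<and> \<psi>' ((x - a) / w) / w * (m * x + k) \<le> M * d / w"
  proof (cases "a \<le> x \<and> x \<le> a + w")
    case True
    then have *: "0 \<le> m * x + k" "m * x + k \<le> d" using assms(2) by auto
    have "\<psi>' ((x - a) / w) * (m * x + k) \<le> M * d"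
      using * psi'_le psi'_ge_0 M_ge_1 by (intro mult_mono) auto
    then have "\<psi>' ((x - a) / w) * (m * x + k) / w \<le> M * d / w"
      using assms(1) by (intro divide_right_mono) auto
    moreover have "0 \<le> \<psi>' ((x - a) / w) / w * (m * x + k)"
      using * assms(1) psi'_ge_0 by simp
    ultimately show ?thesis by simp
  next
    case False
    then have "\<psi>' ((x - a) / w) = 0" using assms(1) by (intro psi'_zero) (auto simp: field_simps)
    then show ?thesis using d0 M_ge_1 assms(1) by simp
  qed
  then show "\<psi> ((x - a) / w) * m \<le> blend_slope \<psi> \<psi>' a w m k x"
    and "blend_slope \<psi> \<psi>' a w m k x \<le> \<psi> ((x - a) / w) * m + M * d / w"
    by (auto simp: blend_slope_def)
qed

text \<open>The affine factor is unbounded off the window. The difference of products is therefore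
  expanded around a point inside the window, where this factor is at most \<open>d\<close>; if both
  points are outside, both \<open>\<psi>'\<close> terms vanish.\<close>

lemma blend_slope_lipschitz:
  assumes w: "w > 0" and win: "\<forall>x\<in>{a..a + w}. 0 \<le> m * x + k \<and> m * x + k \<le> d"
  shows "\<bar>blend_slope \<psi> \<psi>' a w m k x - blend_slope \<psi> \<psi>' a w m k y\<bar>
    \<le> (M * d / w\<^sup>2 + 2 * M * \<bar>m\<bar> / w) * \<bar>x - y\<bar>"
proof -
  define s where "s x = (x - a) / w" for x
  have sl: "\<bar>s x - s y\<bar> = \<bar>x - y\<bar> / w" for x y
    using w by (simp add: s_def flip: diff_divide_distrib)
  have out: "\<psi>' (s x) = 0" if "\<not> (a \<le> x \<and> x \<le> a + w)" for x
    using that w unfolding s_def by (intro psi'_zero) (auto simp: field_simps)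
  have aux: "\<bar>\<psi>' (s x) * (m * x + k) - \<psi>' (s y) * (m * y + k)\<bar> \<le> (M * d / w + M * \<bar>m\<bar>) * \<bar>x - y\<bar>"
    if x: "a \<le> x" "x \<le> a + w" for x y
  proof -
    have "\<psi>' (s x) * (m * x + k) - \<psi>' (s y) * (m * y + k)
      = (\<psi>' (s x) - \<psi>' (s y)) * (m * x + k) + \<psi>' (s y) * (m * (x - y))" by algebra
    also have "\<bar>\<dots>\<bar> \<le> \<bar>\<psi>' (s x) - \<psi>' (s y)\<bar> * \<bar>m * x + k\<bar> + \<bar>\<psi>' (s y)\<bar> * (\<bar>m\<bar> * \<bar>x - y\<bar>)"
      by (metis abs_mult abs_triangle_ineq)
    also have "\<dots> \<le> M * \<bar>s x - s y\<bar> * d + M * (\<bar>m\<bar> * \<bar>x - y\<bar>)"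
      using bspec[OF win, of x] x psi'_lipschitz psi'_le psi'_ge_0 M_ge_1
      by (intro add_mono mult_mono) auto
    finally show ?thesis using w by (simp add: sl algebra_simps)
  qed
  have d0: "d \<ge> 0" using bspec[OF win, of a] w by auto
  have 1: "\<bar>\<psi>' (s x) * (m * x + k) - \<psi>' (s y) * (m * y + k)\<bar> \<le> (M * d / w + M * \<bar>m\<bar>) * \<bar>x - y\<bar>"
  proof -
    consider "a \<le> x \<and> x \<le> a + w" | "a \<le> y \<and> y \<le> a + w"
      | "\<not> (a \<le> x \<and> x \<le> a + w)" "\<not> (a \<le> y \<and> y \<le> a + w)" by blast
    then show ?thesis
    proof cases
      case 1 then show ?thesis using aux by blast
    next
      case 2 then show ?thesis using aux[of y x] by (simp add: abs_minus_commute)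
    next
      case 3
      have "0 \<le> (M * d / w + M * \<bar>m\<bar>) * \<bar>x - y\<bar>" using d0 w M_ge_1 by simp
      then show ?thesis using out 3 by simp
    qed
  qed
  have 2: "\<bar>\<psi> (s x) * m - \<psi> (s y) * m\<bar> \<le> M * \<bar>m\<bar> / w * \<bar>x - y\<bar>"
  proof -
    have "\<bar>\<psi> (s x) * m - \<psi> (s y) * m\<bar> = \<bar>\<psi> (s x) - \<psi> (s y)\<bar> * \<bar>m\<bar>"
      by (simp add: abs_mult flip: left_diff_distrib)
    also have "\<dots> \<le> M * \<bar>s x - s y\<bar> * \<bar>m\<bar>"
      by (intro mult_right_mono psi_lipschitz) auto
    finally show ?thesis by (simp add: sl algebra_simps)
  qed
  have "blend_slope \<psi> \<psi>' a w m k x - blend_slope \<psi> \<psi>' a w m k y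
     = (\<psi>' (s x) * (m * x + k) - \<psi>' (s y) * (m * y + k)) / w + (\<psi> (s x) * m - \<psi> (s y) * m)"
    unfolding blend_slope_def s_def by (simp add: diff_divide_distrib)
  also have "\<bar>\<dots>\<bar> \<le> \<bar>\<psi>' (s x) * (m * x + k) - \<psi>' (s y) * (m * y + k)\<bar> / w + \<bar>\<psi> (s x) * m - \<psi> (s y) * m\<bar>"
    using w by (intro order_trans[OF abs_triangle_ineq]) (simp add: abs_divide)
  also have "\<dots> \<le> (M * d / w + M * \<bar>m\<bar>) * \<bar>x - y\<bar> / w + M * \<bar>m\<bar> / w * \<bar>x - y\<bar>"
    using 1 2 w by (intro add_mono divide_right_mono) auto
  also have "\<dots> = (M * d / w\<^sup>2 + 2 * M * \<bar>m\<bar> / w) * \<bar>x - y\<bar>"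
    using w by (simp add: field_simps power2_eq_square)
  finally show ?thesis .
qed

end

section \<open>Slopes and transition windows of the block\<close>

locale shear = bounded_cutoff +
  fixes t :: real
  assumes t_pos: "0 < t" and t_small: "t < 1 / 10"
begin

text \<open>The left ends of the two windows of length \<open>t^2\<close> that border the steep
  piece: the slope changes from \<open>t\<close> to \<open>1 / t\<close> at \<open>left_turn\<close>
  and back at \<open>right_turn\<close>.\<close>

definition "left_turn = (1 - t + 8 * t^2) / 2"
definition "right_turn = (1 + t - 10 * t^2) / 2"

abbreviation "off_left \<equiv> 1/2 - 1/(2*t) - 11/4 * t"
abbreviation "off_right \<equiv> 1/2 + 1/(2*t) - 15/4 * t"

lemma t_sq: "0 < t^2" "10 * t^2 < t"
  using t_pos t_small by (auto simp: power2_eq_square)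

lemma turn_order: "2 * t < left_turn" "left_turn + t^2 < right_turn" "right_turn + t^2 < 1 - 2 * t"
proof -
  have "5 * t < 1 + 8 * t^2" using t_sq t_small by linarith
  then show "2 * t < left_turn" "left_turn + t^2 < right_turn" "right_turn + t^2 < 1 - 2 * t"
    using t_sq by (simp_all add: left_turn_def right_turn_def field_simps)
qed

abbreviation "slope \<equiv> h_slope \<psi> \<psi>' t"

lemma slope_eq: "slope x = 1
     + blend_slope \<psi> \<psi>' t t (t - 1) (11/4 * t) x
     + blend_slope \<psi> \<psi>' left_turn (t^2) (1/t - t) off_left x
     + blend_slope \<psi> \<psi>' right_turn (t^2) (t - 1/t) off_right x
     + blend_slope \<psi> \<psi>' (1 - 2 * t) t (1 - t) (15/4 * t - 1) x"
  unfolding h_slope_def left_turn_def right_turn_def ..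

text \<open>The windows are disjoint and ordered. On each piece the earlier terms are already affine
  and the later ones still zero, so the sum telescopes to the current piece, with at most one term
  still blending.\<close>

lemma h_hat_eq: "h_hat \<psi> t x = x
     + blend_term \<psi> t t (t - 1) (11/4 * t) x
     + blend_term \<psi> left_turn (t^2) (1/t - t) off_left x
     + blend_term \<psi> right_turn (t^2) (t - 1/t) off_right x
     + blend_term \<psi> (1 - 2 * t) t (1 - t) (15/4 * t - 1) x"
proof -
  \<comment> \<open>\<open>w\<close> hides the square, whose positivity the simplifier would rewrite to \<open>t \<noteq> 0\<close>\<close>
  define w where "w = t^2"
  have "0 < w" using t_sq by (simp add: w_def)
  note o = turn_order[folded w_def] t_pos this
  have l: "(1 - t + 10 * w) / 2 = left_turn + w" and r: "(1 + t - 8 * w) / 2 = right_turn + w"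
    and l0: "(1 - t + 8 * w) / 2 = left_turn" and r0: "(1 + t - 10 * w) / 2 = right_turn"
    by (auto simp: left_turn_def right_turn_def w_def field_simps)
  have e: "x - 1 + 2 * t = x - (1 - 2 * t)" by simp
  have S: "blend_term \<psi> a w m k x = \<psi> ((x - a) / w) * (m * x + k)" for a w m k x
    by (rule blend_term_def)
  note defs = h_hat_def Let_def l r l0 r0 e w_def[symmetric]
  consider "x \<le> t" | "t < x" "x \<le> 2 * t" | "2 * t < x" "x \<le> left_turn"
    | "left_turn < x" "x \<le> left_turn + w" | "left_turn + w < x" "x \<le> right_turn"
    | "right_turn < x" "x \<le> right_turn + w" | "right_turn + w < x" "x \<le> 1 - 2 * t"
    | "1 - 2 * t < x" "x \<le> 1 - t" | "1 - t < x" by linarith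
  then show ?thesis
  proof cases
    case 1
    then show ?thesis using o unfolding defs
      by (simp add: blend_term_left blend_term_right) (simp add: field_simps)?
  next
    case 2
    then show ?thesis using o unfolding defs
      by (simp add: blend_term_left blend_term_right S[of t]) (simp add: field_simps)?
  next
    case 3
    then show ?thesis using o unfolding defs
      by (simp add: blend_term_left blend_term_right) (simp add: field_simps)?
  next
    case 4
    then show ?thesis using o unfolding defs
      by (simp add: blend_term_left blend_term_right S[of left_turn]) (simp add: field_simps)?
  next
    case 5
    then show ?thesis using o unfolding defs
      by (simp add: blend_term_left blend_term_right) (simp add: field_simps)?
  next
    case 6
    then show ?thesis using o unfolding defs
      by (simp add: blend_term_left blend_term_right S[of right_turn]) (simp add: field_simps)?
  next
    case 7
    then show ?thesis using o unfolding defs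
      by (simp add: blend_term_left blend_term_right) (simp add: field_simps)?
  next
    case 8
    then show ?thesis using o unfolding defs
      by (simp add: blend_term_left blend_term_right S[of "1 - 2 * t"]) (simp add: field_simps)?
  next
    case 9
    then show ?thesis using o unfolding defs
      by (simp add: blend_term_left blend_term_right) (simp add: field_simps)?
  qed
qed

lemma h_hat_deriv: "(h_hat \<psi> t has_real_derivative slope x) (at x)"
proof -
  have "((\<lambda>x. x
     + blend_term \<psi> t t (t - 1) (11/4 * t) x
     + blend_term \<psi> left_turn (t^2) (1/t - t) off_left x
     + blend_term \<psi> right_turn (t^2) (t - 1/t) off_right x
     + blend_term \<psi> (1 - 2 * t) t (1 - t) (15/4 * t - 1) x) has_real_derivative slope x) (at x)"
    unfolding slope_eq
    by (intro DERIV_add DERIV_ident blend_term_deriv t_pos t_sq)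
  then show ?thesis by (simp add: h_hat_eq[abs_def])
qed

text \<open>Across each of the four windows the incoming piece exceeds the outgoing one by at most
  \<open>2 * t\<close> and never falls below it. The sign makes the \<open>\<psi>'\<close> terms of
  the slope nonnegative, hence \<open>h_hat\<close> increasing.\<close>

lemma window1: "\<forall>x\<in>{t..t + t}. 0 \<le> (t - 1) * x + 11/4 * t \<and> (t - 1) * x + 11/4 * t \<le> 2 * t"
proof
  fix x assume "x \<in> {t..t + t}"
  then have x: "t \<le> x" "x \<le> t + t" by auto
  have "(1 - t) * t \<le> (1 - t) * x" "(1 - t) * x \<le> (1 - t) * (2 * t)"
    using x t_small by (intro mult_left_mono; simp)+
  moreover have "(1 - t) * t = t - t^2" "(1 - t) * (2 * t) = 2 * t - 2 * t^2"
    "(t - 1) * x = - ((1 - t) * x)"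
    by (simp_all add: algebra_simps power2_eq_square)
  ultimately show "0 \<le> (t - 1) * x + 11/4 * t \<and> (t - 1) * x + 11/4 * t \<le> 2 * t"
    using t_sq t_pos by linarith
qed

lemma window4: "\<forall>x\<in>{1 - 2 * t..1 - 2 * t + t}.
  0 \<le> (1 - t) * x + (15/4 * t - 1) \<and> (1 - t) * x + (15/4 * t - 1) \<le> 2 * t"
proof (intro ballI, rule affine_sandwich)
  fix x assume x: "x \<in> {1 - 2 * t..1 - 2 * t + t}"
  show "(1 - t) * (1 - 2 * t) \<le> (1 - t) * x" "(1 - t) * x \<le> (1 - t) * (1 - t)"
    using x t_small by (intro mult_left_mono; auto)+
  show "(1 - t) * (1 - 2 * t) + (15/4 * t - 1) = 3/4 * t + 2 * t^2"
    "(1 - t) * (1 - t) + (15/4 * t - 1) = 7/4 * t + t^2"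
    by (simp_all add: algebra_simps power2_eq_square)
  show "0 \<le> 3/4 * t + 2 * t^2" "7/4 * t + t^2 \<le> 2 * t" using t_pos t_sq by linarith+
qed

lemma t_cube: "0 < t^3" "100 * t^3 < t"
proof -
  show "0 < t^3" using t_pos by simp
  have "t * t^2 < t * (1/100)" using t_sq t_small t_pos by (intro mult_strict_left_mono) auto
  then show "100 * t^3 < t" by (simp add: power3_eq_cube power2_eq_square)
qed

lemma window2: "\<forall>x\<in>{left_turn..left_turn + t^2}.
  0 \<le> (1/t - t) * x + off_left \<and> (1/t - t) * x + off_left \<le> 2 * t"
proof (intro ballI, rule affine_sandwich)
  fix x assume x: "x \<in> {left_turn..left_turn + t^2}"
  have "t < 1 / t" using mult_strict_mono[of t 1 t 1] t_small t_pos by (simp add: field_simps)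
  then show "(1/t - t) * left_turn \<le> (1/t - t) * x" "(1/t - t) * x \<le> (1/t - t) * (left_turn + t^2)"
    using x by (intro mult_left_mono; auto)+
  show "(1/t - t) * left_turn + off_left = 3/4 * t + t^2/2 - 4 * t^3"
    using t_pos by (simp add: left_turn_def field_simps power2_eq_square power3_eq_cube)
  show "(1/t - t) * (left_turn + t^2) + off_left = 7/4 * t + t^2/2 - 5 * t^3"
    using t_pos by (simp add: left_turn_def field_simps power2_eq_square power3_eq_cube)
  have "\<And>u v. 0 < u \<Longrightarrow> 10 * u < t \<Longrightarrow> 0 < v \<Longrightarrow> 100 * v < t \<Longrightarrow>
      0 \<le> 3/4 * t + u / 2 - 4 * v \<and> 7/4 * t + u / 2 - 5 * v \<le> 2 * t
    \<and> 0 \<le> 7/4 * t + u / 2 - 5 * v \<and> 3/4 * t + u / 2 - 4 * v \<le> 2 * t" by linarith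
  from this[OF t_sq t_cube] show "0 \<le> 3/4 * t + t^2/2 - 4 * t^3" "7/4 * t + t^2/2 - 5 * t^3 \<le> 2 * t" by auto
qed

lemma window3: "\<forall>x\<in>{right_turn..right_turn + t^2}.
  0 \<le> (t - 1/t) * x + off_right \<and> (t - 1/t) * x + off_right \<le> 2 * t"
proof (intro ballI, rule affine_sandwich)
  fix x assume x: "x \<in> {right_turn..right_turn + t^2}"
  have "t < 1 / t" using mult_strict_mono[of t 1 t 1] t_small t_pos by (simp add: field_simps)
  then show "(t - 1/t) * (right_turn + t^2) \<le> (t - 1/t) * x" "(t - 1/t) * x \<le> (t - 1/t) * right_turn"
    using x by (intro mult_left_mono_neg; auto)+
  show "(t - 1/t) * right_turn + off_right = 7/4 * t + t^2/2 - 5 * t^3"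
    using t_pos by (simp add: right_turn_def field_simps power2_eq_square power3_eq_cube)
  show "(t - 1/t) * (right_turn + t^2) + off_right = 3/4 * t + t^2/2 - 4 * t^3"
    using t_pos by (simp add: right_turn_def field_simps power2_eq_square power3_eq_cube)
  have "\<And>u v. 0 < u \<Longrightarrow> 10 * u < t \<Longrightarrow> 0 < v \<Longrightarrow> 100 * v < t \<Longrightarrow>
      0 \<le> 3/4 * t + u / 2 - 4 * v \<and> 7/4 * t + u / 2 - 5 * v \<le> 2 * t
    \<and> 0 \<le> 7/4 * t + u / 2 - 5 * v \<and> 3/4 * t + u / 2 - 4 * v \<le> 2 * t" by linarith
  from this[OF t_sq t_cube] show "0 \<le> 3/4 * t + t^2/2 - 4 * t^3" "7/4 * t + t^2/2 - 5 * t^3 \<le> 2 * t" by auto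
qed

lemma t_inv: "t < 1" "1 < 1 / t" "t < 1 / t"
  using t_pos t_small mult_strict_mono[of t 1 t 1] by (simp_all add: field_simps)

text \<open>The weights satisfy \<open>s4 \<le> s3 \<le> s2 \<le> s1\<close>, because a window is
  entered only after the previous one has been left. Without the \<open>\<psi>'\<close> terms the
  slope thus stays between \<open>t\<close> and \<open>1 / t\<close>; those terms add at most
  \<open>2 * M\<close> for a window of length \<open>t\<close> and \<open>2 * M / t\<close> for one
  of length \<open>t^2\<close>.\<close>

lemma slope_ge: "t \<le> slope x" and slope_le: "slope x \<le> 9 * M / t"
proof -
  define s where "s a w = \<psi> ((x - a) / w)" for a w
  have L: "s a w = 0" if "x \<le> a" "0 < w" for a w
    unfolding s_def using that by (intro psi_left) (simp add: divide_nonpos_pos)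
  have R: "s a w = 1" if "x \<ge> a + w" "0 < w" for a w
    unfolding s_def using that by (intro psi_right) (simp add: field_simps)
  define s1 s2 s3 s4 where s_defs: "s1 = s t t" "s2 = s left_turn (t^2)" "s3 = s right_turn (t^2)" "s4 = s (1 - 2 * t) t"
  have s: "0 \<le> s1" "s1 \<le> 1" "0 \<le> s2" "s2 \<le> 1" "0 \<le> s3" "s3 \<le> 1" "0 \<le> s4" "s4 \<le> 1"
    by (simp_all add: s_defs s_def psi_ge_0 psi_le_1)
  note o = turn_order t_pos t_sq
  have "s2 = 0 \<or> s1 = 1" unfolding s_defs
    using L[of left_turn "t^2"] R[of t t] o by (cases "x \<le> left_turn") auto
  then have s21: "s2 \<le> s1" using s by auto
  have "s3 = 0 \<or> s2 = 1" unfolding s_defs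
    using L[of right_turn "t^2"] R[of left_turn "t^2"] o by (cases "x \<le> right_turn") auto
  then have s32: "s3 \<le> s2" using s by auto
  have "s4 = 0 \<or> s3 = 1" unfolding s_defs
    using L[of "1 - 2 * t" t] R[of right_turn "t^2"] o by (cases "x \<le> 1 - 2 * t") auto
  then have s43: "s4 \<le> s3" using s by auto
  note b1 = blend_slope_window_bounds[OF t_pos window1, of x, folded s_def]
  note b2 = blend_slope_window_bounds[OF t_sq(1) window2, of x, folded s_def]
  note b3 = blend_slope_window_bounds[OF t_sq(1) window3, of x, folded s_def]
  note b4 = blend_slope_window_bounds[OF t_pos window4, of x, folded s_def]
  have e: "M * (2 * t) / t = 2 * M" "M * (2 * t) / t^2 = 2 * M / t"
    using t_pos by (simp_all add: field_simps power2_eq_square)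
  \<comment> \<open>The third identity splits off \<open>s1 * (1/t - t)\<close>, which dominates the
    term of \<open>s2\<close> in the upper bound.\<close>
  have neg: "s1 * (t - 1) = - (s1 * (1 - t))" "s3 * (t - 1/t) = - (s3 * (1/t - t))"
    "s1 * (t - 1) = s1 * (1/t - 1) - s1 * (1/t - t)"
    by (simp_all add: algebra_simps)
  have "1 + s1 * (t - 1) + s2 * (1/t - t) + s3 * (t - 1/t) + s4 * (1 - t) \<le> slope x"
    unfolding slope_eq s_defs by (intro add_mono b1 b2 b3 b4 order_refl)
  note lower = this[unfolded neg(1,2)]
  have "A \<le> 1 - t \<Longrightarrow> 0 \<le> D \<Longrightarrow> C \<le> B \<Longrightarrow> 1 + - A + B + - C + D \<le> x \<Longrightarrow> t \<le> x" for A B C D x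
    by linarith
  from this[OF _ _ _ lower] show "t \<le> slope x"
    using mult_right_mono[OF s(2), of "1 - t"] mult_right_mono[OF s32, of "1/t - t"] s t_inv by simp
  have "slope x \<le> 1 + (s1 * (t - 1) + 2 * M) + (s2 * (1/t - t) + 2 * M / t)
      + (s3 * (t - 1/t) + 2 * M / t) + (s4 * (1 - t) + 2 * M)"
    unfolding slope_eq s_defs
    by (intro add_mono b1[unfolded e] b2[unfolded e] b3[unfolded e] b4[unfolded e] order_refl)
  note upper = this[unfolded neg(2,3)]
  have "B \<le> A \<Longrightarrow> D \<le> E \<Longrightarrow> E \<le> C \<Longrightarrow> F \<le> 1 / t - 1 \<Longrightarrow>
      x \<le> 1 + (F - A + 2 * M) + (B + 2 * M / t) + (- C + 2 * M / t) + (D + 2 * M) \<Longrightarrow>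
      x \<le> 1 / t + 4 * M + 4 * M / t" for A B C D E F x
    by linarith
  from this[OF mult_right_mono[OF s21] mult_right_mono[OF s43] mult_left_mono[OF _ s(5)] _ upper]
  have "slope x \<le> 1 / t + 4 * M + 4 * M / t"
    using mult_right_mono[OF s(2), of "1/t - 1"] t_inv by simp
  moreover have "1 / t \<le> M / t" "4 * M \<le> 4 * M / t"
    using M_ge_1 t_pos t_inv by (simp_all add: field_simps)
  ultimately show "slope x \<le> 9 * M / t" by (simp add: add_divide_distrib[symmetric])
qed

text \<open>The power \<open>t^3\<close> comes from the two windows of length \<open>t^2\<close>,
  where the slope changes by the order of \<open>1 / t\<close>. They contribute 4 each to the
  constant 12, the outer windows 2 each.\<close>

lemma slope_lipschitz: "\<bar>slope x - slope y\<bar> \<le> 12 * M / t^3 * \<bar>x - y\<bar>"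
proof -
  have d: "\<bar>(a1 + b1 + c1 + d1 + e) - (a1 + b2 + c2 + d2 + e2)\<bar>
      \<le> \<bar>b1 - b2\<bar> + \<bar>c1 - c2\<bar> + \<bar>d1 - d2\<bar> + \<bar>e - e2\<bar>" for a1 b1 b2 c1 c2 d1 d2 e e2 :: real
    by linarith
  have e1: "(M * (2 * t) / t\<^sup>2 + 2 * M * \<bar>t - 1\<bar> / t) \<le> 4 * M / t"
    "(M * (2 * t) / t\<^sup>2 + 2 * M * \<bar>1 - t\<bar> / t) \<le> 4 * M / t"
    using t_pos t_small M_ge_1 by (simp_all add: field_simps power2_eq_square)
  have le: "4 * M / t \<le> 2 * M / t^3"
    using t_pos t_sq t_small M_ge_1 by (simp add: field_simps power2_eq_square power3_eq_cube)
  have e2: "(M * (2 * t) / (t\<^sup>2)\<^sup>2 + 2 * M * \<bar>1/t - t\<bar> / t^2) \<le> 4 * M / t^3"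
    "(M * (2 * t) / (t\<^sup>2)\<^sup>2 + 2 * M * \<bar>t - 1/t\<bar> / t^2) \<le> 4 * M / t^3"
    using t_pos t_inv M_ge_1 by (simp_all add: field_simps power2_eq_square power3_eq_cube)
  have "\<bar>slope x - slope y\<bar> \<le> 2 * M / t^3 * \<bar>x - y\<bar> + 4 * M / t^3 * \<bar>x - y\<bar> + 4 * M / t^3 * \<bar>x - y\<bar> + 2 * M / t^3 * \<bar>x - y\<bar>"
    unfolding slope_eq
    apply (rule order_trans[OF d])
    apply (intro add_mono)
       apply (rule order_trans[OF blend_slope_lipschitz[OF t_pos window1] mult_right_mono[OF order_trans[OF e1(1) le]]]; simp)
      apply (rule order_trans[OF blend_slope_lipschitz[OF t_sq(1) window2] mult_right_mono[OF e2(1)]]; simp)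
     apply (rule order_trans[OF blend_slope_lipschitz[OF t_sq(1) window3] mult_right_mono[OF e2(2)]]; simp)
    apply (rule order_trans[OF blend_slope_lipschitz[OF t_pos window4] mult_right_mono[OF order_trans[OF e1(2) le]]]; simp)
    done
  also have "\<dots> = 12 * M / t^3 * \<bar>x - y\<bar>" by (simp add: field_simps)
  finally show ?thesis .
qed

lemma piece_order:
  "x \<le> t \<Longrightarrow> x \<le> left_turn" "x \<le> left_turn \<Longrightarrow> x \<le> right_turn" "x \<le> right_turn \<Longrightarrow> x \<le> 1 - 2 * t"
  "1 - 2 * t \<le> x \<Longrightarrow> right_turn + t^2 \<le> x" "right_turn + t^2 \<le> x \<Longrightarrow> left_turn + t^2 \<le> x"
  "left_turn + t^2 \<le> x \<Longrightarrow> t + t \<le> x"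
  using turn_order t_pos t_sq(1) by linarith+

lemma slope_vals:
  "x \<le> t \<Longrightarrow> slope x = 1"
  "2 * t \<le> x \<Longrightarrow> x \<le> left_turn \<Longrightarrow> slope x = t"
  "left_turn + t^2 \<le> x \<Longrightarrow> x \<le> right_turn \<Longrightarrow> slope x = 1 / t"
  "right_turn + t^2 \<le> x \<Longrightarrow> x \<le> 1 - 2 * t \<Longrightarrow> slope x = t"
  "1 - t \<le> x \<Longrightarrow> slope x = 1"
  using piece_order[of x] t_pos t_sq(1) unfolding slope_eq
  by (simp_all add: blend_slope_left blend_slope_right)

text \<open>Away from the steep piece and its two windows the slope has a bound free of
  \<open>t\<close>, outer windows included. The contrast with \<open>1 / t\<close> is what
  \<open>near_period_of_slope_comparison\<close> exploits.\<close>

lemma slope_left_le: "x \<le> left_turn \<Longrightarrow> slope x \<le> 3 * M"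
proof -
  assume x: "x \<le> left_turn"
  have e: "M * (2 * t) / t = 2 * M" using t_pos by simp
  have "slope x = 1 + blend_slope \<psi> \<psi>' t t (t - 1) (11/4 * t) x"
    using piece_order[of x] t_pos t_sq(1) x unfolding slope_eq by (simp add: blend_slope_left)
  also have "\<dots> \<le> 1 + (\<psi> ((x - t) / t) * (t - 1) + 2 * M)"
    using blend_slope_window_bounds(2)[OF t_pos window1, of x] unfolding e by simp
  also have "\<psi> ((x - t) / t) * (t - 1) \<le> 0"
    using psi_ge_0 t_inv by (simp add: mult_nonneg_nonpos)
  finally show ?thesis using M_ge_1 by simp
qed

lemma slope_right_le: "right_turn + t^2 \<le> x \<Longrightarrow> slope x \<le> 3 * M"
proof -
  assume x: "right_turn + t^2 \<le> x"
  have e: "M * (2 * t) / t = 2 * M" using t_pos by simp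
  have "slope x = t + blend_slope \<psi> \<psi>' (1 - 2 * t) t (1 - t) (15/4 * t - 1) x"
    using piece_order[of x] t_pos t_sq(1) x unfolding slope_eq by (simp add: blend_slope_right)
  also have "\<dots> \<le> t + (\<psi> ((x - (1 - 2 * t)) / t) * (1 - t) + 2 * M)"
    using blend_slope_window_bounds(2)[OF t_pos window4, of x] unfolding e by simp
  also have "\<psi> ((x - (1 - 2 * t)) / t) * (1 - t) \<le> 1 * (1 - t)"
    using psi_le_1 t_inv by (intro mult_right_mono) auto
  finally show ?thesis using M_ge_1 by simp
qed

lemma h_hat_id: "x \<le> t \<or> 1 - t \<le> x \<Longrightarrow> h_hat \<psi> t x = x"
  using piece_order[of x] t_pos t_sq(1) unfolding h_hat_eq
  by (auto simp: blend_term_left blend_term_right algebra_simps)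

text \<open>The ends of a window lie on affine pieces, so its image length is explicit:
  \<open>7/4 * t\<close> plus terms of higher order. These lengths bound the images of the zones
  where the map is not affine.\<close>

lemma h_hat_jumps:
  "h_hat \<psi> t (2 * t) - h_hat \<psi> t t \<le> 2 * t"
  "h_hat \<psi> t (left_turn + t^2) - h_hat \<psi> t left_turn \<le> 2 * t"
  "h_hat \<psi> t (right_turn + t^2) - h_hat \<psi> t right_turn \<le> 2 * t"
  "h_hat \<psi> t (1 - t) - h_hat \<psi> t (1 - 2 * t) \<le> 2 * t"
proof -
  have v: "h_hat \<psi> t x = t * x + 11/4 * t" if "2 * t \<le> x" "x \<le> left_turn" for x
    using piece_order[of x] that t_pos t_sq(1) unfolding h_hat_eq
    by (simp add: blend_term_left blend_term_right) (simp add: algebra_simps)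
  have v2: "h_hat \<psi> t x = (x - 1/2) / t + 1/2" if "left_turn + t^2 \<le> x" "x \<le> right_turn" for x
    using piece_order[of x] that t_pos t_sq(1) unfolding h_hat_eq
    by (simp add: blend_term_left blend_term_right) (simp add: field_simps)
  have v3: "h_hat \<psi> t x = t * x + 1 - 15/4 * t" if "right_turn + t^2 \<le> x" "x \<le> 1 - 2 * t" for x
    using piece_order[of x] that t_pos t_sq(1) unfolding h_hat_eq
    by (simp add: blend_term_left blend_term_right) (simp add: field_simps)
  have c: "0 < u \<Longrightarrow> 10 * u < t \<Longrightarrow> 0 < v \<Longrightarrow> 7/4 * t + u / 2 - 4 * v \<le> 2 * t" for u v by linarith
  note c = c[OF t_sq t_cube(1)]
  note o = turn_order t_pos
  have "h_hat \<psi> t (2 * t) - h_hat \<psi> t t = 7/4 * t + 2 * t^2"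
    using o by (simp add: v h_hat_id power2_eq_square)
  also have "\<dots> \<le> 2 * t" using t_sq by linarith
  finally show "h_hat \<psi> t (2 * t) - h_hat \<psi> t t \<le> 2 * t" .
  have "h_hat \<psi> t (left_turn + t^2) - h_hat \<psi> t left_turn
      = ((left_turn + t^2) - 1/2) / t + 1/2 - (t * left_turn + 11/4 * t)"
    using o by (simp add: v v2)
  also have "\<dots> = 7/4 * t + t^2/2 - 4 * t^3"
    using t_pos by (simp add: left_turn_def field_simps power2_eq_square power3_eq_cube)
  finally show "h_hat \<psi> t (left_turn + t^2) - h_hat \<psi> t left_turn \<le> 2 * t"
    using c by simp
  have "h_hat \<psi> t (right_turn + t^2) - h_hat \<psi> t right_turn
      = t * (right_turn + t^2) + 1 - 15/4 * t - ((right_turn - 1/2) / t + 1/2)"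
    using o by (simp add: v3 v2)
  also have "\<dots> = 7/4 * t + t^2/2 - 4 * t^3"
    using t_pos by (simp add: right_turn_def field_simps power2_eq_square power3_eq_cube)
  finally show "h_hat \<psi> t (right_turn + t^2) - h_hat \<psi> t right_turn \<le> 2 * t"
    using c by simp
  have "h_hat \<psi> t (1 - t) - h_hat \<psi> t (1 - 2 * t) = (1 - t) - (t * (1 - 2 * t) + 1 - 15/4 * t)"
    using o by (simp add: v3 h_hat_id)
  also have "\<dots> = 7/4 * t + 2 * t^2" by (simp add: algebra_simps power2_eq_square)
  also have "\<dots> \<le> 2 * t" using t_sq by linarith
  finally show "h_hat \<psi> t (1 - t) - h_hat \<psi> t (1 - 2 * t) \<le> 2 * t" .
qed

end

section \<open>Lifts with controlled slope and distortion\<close>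

text \<open>The last clause says that \<open>ln g'\<close> is Lipschitz with constant \<open>W\<close>.\<close>

definition tame :: "(real \<Rightarrow> real) \<Rightarrow> (real \<Rightarrow> real) \<Rightarrow> real \<Rightarrow> real \<Rightarrow> real \<Rightarrow> bool" where
  "tame g g' m L W \<longleftrightarrow> 0 < m \<and> 0 \<le> W \<and> g 0 = 0 \<and> (\<forall>x. g (x + 1) = g x + 1) \<and>
     (\<forall>x. (g has_real_derivative g' x) (at x) \<and> m \<le> g' x \<and> g' x \<le> L) \<and>
     (\<forall>x y. g' x \<le> exp (W * \<bar>x - y\<bar>) * g' y)"

lemma tameI:
  assumes "0 < m" "0 \<le> W" "g 0 = 0" "\<And>x. g (x + 1) = g x + 1"
    "\<And>x. (g has_real_derivative g' x) (at x)" "\<And>x. m \<le> g' x" "\<And>x. g' x \<le> L"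
    "\<And>x y. g' x \<le> exp (W * \<bar>x - y\<bar>) * g' y"
  shows "tame g g' m L W"
  using assms unfolding tame_def by blast

lemma tameD:
  assumes "tame g g' m L W"
  shows "0 < m" "0 \<le> W" "g 0 = 0" "g (x + 1) = g x + 1" "(g has_real_derivative g' x) (at x)"
    "m \<le> g' x" "g' x \<le> L" "g' x \<le> exp (W * \<bar>x - y\<bar>) * g' y" "0 < g' x" "0 < L"
proof -
  show "0 < m" "0 \<le> W" "g 0 = 0" "g (x + 1) = g x + 1" "(g has_real_derivative g' x) (at x)"
    "m \<le> g' x" "g' x \<le> L" "g' x \<le> exp (W * \<bar>x - y\<bar>) * g' y"
    using assms by (simp_all add: tame_def)
  then show "0 < g' x" "0 < L" by linarith+
qed

lemma tame_mono: "tame g g' m L W \<Longrightarrow> strict_mono g"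
  by (rule strict_monoI) (meson tameD(5,9) DERIV_pos_imp_increasing)

lemma tame_lipschitz: "tame g g' m L W \<Longrightarrow> \<bar>g x - g y\<bar> \<le> L * \<bar>x - y\<bar>"
  using field_differentiable_bound[of UNIV g g' L x y] tameD(5,7,9)[of g g' m L W]
  by (simp add: has_field_derivative_at_within less_imp_le)

lemma tame_continuous: "tame g g' m L W \<Longrightarrow> continuous_on S g"
  by (meson DERIV_continuous_on tameD(5) has_field_derivative_at_within)

lemma lift_add_of_int:
  fixes g :: "real \<Rightarrow> real"
  assumes "\<And>x. g (x + 1) = g x + 1"
  shows "g (x + of_int k) = g x + of_int k"
proof (induction k rule: int_induct[where k = 0])
  case (step1 i)
  then show ?case using assms[of "x + of_int i"] by (simp add: algebra_simps)
next
  case (step2 i)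
  then show ?case using assms[of "x + of_int (i - 1)"] by (simp add: algebra_simps)
qed simp

lemma tame_bij: assumes "tame g g' m L W" shows "bij g"
proof -
  have "\<exists>x. g x = y" for y
  proof -
    define k where "k = \<lfloor>y\<rfloor>"
    have "g (of_int k) = of_int k" "g (of_int (k + 1)) = of_int (k + 1)"
      using lift_add_of_int[of g 0 k] lift_add_of_int[of g 0 "k + 1"] tameD(3,4)[OF assms] by simp_all
    then have "\<exists>x\<ge>of_int k. x \<le> of_int (k + 1) \<and> g x = y"
      by (intro IVT' tame_continuous[OF assms]) (auto simp: k_def less_imp_le)
    then show ?thesis by blast
  qed
  then show ?thesis
    using tame_mono[OF assms] by (metis bijI strict_mono_imp_inj_on surjI)
qed

lemma tame_id: "tame id (\<lambda>_. 1) 1 1 0"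
  by (rule tameI) (auto simp: id_def)

text \<open>The logarithm of the slope of the composition is \<open>ln F'\<close> at
  \<open>g x\<close> plus \<open>ln g'\<close> at \<open>x\<close>. The first summand has Lipschitz
  constant \<open>W1 * L2\<close>, since \<open>g\<close> stretches by at most
  \<open>L2\<close>.\<close>

lemma tame_comp:
  assumes F: "tame F F' m1 L1 W1" and g: "tame g g' m2 L2 W2"
  shows "tame (F \<circ> g) (\<lambda>x. F' (g x) * g' x) (m1 * m2) (L1 * L2) (W1 * L2 + W2)"
proof (rule tameI)
  show "0 < m1 * m2" "0 \<le> W1 * L2 + W2" "(F \<circ> g) 0 = 0"
    using tameD[OF F] tameD[OF g] by auto
  fix x y
  show "(F \<circ> g) (x + 1) = (F \<circ> g) x + 1"
    by (simp add: tameD(4)[OF F] tameD(4)[OF g])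
  show "(F \<circ> g has_real_derivative F' (g x) * g' x) (at x)"
    using DERIV_chain[OF tameD(5)[OF F] tameD(5)[OF g]] .
  show "m1 * m2 \<le> F' (g x) * g' x" "F' (g x) * g' x \<le> L1 * L2"
    using tameD(1)[OF F] tameD(1)[OF g] tameD(6,7,9)[OF F, of "g x"] tameD(6,7,9)[OF g, of x] by (auto intro!: mult_mono)
  have "F' (g x) \<le> exp (W1 * (L2 * \<bar>x - y\<bar>)) * F' (g y)"
    using tameD(8)[OF F, of "g x" "g y"] tame_lipschitz[OF g, of x y] tameD(2)[OF F] tameD(9)[OF F, of "g y"]
    by (smt (verit) exp_le_cancel_iff mult_left_mono mult_right_mono)
  then have "F' (g x) * g' x \<le> (exp (W1 * (L2 * \<bar>x - y\<bar>)) * F' (g y)) * (exp (W2 * \<bar>x - y\<bar>) * g' y)"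
    using tameD(8)[OF g, of x y] tameD(9)[OF F, of "g y"] tameD(9)[OF g, of x]
    by (intro mult_mono) auto
  then show "F' (g x) * g' x \<le> exp ((W1 * L2 + W2) * \<bar>x - y\<bar>) * (F' (g y) * g' y)"
    by (simp add: exp_add algebra_simps)
qed

text \<open>The logarithm of the slope of the inverse is \<open>- ln g'\<close> at
  \<open>inv g x\<close>, and \<open>inv g\<close> has Lipschitz constant \<open>1 / m\<close>. The
  same Lipschitz bound gives the continuity that the inverse function rule requires.\<close>

lemma tame_inv:
  assumes g: "tame g g' m L W"
  shows "tame (inv g) (\<lambda>x. 1 / g' (inv g x)) (1 / L) (1 / m) (W / m)"
proof (rule tameI)
  note b = tame_bij[OF g]
  have gi [simp]: "g (inv g x) = x" "inv g (g x) = x" for x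
    using b by (simp_all add: bij_is_surj surj_f_inv_f bij_is_inj)
  show "0 < 1 / L" "0 \<le> W / m" using tameD[OF g] by auto
  show "inv g 0 = 0" using gi(2)[of 0] tameD(3)[OF g] by simp
  fix x y
  show "inv g (x + 1) = inv g x + 1"
    using gi(2)[of "inv g x + 1"] tameD(4)[OF g, of "inv g x"] by simp
  have low: "m * \<bar>x - y\<bar> \<le> \<bar>g x - g y\<bar>" for x y
  proof (induction x y rule: linorder_wlog)
    case (le x y)
    show ?case
    proof (cases "x < y")
      case True
      then obtain z where "g y - g x = (y - x) * g' z"
        using MVT2[of x y g g'] tameD(5)[OF g] by blast
      moreover have "m * (y - x) \<le> (y - x) * g' z"
        using True tameD(6)[OF g, of z] by (simp add: mult.commute mult_left_mono)
      ultimately have "m * (y - x) \<le> g y - g x" by simp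
      then show ?thesis using True by simp
    qed (use le in simp)
  qed (simp add: abs_minus_commute)
  have lip: "\<bar>inv g x - inv g y\<bar> \<le> \<bar>x - y\<bar> / m" for x y
    using low[of "inv g x" "inv g y"] tameD(1)[OF g] by (simp add: field_simps)
  have "continuous_on UNIV (inv g)"
  proof (rule continuous_on_subset)
    have "(1 / m)-lipschitz_on UNIV (inv g)"
      using lip tameD(1)[OF g] by (intro lipschitz_onI) (auto simp: dist_real_def)
    then show "continuous_on UNIV (inv g)" by (rule lipschitz_on_continuous_on)
  qed simp
  then have "isCont (inv g) x" by (simp add: continuous_on_eq_continuous_at)
  then show "(inv g has_real_derivative 1 / g' (inv g x)) (at x)"
    using DERIV_inverse_function[of g "g' (inv g x)" "inv g" x "x - 1" "x + 1"] tameD(5,9)[OF g, of "inv g x"]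
    by (simp add: inverse_eq_divide)
  show "1 / L \<le> 1 / g' (inv g x)" "1 / g' (inv g x) \<le> 1 / m"
    using tameD(1)[OF g] tameD(6,7,9)[OF g, of "inv g x"] by (simp_all add: frac_le)
  have "g' (inv g y) \<le> exp (W * \<bar>inv g y - inv g x\<bar>) * g' (inv g x)" by (rule tameD(8)[OF g])
  also have "\<dots> \<le> exp (W / m * \<bar>x - y\<bar>) * g' (inv g x)"
    using mult_left_mono[OF lip[of y x] tameD(2)[OF g]] tameD(9)[OF g, of "inv g x"]
    by (intro mult_right_mono) (auto simp: abs_minus_commute)
  finally show "1 / g' (inv g x) \<le> exp (W / m * \<bar>x - y\<bar>) * (1 / g' (inv g y))"
    using tameD(9)[OF g, of "inv g x"] tameD(9)[OF g, of "inv g y"] by (simp add: field_simps)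
qed

lemma tame_weaken:
  "tame g g' m L W \<Longrightarrow> 0 < m' \<Longrightarrow> m' \<le> m \<Longrightarrow> L \<le> L' \<Longrightarrow> W \<le> W' \<Longrightarrow> tame g g' m' L' W'"
proof (rule tameI)
  assume g: "tame g g' m L W" and le: "0 < m'" "m' \<le> m" "L \<le> L'" "W \<le> W'"
  show "0 < m'" "0 \<le> W'" "g 0 = 0" using tameD[OF g] le by auto
  fix x y
  show "g (x + 1) = g x + 1" "(g has_real_derivative g' x) (at x)" "m' \<le> g' x" "g' x \<le> L'"
    using tameD(4-7)[OF g, of x] le by auto
  have "exp (W * \<bar>x - y\<bar>) * g' y \<le> exp (W' * \<bar>x - y\<bar>) * g' y"
    using le tameD(9)[OF g, of y] by (intro mult_right_mono) (auto simp: mult_right_mono)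
  then show "g' x \<le> exp (W' * \<bar>x - y\<bar>) * g' y"
    using tameD(8)[OF g, of x y] by linarith
qed

section \<open>The periodic maps of one level\<close>

text \<open>\<open>Z\<close> collects the transition zones in one period; every interval that avoids the
  translates of the zones lies in a single affine piece of \<open>g\<close>.\<close>

definition affine_off_zones :: "real \<Rightarrow> nat \<Rightarrow> (real \<Rightarrow> real) \<Rightarrow> (real \<Rightarrow> real) \<Rightarrow> bool" where
  "affine_off_zones t Q g g' \<longleftrightarrow> (\<exists>Z. finite Z \<and> card Z \<le> 4 \<and>
     (\<forall>a b. (a, b) \<in> Z \<longrightarrow> 0 \<le> a \<and> a \<le> b \<and> b \<le> 1 / real Q \<and> g b - g a \<le> 2 * t / real Q) \<and>
     (\<forall>x y. x \<le> y \<longrightarrow>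
       (\<forall>a b. (a, b) \<in> Z \<longrightarrow> (\<forall>l. y \<le> a + of_int l / real Q \<or> b + of_int l / real Q \<le> x)) \<longrightarrow>
       g' x = g' y))"

text \<open>What \<open>h_bar\<close> and its inverse have in common, so that later arguments do not
  distinguish the two symbols. The power \<open>t^5\<close> exceeds the \<open>t^4\<close> of
  \<open>h_bar\<close> itself because inversion divides the distortion constant by the least slope
  \<open>t\<close>.\<close>

definition step_map ::
    "real \<Rightarrow> real \<Rightarrow> nat \<Rightarrow> nat \<Rightarrow> (real \<Rightarrow> real) \<Rightarrow> (real \<Rightarrow> real) \<Rightarrow> bool" where
  "step_map C t Q n g g' \<longleftrightarrow>
     tame g g' (t / C) (C / t) (2 * C * 2 ^ (n + 1) * real Q / t^5) \<and>
     (\<forall>x. 1 / 2 ^ (n + 1) \<le> real Q * x - of_int \<lfloor>real Q * x\<rfloor> \<longrightarrow> g x = x) \<and>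
     (\<forall>x. \<bar>g x - x\<bar> \<le> 1 / (2 ^ (n + 1) * real Q)) \<and>
     (\<forall>x k. g (x + of_int k / real Q) = g x + of_int k / real Q) \<and>
     affine_off_zones t Q g g'"

locale level = shear +
  fixes Q n :: nat
  assumes Q_pos: "0 < Q" and n_pos: "1 \<le> n" and t_eq: "t = t_param Q n"
begin

definition c :: real where "c = 2 ^ (n + 1)"

lemma c_ge: "4 \<le> c"
proof -
  have "(2::real) ^ 2 \<le> 2 ^ (n + 1)" using n_pos by (intro power_increasing) auto
  then show ?thesis by (simp add: c_def)
qed

abbreviation "g \<equiv> h_bar \<psi> Q n"

text \<open>The rescaling factors \<open>c * Q\<close> and \<open>1 / (c * Q)\<close> of the block
  cancel in the slope.\<close>

definition g' :: "real \<Rightarrow> real" where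
  "g' x = slope (c * (real Q * x - of_int \<lfloor>real Q * x\<rfloor>))"

text \<open>One formula holds on the period of index \<open>l\<close> and on half a period before
  it: there the true map is the identity because \<open>4 \<le> c\<close>, and so is
  \<open>h_hat\<close> left of 0. The overlap gives differentiability at the multiples of
  \<open>1 / Q\<close> and lets points half a period apart share a formula.\<close>

lemma g_window:
  assumes "- (1/2) \<le> real Q * x - of_int l" "real Q * x - of_int l \<le> 1"
  shows "g x = (of_int l + h_hat \<psi> t (c * (real Q * x - of_int l)) / c) / real Q"
proof -
  define y where "y = real Q * x - of_int l"
  have br: "h_breve \<psi> Q n z = (if z \<le> 1 / c then h_hat \<psi> t (c * z) / c else z)" for z
    by (simp add: h_breve_def c_def t_eq)
  consider "y < 0" | "0 \<le> y" "y < 1" | "y = 1" using assms unfolding y_def by linarith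
  then show ?thesis
  proof cases
    case 1
    then have f: "\<lfloor>real Q * x\<rfloor> = l - 1" using assms unfolding y_def by linarith
    have "1 / c \<le> 1 / 4" using c_ge by (simp add: field_simps)
    then have gt: "\<not> y + 1 \<le> 1 / c" using assms unfolding y_def by linarith
    have "c * y \<le> t" using 1 c_ge t_pos by (smt (verit) mult_pos_neg)
    then have "h_hat \<psi> t (c * y) / c = y" using c_ge by (simp add: h_hat_id)
    moreover have "real Q * x - of_int \<lfloor>real Q * x\<rfloor> = y + 1" by (simp add: f y_def)
    ultimately have "g x = (of_int (l - 1) + (y + 1)) / real Q"
      using gt unfolding h_bar_def br by (simp only: f if_False)
    then show ?thesis using \<open>h_hat \<psi> t (c * y) / c = y\<close> unfolding y_def[symmetric] by simp
  next
    case 2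
    then have f: "\<lfloor>real Q * x\<rfloor> = l" using assms unfolding y_def by linarith
    have "h_breve \<psi> Q n y = h_hat \<psi> t (c * y) / c"
    proof (cases "y \<le> 1 / c")
      case False
      then have "1 - t \<le> c * y" using c_ge t_pos by (simp add: field_simps)
      then show ?thesis using False c_ge by (simp add: br h_hat_id)
    qed (simp add: br)
    then show ?thesis by (simp add: h_bar_def f y_def)
  next
    case 3
    then have Qx: "real Q * x = of_int (l + 1)" by (simp add: y_def)
    then have f: "\<lfloor>real Q * x\<rfloor> = l + 1" by (metis floor_of_int)
    have "h_hat \<psi> t c = c" using c_ge t_pos by (intro h_hat_id) simp
    moreover have "h_hat \<psi> t 0 = 0" using t_pos by (intro h_hat_id) simp
    ultimately show ?thesis using 3 c_ge unfolding h_bar_def br y_def[symmetric] f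
      by (simp add: Qx)
  qed
qed

lemma g'_window:
  assumes "- (1/2) \<le> real Q * x - of_int l" "real Q * x - of_int l \<le> 1"
  shows "g' x = slope (c * (real Q * x - of_int l))"
proof -
  define y where "y = real Q * x - of_int l"
  consider "y < 0" | "0 \<le> y" "y < 1" | "y = 1" using assms unfolding y_def by linarith
  then show ?thesis
  proof cases
    case 1
    then have f: "\<lfloor>real Q * x\<rfloor> = l - 1" using assms unfolding y_def by linarith
    have e: "real Q * x - of_int (l - 1) = y + 1" by (simp add: y_def)
    have "4 * (1 / 2) \<le> c * (y + 1)" using c_ge assms 1 unfolding y_def by (intro mult_mono) auto
    then have "1 - t \<le> c * (y + 1)" using t_pos by simp
    moreover have "c * y \<le> t" using 1 c_ge t_pos by (smt (verit) mult_pos_neg)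
    moreover have "g' x = slope (c * (y + 1))" unfolding g'_def f e ..
    ultimately show ?thesis by (simp add: slope_vals flip: y_def)
  next
    case 2
    then have f: "\<lfloor>real Q * x\<rfloor> = l" using assms unfolding y_def by linarith
    then show ?thesis by (simp add: g'_def)
  next
    case 3
    then have Qx: "real Q * x = of_int (l + 1)" by (simp add: y_def)
    then have f: "\<lfloor>real Q * x\<rfloor> = l + 1" by (metis floor_of_int)
    show ?thesis using c_ge t_pos unfolding g'_def f by (simp add: Qx slope_vals)
  qed
qed

lemma g_deriv: "(g has_real_derivative g' x) (at x)"
proof -
  define l where "l = \<lfloor>real Q * x\<rfloor>"
  define S where "S = {y. - (1/2) < real Q * y - of_int l} \<inter> {y. real Q * y - of_int l < 1}"
  have l: "0 \<le> real Q * x - of_int l" "real Q * x - of_int l < 1" by (auto simp: l_def) linarith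
  have "((\<lambda>x. c * (real Q * x - of_int l)) has_real_derivative c * real Q) (at x)"
    by (auto intro!: derivative_eq_intros)
  from DERIV_chain2[OF h_hat_deriv this]
  have "((\<lambda>x. h_hat \<psi> t (c * (real Q * x - of_int l))) has_real_derivative
      slope (c * (real Q * x - of_int l)) * (c * real Q)) (at x)" .
  then have "((\<lambda>x. (of_int l + h_hat \<psi> t (c * (real Q * x - of_int l)) / c) / real Q) has_real_derivative
      g' x) (at x)"
    unfolding g'_window[OF order_trans[OF _ l(1)] less_imp_le[OF l(2)], simplified]
    by (auto intro!: derivative_eq_intros simp: Q_pos) (use c_ge Q_pos in auto)
  then show ?thesis
  proof (rule has_field_derivative_transform_within_open)
    show "open S" unfolding S_def
      by (intro open_Int open_Collect_less continuous_intros)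
    show "x \<in> S" using l by (simp add: S_def)
  qed (auto simp: S_def g_window[of _ l])
qed

lemma floor_shift: "\<lfloor>real Q * (x + of_int k / real Q)\<rfloor> = \<lfloor>real Q * x\<rfloor> + k"
  using Q_pos by (simp add: distrib_left)

lemma g_shift: "g (x + of_int k / real Q) = g x + of_int k / real Q"
  unfolding h_bar_def floor_shift using Q_pos by (simp add: distrib_left add_divide_distrib)

lemma g'_shift: "g' (x + of_int k / real Q) = g' x"
  unfolding g'_def floor_shift using Q_pos by (simp add: distrib_left)

lemma g_0: "g 0 = 0"
  using g_window[of 0 0] h_hat_id[of 0] t_pos by simp

lemma nearest_shift:
  obtains k :: int where "\<bar>z - of_int k / real Q\<bar> \<le> 1 / (2 * real Q)"
proof
  have "\<bar>real Q * z - of_int (round (real Q * z))\<bar> \<le> 1 / 2"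
    using of_int_round_abs_le[of "real Q * z"] by (simp add: abs_minus_commute)
  then have "\<bar>real Q * z - of_int (round (real Q * z))\<bar> / real Q \<le> 1 / 2 / real Q"
    by (rule divide_right_mono) simp
  moreover have "z - of_int (round (real Q * z)) / real Q = (real Q * z - of_int (round (real Q * z))) / real Q"
    using Q_pos by (simp add: field_simps)
  then have "\<bar>z - of_int (round (real Q * z)) / real Q\<bar> = \<bar>real Q * z - of_int (round (real Q * z))\<bar> / real Q"
    by (simp add: abs_divide)
  ultimately show "\<bar>z - of_int (round (real Q * z)) / real Q\<bar> \<le> 1 / (2 * real Q)" by simp
qed

text \<open>Points at most half a period apart share a window of \<open>g'_window\<close>. For
  others, \<open>y\<close> is moved by the multiple of the period that brings it nearest to
  \<open>x\<close>; this keeps its slope and only shortens the distance.\<close>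

lemma g'_lipschitz: "\<bar>g' x - g' y\<bar> \<le> 12 * M / t^3 * c * real Q * \<bar>x - y\<bar>"
proof -
  have near: "\<bar>g' x - g' y\<bar> \<le> 12 * M / t^3 * c * real Q * \<bar>x - y\<bar>"
    if "\<bar>x - y\<bar> \<le> 1 / (2 * real Q)" for x y
    using that
  proof (induction x y rule: linorder_wlog)
    case (le x y)
    define l where "l = \<lfloor>real Q * y\<rfloor>"
    have l: "0 \<le> real Q * y - of_int l" "real Q * y - of_int l < 1" by (auto simp: l_def) linarith
    have "real Q * y - real Q * x \<le> 1 / 2" "real Q * x \<le> real Q * y"
      using le Q_pos by (auto simp: field_simps)
    then have w: "- (1/2) \<le> real Q * x - of_int l" "real Q * x - of_int l \<le> 1" using l by linarith+
    have "\<bar>g' x - g' y\<bar> = \<bar>slope (c * (real Q * x - of_int l)) - slope (c * (real Q * y - of_int l))\<bar>"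
      using g'_window[OF w] g'_window[of y l] l by simp
    also have "\<dots> \<le> 12 * M / t^3 * \<bar>c * (real Q * x - of_int l) - c * (real Q * y - of_int l)\<bar>"
      by (rule slope_lipschitz)
    also have "c * (real Q * x - of_int l) - c * (real Q * y - of_int l) = c * real Q * (x - y)"
      by (simp add: algebra_simps)
    finally show ?case using c_ge by (simp add: abs_mult mult.assoc)
  next
    case (sym x y) then show ?case by (simp add: abs_minus_commute)
  qed
  show ?thesis
  proof (cases "\<bar>x - y\<bar> \<le> 1 / (2 * real Q)")
    case False
    obtain k where k: "\<bar>(x - y) - of_int k / real Q\<bar> \<le> 1 / (2 * real Q)" by (rule nearest_shift)
    have "\<bar>g' x - g' (y + of_int k / real Q)\<bar> \<le> 12 * M / t^3 * c * real Q * \<bar>x - (y + of_int k / real Q)\<bar>"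
      using k by (intro near) (simp add: algebra_simps)
    also have "\<dots> \<le> 12 * M / t^3 * c * real Q * \<bar>x - y\<bar>"
      using k False c_ge M_ge_1 t_pos by (intro mult_left_mono) (auto simp: algebra_simps)
    finally show ?thesis by (simp add: g'_shift)
  qed (rule near)
qed

lemma tame_g: "tame g g' t (9 * M / t) (12 * M / t^4 * c * real Q)"
proof (rule tameI)
  show "0 < t" by (rule t_pos)
  show W: "0 \<le> 12 * M / t^4 * c * real Q" using M_ge_1 c_ge by simp
  show "g 0 = 0" by (rule g_0)
  fix x y
  show "g (x + 1) = g x + 1" using g_shift[of x "int Q"] Q_pos by simp
  show "(g has_real_derivative g' x) (at x)" by (rule g_deriv)
  show ge: "t \<le> g' x" "g' x \<le> 9 * M / t" for x unfolding g'_def by (rule slope_ge slope_le)+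
  have e: "12 * M / t^4 * c * real Q * \<bar>x - y\<bar> * t = 12 * M / t^3 * c * real Q * \<bar>x - y\<bar>"
    using t_pos by (simp add: power_eq_if)
  \<comment> \<open>An additive Lipschitz bound becomes a multiplicative one because
    \<open>t \<le> g' y\<close>; this costs the fourth factor \<open>t\<close> in the denominator.
    Then \<open>1 + z \<le> exp z\<close>.\<close>
  have "g' x \<le> g' y + 12 * M / t^3 * c * real Q * \<bar>x - y\<bar>" using g'_lipschitz[of x y] by linarith
  also have "\<dots> \<le> g' y + 12 * M / t^4 * c * real Q * \<bar>x - y\<bar> * g' y"
    unfolding e[symmetric] using ge[of y] by (intro add_left_mono mult_left_mono mult_nonneg_nonneg[OF W]) auto
  also have "\<dots> = (1 + 12 * M / t^4 * c * real Q * \<bar>x - y\<bar>) * g' y" by (simp add: algebra_simps)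
  also have "\<dots> \<le> exp (12 * M / t^4 * c * real Q * \<bar>x - y\<bar>) * g' y"
    using ge[of y] t_pos by (intro mult_right_mono exp_ge_add_one_self) auto
  finally show "g' x \<le> exp (12 * M / t^4 * c * real Q * \<bar>x - y\<bar>) * g' y" .
qed

lemma g_bij: "bij g" by (rule tame_bij[OF tame_g])

lemma g_mono: "strict_mono g" by (rule tame_mono[OF tame_g])

lemma g_inv [simp]: "g (inv g x) = x" "inv g (g x) = x"
  using g_bij by (simp_all add: bij_is_surj surj_f_inv_f bij_is_inj)

lemma g_off_support:
  assumes "1 / c \<le> real Q * x - of_int \<lfloor>real Q * x\<rfloor>"
  shows "g x = x"
proof -
  define l where "l = \<lfloor>real Q * x\<rfloor>"
  have l: "0 \<le> real Q * x - of_int l" "real Q * x - of_int l < 1" by (auto simp: l_def) linarith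
  have "1 \<le> c * (real Q * x - of_int l)" using assms c_ge unfolding l_def by (simp add: field_simps)
  then have "h_hat \<psi> t (c * (real Q * x - of_int l)) = c * (real Q * x - of_int l)"
    using t_pos by (intro h_hat_id) simp
  then show ?thesis using g_window[of x l] l c_ge Q_pos by simp
qed

text \<open>The map fixes both ends of each component of the support and is increasing, so no point
  leaves its component, whose length is \<open>1 / (c * Q)\<close>.\<close>

lemma g_displacement: "\<bar>g x - x\<bar> \<le> 1 / (c * real Q)"
proof (cases "1 / c \<le> real Q * x - of_int \<lfloor>real Q * x\<rfloor>")
  case True
  then show ?thesis using g_off_support c_ge by simp
next
  case False
  define l where "l = \<lfloor>real Q * x\<rfloor>"
  have l: "0 \<le> real Q * x - of_int l" by (auto simp: l_def)
  have ends: "g (of_int l / real Q) = of_int l / real Q"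
    "g (of_int l / real Q + 1 / (c * real Q)) = of_int l / real Q + 1 / (c * real Q)"
  proof -
    show "g (of_int l / real Q) = of_int l / real Q" using g_shift[of 0 l] g_0 by simp
    have "real Q * (of_int l / real Q + 1 / (c * real Q)) = of_int l + 1 / c"
      using Q_pos by (simp add: field_simps)
    moreover have "\<lfloor>of_int l + 1 / c\<rfloor> = l"
      using c_ge by (simp add: floor_eq_iff)
    ultimately show "g (of_int l / real Q + 1 / (c * real Q)) = of_int l / real Q + 1 / (c * real Q)"
      by (intro g_off_support) simp
  qed
  have x: "of_int l / real Q \<le> x" "x \<le> of_int l / real Q + 1 / (c * real Q)"
    using l False Q_pos c_ge unfolding l_def[symmetric] by (auto simp: field_simps)
  then have "of_int l / real Q \<le> g x" "g x \<le> of_int l / real Q + 1 / (c * real Q)"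
    using ends strict_mono_less_eq[OF g_mono] by metis+
  then show ?thesis using x by linarith
qed

definition zones :: "(real \<times> real) set" where
  "zones = {(t, 2 * t), (left_turn, left_turn + t^2), (right_turn, right_turn + t^2), (1 - 2 * t, 1 - t)}"

lemma zones_bounds:
  assumes "(a, b) \<in> zones"
  shows "0 \<le> a" "a \<le> b" "b \<le> 1" "b - a \<le> t" "h_hat \<psi> t b - h_hat \<psi> t a \<le> 2 * t"
proof -
  consider "a = t" "b = 2 * t" | "a = left_turn" "b = left_turn + t^2"
    | "a = right_turn" "b = right_turn + t^2" | "a = 1 - 2 * t" "b = 1 - t"
    using assms unfolding zones_def by blast
  then have "0 \<le> a \<and> a \<le> b \<and> b \<le> 1 \<and> b - a \<le> t \<and> h_hat \<psi> t b - h_hat \<psi> t a \<le> 2 * t"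
    using h_hat_jumps turn_order t_pos t_small t_sq by (cases; simp only:) linarith+
  then show "0 \<le> a" "a \<le> b" "b \<le> 1" "b - a \<le> t" "h_hat \<psi> t b - h_hat \<psi> t a \<le> 2 * t"
    by blast+
qed

text \<open>Both endpoints are expressed as block coordinates \<open>u\<close>, \<open>v\<close>
  relative to the period of \<open>x\<close>. Avoiding the zones puts \<open>u\<close> and
  \<open>v\<close> into the same affine piece.\<close>

lemma g'_const_off_zones:
  assumes "x \<le> y"
    "\<And>a b l. (a, b) \<in> zones \<Longrightarrow> y \<le> a / (c * real Q) + of_int l / real Q \<or> b / (c * real Q) + of_int l / real Q \<le> x"
  shows "g' x = g' y"
proof -
  define l where "l = \<lfloor>real Q * x\<rfloor>"
  define u where "u = c * (real Q * x - of_int l)"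
  define v where "v = c * (real Q * y - of_int l)"
  have l: "0 \<le> real Q * x - of_int l" "real Q * x - of_int l < 1" by (auto simp: l_def) linarith
  have u: "0 \<le> u" "u < c" using l c_ge by (auto simp: u_def)
  have uv: "u \<le> v" using assms(1) c_ge unfolding u_def v_def by (auto intro!: mult_left_mono)
  have cq: "0 < c * real Q" using c_ge Q_pos by simp
  have s: "z \<le> a / (c * real Q) + of_int k / real Q \<longleftrightarrow> c * (real Q * z - of_int k) \<le> a"
    "a / (c * real Q) + of_int k / real Q \<le> z \<longleftrightarrow> a \<le> c * (real Q * z - of_int k)" for z a k
    using cq c_ge Q_pos by (simp_all add: field_simps)
  have avoid: "v \<le> a \<or> b \<le> u" if "(a, b) \<in> zones" for a b
    using assms(2)[OF that, of l] unfolding s u_def v_def .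
  \<comment> \<open>The first zone of the next period stops \<open>y\<close>: the interval can reach
    at most the initial identity part of that period, where the slope is 1 as at the end of the
    current one.\<close>
  have "v - c \<le> t \<or> 2 * t \<le> u - c"
    using assms(2)[of t "2 * t" "l + 1"] unfolding s u_def v_def zones_def by (simp add: algebra_simps)
  then have v: "v - c \<le> t" using u t_pos by linarith
  have gx: "g' x = slope u" using g'_window[of x l] l by (simp add: u_def)
  have gy: "g' y = slope v" if "v \<le> c"
  proof -
    have "c * (real Q * y - of_int l) \<le> c * 1" using that by (simp add: v_def)
    then have "real Q * y - of_int l \<le> 1" by (rule mult_left_le_imp_le) (use c_ge in simp)
    moreover have "0 \<le> c * (real Q * y - of_int l)" using uv u by (simp add: v_def)
    then have "0 \<le> real Q * y - of_int l" using c_ge by (simp add: zero_le_mult_iff)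
    ultimately show ?thesis using g'_window[of y l] by (simp add: v_def)
  qed
  have gy': "g' y = 1" if "c < v"
  proof -
    have *: "c * 1 < c * (real Q * y - of_int l)" "c * (real Q * y - of_int l) \<le> c * 2"
      using that v c_ge t_small unfolding v_def by linarith+
    have "1 < real Q * y - of_int l"
      by (rule mult_left_less_imp_less[OF *(1)]) (use c_ge in simp)
    moreover have "real Q * y - of_int l \<le> 2"
      by (rule mult_left_le_imp_le[OF *(2)]) (use c_ge in simp)
    ultimately have "g' y = slope (c * (real Q * y - of_int (l + 1)))"
      by (intro g'_window) auto
    also have "\<dots> = 1" using v by (intro slope_vals) (simp add: v_def algebra_simps)
    finally show ?thesis .
  qed
  have c1: "1 < c" using c_ge by simp
  have z: "v \<le> t \<or> 2 * t \<le> u" "v \<le> left_turn \<or> left_turn + t^2 \<le> u"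
    "v \<le> right_turn \<or> right_turn + t^2 \<le> u" "v \<le> 1 - 2 * t \<or> 1 - t \<le> u"
    using avoid by (auto simp: zones_def)
  note o = turn_order t_pos c1
  consider "v \<le> t" | "2 * t \<le> u" "v \<le> left_turn" | "left_turn + t^2 \<le> u" "v \<le> right_turn"
    | "right_turn + t^2 \<le> u" "v \<le> 1 - 2 * t" | "1 - t \<le> u" using z by blast
  then show ?thesis
  proof cases
    case 5
    then show ?thesis using gx gy gy' uv slope_vals(5)[of u] slope_vals(5)[of v] by (cases "v \<le> c") auto
  qed (use gx gy uv o t_sq slope_vals[of u] slope_vals[of v] in auto)
qed

text \<open>If \<open>d\<close> were farther from the periods, a shift by \<open>d\<close> would carry some point of the
  moderate part over a whole turn into the steep part, where the slope is \<open>1 / t\<close>.\<close>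

lemma near_period_of_slope_comparison:
  assumes B: "B * (3 * M) < 1 / t" "0 \<le> B" and le: "\<And>y. g' (y + d) \<le> B * g' y"
  shows "\<exists>k::int. \<bar>d - of_int k / real Q\<bar> \<le> t^2 / (c * real Q)"
proof -
  obtain k where k: "\<bar>d - of_int k / real Q\<bar> \<le> 1 / (2 * real Q)" by (rule nearest_shift)
  define e where "e = d - of_int k / real Q"
  define u where "u x = c * (real Q * x)" for x
  have cq: "0 < c * real Q" using c_ge Q_pos by simp
  have le': "g' z \<le> B * g' (z - e)" for z
    using le[of "z - e"] g'_shift[of z k] by (simp add: e_def algebra_simps)
  have win: "g' z = slope (u z)" if "- (c/2) \<le> u z" "u z \<le> c" for z
  proof -
    have "c * (- (1/2)) \<le> c * (real Q * z)" "c * (real Q * z) \<le> c * 1" using that by (auto simp: u_def)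
    then have "- (1/2) \<le> real Q * z" "real Q * z \<le> 1"
      using c_ge mult_left_le_imp_le[of c "- (1/2)"] mult_left_le_imp_le[of c _ 1] by auto
    then show ?thesis using g'_window[of z 0] by (simp add: u_def)
  qed
  have bad: False if "left_turn + t^2 \<le> u z" "u z \<le> right_turn" "- (c/2) \<le> u (z - e)" "u (z - e) \<le> c"
    "u (z - e) \<le> left_turn \<or> right_turn + t^2 \<le> u (z - e)" for z
  proof -
    have "g' z = 1 / t"
      using win[of z] slope_vals(3)[of "u z"] that turn_order t_pos t_sq c_ge by simp
    moreover have "g' (z - e) \<le> 3 * M"
      using win[of "z - e"] slope_left_le[of "u (z - e)"] slope_right_le[of "u (z - e)"] that by auto
    ultimately show False using le'[of z] B mult_left_mono[of "g' (z - e)" "3 * M" B] by linarith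
  qed
  have ud: "u (z - e) = u z - c * real Q * e" for z by (simp add: u_def algebra_simps)
  have e: "\<bar>c * real Q * e\<bar> \<le> c / 2"
    using mult_left_mono[OF k[folded e_def], of "c * real Q"] cq Q_pos c_ge by (simp add: abs_mult)
  have "\<bar>c * real Q * e\<bar> \<le> t^2"
  proof (rule ccontr)
    assume "\<not> \<bar>c * real Q * e\<bar> \<le> t^2"
    then consider "c * real Q * e > t^2" | "c * real Q * e < - (t^2)" by linarith
    then show False
    proof cases
      case 1
      \<comment> \<open>The witness is the left end of the steep piece. A move to the left by more
        than the window length \<open>t^2\<close> in block coordinates lands before
        \<open>left_turn\<close>; the bound \<open>c / 2\<close> on the move keeps the point in the
        range of \<open>win\<close>. In the other case the right end \<open>right_turn\<close> is
        used.\<close>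
      have "u ((left_turn + t^2) / (c * real Q)) = left_turn + t^2" using c_ge Q_pos by (simp add: u_def)
      then show False using bad[of "(left_turn + t^2) / (c * real Q)"] 1 e turn_order t_pos t_sq c_ge
        unfolding ud by linarith
    next
      case 2
      have "u (right_turn / (c * real Q)) = right_turn" using c_ge Q_pos by (simp add: u_def)
      then show False using bad[of "right_turn / (c * real Q)"] 2 e turn_order t_pos t_sq c_ge
        unfolding ud by linarith
    qed
  qed
  then have "\<bar>e\<bar> \<le> t^2 / (c * real Q)" using cq c_ge by (simp add: abs_mult field_simps)
  then show ?thesis unfolding e_def by blast
qed

lemma step_map_g: "step_map (9 * M) t Q n g g'"
  unfolding step_map_def
proof (intro conjI allI impI)
  have "t / (9 * M) \<le> t" "0 < t / (9 * M)" using M_ge_1 t_pos by (simp_all add: field_simps)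
  moreover have "12 * M / t^4 * c * real Q \<le> 2 * (9 * M) * 2 ^ (n + 1) * real Q / t^5"
  proof -
    have "12 * M / t^4 \<le> 18 * M / t^5"
      using M_ge_1 t_pos t_small by (simp add: field_simps power_eq_if)
    then have "12 * M / t^4 * (c * real Q) \<le> 18 * M / t^5 * (c * real Q)"
      using c_ge by (intro mult_right_mono) auto
    then show ?thesis by (simp add: c_def mult.assoc)
  qed
  ultimately show "tame g g' (t / (9 * M)) (9 * M / t) (2 * (9 * M) * 2 ^ (n + 1) * real Q / t^5)"
    by (intro tame_weaken[OF tame_g]) auto
  show "g x = x" if "1 / 2 ^ (n + 1) \<le> real Q * x - of_int \<lfloor>real Q * x\<rfloor>" for x
    using that by (intro g_off_support) (simp add: c_def)
  show "\<bar>g x - x\<bar> \<le> 1 / (2 ^ (n + 1) * real Q)" for x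
    using g_displacement by (simp add: c_def)
  show "g (x + of_int k / real Q) = g x + of_int k / real Q" for x k by (rule g_shift)
  have cq: "0 < c * real Q" using c_ge Q_pos by simp
  show "affine_off_zones t Q g g'"
    unfolding affine_off_zones_def
  proof (intro exI conjI allI impI)
    let ?f = "\<lambda>(a, b). (a / (c * real Q), b / (c * real Q))"
    show "finite (?f ` zones)" by (simp add: zones_def)
    have "card (?f ` zones) \<le> card zones" by (rule card_image_le) (simp add: zones_def)
    also have "\<dots> \<le> 4"
      using card_length[of "[(t, 2 * t), (left_turn, left_turn + t^2), (right_turn, right_turn + t^2), (1 - 2 * t, 1 - t)]"]
      by (simp add: zones_def)
    finally show "card (?f ` zones) \<le> 4" .
    {
      fix a b assume "(a, b) \<in> ?f ` zones"
      then obtain a0 b0 where z: "(a0, b0) \<in> zones" and ab: "a = a0 / (c * real Q)" "b = b0 / (c * real Q)" by auto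
      note zb = zones_bounds[OF z]
      show "0 \<le> a" "a \<le> b" using zb cq by (simp_all add: ab divide_right_mono)
      have "b \<le> 1 / (c * real Q)" unfolding ab using zb cq by (intro divide_right_mono) auto
      also have "\<dots> \<le> 1 / real Q" using c_ge Q_pos by (simp add: field_simps)
      finally show b: "b \<le> 1 / real Q" .
      have win: "g z = h_hat \<psi> t (c * (real Q * z)) / c / real Q" if "0 \<le> z" "z \<le> 1 / real Q" for z
      proof -
        have "0 \<le> real Q * z" "real Q * z \<le> 1" using that Q_pos by (simp_all add: field_simps)
        then show ?thesis using g_window[of z 0] by simp
      qed
      have "g b - g a = (h_hat \<psi> t b0 - h_hat \<psi> t a0) / c / real Q"
        using win[of a] win[of b] b \<open>0 \<le> a\<close> \<open>a \<le> b\<close> c_ge Q_pos unfolding ab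
        by (simp add: diff_divide_distrib)
      also have "\<dots> \<le> (2 * t) / c / real Q"
        using zb(5) c_ge by (intro divide_right_mono) auto
      also have "\<dots> \<le> 2 * t / real Q" using c_ge t_pos by (intro divide_right_mono) (simp_all add: field_simps)
      finally show "g b - g a \<le> 2 * t / real Q" .
    }
    fix x y assume "x \<le> y" "\<forall>a b. (a, b) \<in> ?f ` zones \<longrightarrow>
      (\<forall>l. y \<le> a + of_int l / real Q \<or> b + of_int l / real Q \<le> x)"
    then show "g' x = g' y" by (intro g'_const_off_zones) force+
  qed
qed

end

lemma step_mapD:
  assumes "step_map C t Q n g g'"
  shows "tame g g' (t / C) (C / t) (2 * C * 2 ^ (n + 1) * real Q / t^5)"
    and "1 / 2 ^ (n + 1) \<le> real Q * x - of_int \<lfloor>real Q * x\<rfloor> \<Longrightarrow> g x = x"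
    and "\<bar>g x - x\<bar> \<le> 1 / (2 ^ (n + 1) * real Q)"
    and "g (x + of_int k / real Q) = g x + of_int k / real Q"
  using assms unfolding step_map_def by blast+

text \<open>The zones of the inverse are the \<open>g\<close>-images of those of \<open>g\<close>.
  Their images under the inverse are the original zones, which is why \<open>zones_bounds\<close>
  controls the lengths on both sides.\<close>

lemma (in level) step_map_inv: "step_map (9 * M) t Q n (inv g) (\<lambda>x. 1 / g' (inv g x))"
  unfolding step_map_def
proof (intro conjI allI impI)
  note G = step_map_g
  have "t / (9 * M) \<le> 1 / (9 * M / t)" "0 < t / (9 * M)" "1 / t \<le> 9 * M / t"
    using M_ge_1 t_pos by (simp_all add: field_simps)
  moreover have "12 * M / t^4 * c * real Q / t \<le> 2 * (9 * M) * 2 ^ (n + 1) * real Q / t^5"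
  proof -
    have "12 * M / t^4 / t \<le> 18 * M / t^5"
      using M_ge_1 t_pos t_small by (simp add: field_simps power_eq_if)
    then have "12 * M / t^4 / t * (c * real Q) \<le> 18 * M / t^5 * (c * real Q)"
      using c_ge by (intro mult_right_mono) auto
    then show ?thesis by (simp add: c_def mult.assoc)
  qed
  ultimately show "tame (inv g) (\<lambda>x. 1 / g' (inv g x)) (t / (9 * M)) (9 * M / t) (2 * (9 * M) * 2 ^ (n + 1) * real Q / t^5)"
    by (intro tame_weaken[OF tame_inv[OF tame_g]]) auto
  show "inv g x = x" if "1 / 2 ^ (n + 1) \<le> real Q * x - of_int \<lfloor>real Q * x\<rfloor>" for x
    using step_mapD(2)[OF G that] g_inv(2)[of x] by simp
  show "\<bar>inv g x - x\<bar> \<le> 1 / (2 ^ (n + 1) * real Q)" for x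
    using step_mapD(3)[OF G, of "inv g x"] by (simp add: abs_minus_commute)
  show sh: "inv g (x + of_int k / real Q) = inv g x + of_int k / real Q" for x k
    using g_inv(2)[of "inv g x + of_int k / real Q"] by (simp add: g_shift)
  have le_iff: "inv g x \<le> y \<longleftrightarrow> x \<le> g y" "y \<le> inv g x \<longleftrightarrow> g y \<le> x" for x y
    using strict_mono_less_eq[OF g_mono, of "inv g x" y] strict_mono_less_eq[OF g_mono, of y "inv g x"] by simp_all
  have g1: "g (1 / real Q) = 1 / real Q" using g_shift[of 0 1] g_0 by simp
  have cq: "0 < c * real Q" using c_ge Q_pos by simp
  show "affine_off_zones t Q (inv g) (\<lambda>x. 1 / g' (inv g x))"
    unfolding affine_off_zones_def
  proof (intro exI conjI allI impI)
    let ?f = "\<lambda>(a, b). (g (a / (c * real Q)), g (b / (c * real Q)))"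
    show "finite (?f ` zones)" by (simp add: zones_def)
    have "card (?f ` zones) \<le> card zones" by (rule card_image_le) (simp add: zones_def)
    also have "\<dots> \<le> 4"
      using card_length[of "[(t, 2 * t), (left_turn, left_turn + t^2), (right_turn, right_turn + t^2), (1 - 2 * t, 1 - t)]"]
      by (simp add: zones_def)
    finally show "card (?f ` zones) \<le> 4" .
    {
      fix a b assume "(a, b) \<in> ?f ` zones"
      then obtain a0 b0 where z: "(a0, b0) \<in> zones" and ab: "a = g (a0 / (c * real Q))" "b = g (b0 / (c * real Q))" by auto
      note zb = zones_bounds[OF z]
      have "0 \<le> a0 / (c * real Q)" "a0 / (c * real Q) \<le> b0 / (c * real Q)"
        using zb cq by (simp_all add: divide_right_mono)
      then show "0 \<le> a" "a \<le> b" unfolding ab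
        using strict_mono_less_eq[OF g_mono, of 0] g_0 by (simp_all add: strict_mono_less_eq[OF g_mono])
      have "b0 / (c * real Q) \<le> 1 / (c * real Q)" using zb cq by (intro divide_right_mono) auto
      also have "\<dots> \<le> 1 / real Q" using c_ge Q_pos by (simp add: field_simps)
      finally have "g (b0 / (c * real Q)) \<le> g (1 / real Q)" by (simp add: strict_mono_less_eq[OF g_mono])
      then show "b \<le> 1 / real Q" by (simp add: ab g1)
      have "inv g b - inv g a = (b0 - a0) / (c * real Q)" unfolding ab by (simp add: diff_divide_distrib)
      also have "\<dots> \<le> t / (c * real Q)" using zb cq by (intro divide_right_mono) auto
      also have "\<dots> \<le> 2 * t / real Q" using c_ge Q_pos t_pos by (simp add: field_simps)
      finally show "inv g b - inv g a \<le> 2 * t / real Q" .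
    }
    fix x y assume xy: "x \<le> y" and off: "\<forall>a b. (a, b) \<in> ?f ` zones \<longrightarrow>
      (\<forall>l. y \<le> a + of_int l / real Q \<or> b + of_int l / real Q \<le> x)"
    have "g' (inv g x) = g' (inv g y)"
    proof (rule g'_const_off_zones)
      show "inv g x \<le> inv g y" using xy by (simp add: le_iff)
      fix a b l assume "(a, b) \<in> zones"
      then have "(g (a / (c * real Q)), g (b / (c * real Q))) \<in> ?f ` zones" by force
      then show "inv g y \<le> a / (c * real Q) + of_int l / real Q \<or> b / (c * real Q) + of_int l / real Q \<le> inv g x"
        using off unfolding le_iff g_shift by blast
    qed
    then show "1 / g' (inv g x) = 1 / g' (inv g y)" by simp
  qed
qed

section \<open>Compositions along the levels\<close>

locale tower =
  fixes C :: real and q :: "nat \<Rightarrow> nat" and g g' :: "nat \<Rightarrow> real \<Rightarrow> real" and H :: "nat \<Rightarrow> real \<Rightarrow> real"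
  assumes C_ge_1: "1 \<le> C"
    and q_pos: "\<And>n. n \<ge> 1 \<Longrightarrow> q n > 0"
    and t_small: "\<And>n. n \<ge> 1 \<Longrightarrow> t_param (q n) n < 1 / 10"
    and q_growth: "\<And>n. n \<ge> 1 \<Longrightarrow> q (n + 1) \<ge> q n ^ (2 * n)"
    and step: "\<And>n. n \<ge> 1 \<Longrightarrow> step_map C (t_param (q n) n) (q n) n (g n) (g' n)"
    and H_0: "H 0 = id" and H_Suc: "\<And>n. H (Suc n) = H n \<circ> g (Suc n)"
begin

abbreviation "qr n \<equiv> real (q n)"

definition t :: "nat \<Rightarrow> real" where "t n = t_param (q n) n"

lemma t_eq: "n \<ge> 1 \<Longrightarrow> t n = 1 / qr n ^ (2 * n - 1)"
proof -
  assume "n \<ge> 1"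
  then have "1 - 2 * int n = - int (2 * n - 1)" by simp
  then show ?thesis unfolding t_def t_param_def by (simp only: power_int_minus power_int_of_nat inverse_eq_divide)
qed

lemma t_pos: "n \<ge> 1 \<Longrightarrow> 0 < t n"
  using q_pos by (simp add: t_eq)

text \<open>For \<open>q 1 = 1\<close> the parameter \<open>t 1\<close> would be 1.\<close>

lemma q_1: "q 1 \<ge> 2"
  using t_small[of 1] t_eq[of 1] q_pos[of 1] unfolding t_def by (cases "q 1 = 1") auto

lemma q_ge: "n \<ge> 1 \<Longrightarrow> q n \<ge> n + 1"
proof (induction n rule: nat_induct_at_least)
  case base then show ?case using q_1 by simp
next
  case (Suc n)
  have "n + 2 \<le> q n * q n"
    using Suc mult_le_mono[of "n + 1" "q n" 2 "q n"] by simp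
  also have "\<dots> = q n ^ 2" by (simp add: power2_eq_square)
  also have "\<dots> \<le> q n ^ (2 * n)" using Suc by (intro power_increasing) auto
  also have "\<dots> \<le> q (Suc n)" using q_growth[of n] Suc by simp
  finally show ?case by simp
qed

lemma q_mono_Suc: "n \<ge> 1 \<Longrightarrow> q n \<le> q (Suc n)"
  using q_growth[of n] q_pos[of n] self_le_power[of "q n" "2 * n"] by simp

lemma q_mono: "m \<le> n \<Longrightarrow> 1 \<le> m \<Longrightarrow> q m \<le> q n"
proof (induction n rule: dec_induct)
  case (step n)
  then show ?case using q_mono_Suc[of n] by simp
qed simp

lemma q_growth_real: "n \<ge> 1 \<Longrightarrow> qr n ^ (2 * n) \<le> qr (Suc n)"
  using q_growth[of n] by (metis Suc_eq_plus1 of_nat_le_iff of_nat_power)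

primrec H' :: "nat \<Rightarrow> real \<Rightarrow> real" where
  "H' 0 = (\<lambda>_. 1)"
| "H' (Suc n) = (\<lambda>x. H' n (g (Suc n) x) * g' (Suc n) x)"

primrec W :: "nat \<Rightarrow> real" where
  "W 0 = 0"
| "W (Suc n) = W n * (C / t (Suc n)) + 2 * C * 2 ^ (Suc n + 1) * qr (Suc n) / t (Suc n) ^ 5"

definition P :: "nat \<Rightarrow> real" where "P n = (\<Prod>k=1..n. 1 / t k)"

lemma P_Suc: "P (Suc n) = P n * (1 / t (Suc n))" by (simp add: P_def)

lemma P_pos: "0 < P n" unfolding P_def by (intro prod_pos) (auto simp: t_pos)

text \<open>By induction and the growth of \<open>q\<close>, all earlier levels together contribute
  at most one factor \<open>q (Suc n)\<close>, and the new one contributes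
  \<open>q (Suc n) ^ (2 * Suc n - 1)\<close>.\<close>

lemma P_le: "n \<ge> 1 \<Longrightarrow> P n \<le> qr n ^ (2 * n)"
proof (induction n rule: nat_induct_at_least)
  case base
  then show ?case using q_1 by (simp add: P_def t_eq power2_eq_square)
next
  case (Suc n)
  have "P n \<le> qr (Suc n)" using Suc q_growth_real[of n] by linarith
  then have "P (Suc n) \<le> qr (Suc n) * (1 / t (Suc n))"
    unfolding P_Suc using t_pos[of "Suc n"] by (intro mult_right_mono) auto
  also have "\<dots> = qr (Suc n) ^ (2 * Suc n)" by (simp add: t_eq)
  finally show ?case .
qed

lemma P_le_next: "P n \<le> qr (Suc n)"
proof (cases n)
  case 0 then show ?thesis using q_pos[of 1] by (simp add: P_def)
next
  case (Suc m)
  then show ?thesis using P_le[of n] q_growth_real[of n] by linarith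
qed

lemma tame_H: "tame (H n) (H' n) (1 / (C ^ n * P n)) (C ^ n * P n) (W n)"
proof (induction n)
  case 0
  have "P 0 = 1" by (simp add: P_def)
  then show ?case unfolding H_0 H'.simps W.simps using tame_id by (simp del: id_apply)
next
  case (Suc n)
  have "tame (g (Suc n)) (g' (Suc n)) (t (Suc n) / C) (C / t (Suc n))
      (2 * C * 2 ^ (Suc n + 1) * qr (Suc n) / t (Suc n) ^ 5)"
    using step_mapD(1)[OF step[of "Suc n"]] by (simp add: t_def)
  note comp = tame_comp[OF Suc this]
  have "1 / (C ^ n * P n) * (t (Suc n) / C) = 1 / (C ^ Suc n * P (Suc n))"
    "C ^ n * P n * (C / t (Suc n)) = C ^ Suc n * P (Suc n)"
    by (simp_all add: P_Suc)
  then show ?case using comp unfolding H_Suc H'.simps W.simps by metis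
qed

text \<open>The sum of \<open>C\<close> and \<open>8 * C\<close>, the factors of the two summands in
  the recursion for \<open>W\<close> in the next lemma.\<close>

definition K :: real where "K = 9 * C"

text \<open>The growth of \<open>q\<close> makes the inherited distortion cheap:
  \<open>q n ^ (10 * n)\<close> is the fifth power of \<open>q n ^ (2 * n)\<close>, hence at most
  \<open>q (Suc n) ^ 5\<close>. The newest level dominates, with exponent \<open>10 * n - 4\<close>
  coming from \<open>q n / t n ^ 5\<close>.\<close>

lemma W_le: "n \<ge> 1 \<Longrightarrow> W n \<le> K ^ n * qr n ^ (10 * n)"
proof -
  have w: "2 * C * 2 ^ (m + 1) * qr m / t m ^ 5 = 4 * C * 2 ^ m * qr m ^ (10 * m - 4)" if "m \<ge> 1" for m
  proof -
    have "qr m * (qr m ^ (2 * m - 1)) ^ 5 = qr m ^ (10 * m - 4)"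
    proof -
      have "Suc ((2 * m - 1) * 5) = 10 * m - 4" using that by simp
      then show ?thesis by (metis power_Suc power_mult)
    qed
    then show ?thesis using that by (simp add: t_eq power_one_over field_simps)
  qed
  show "n \<ge> 1 \<Longrightarrow> W n \<le> K ^ n * qr n ^ (10 * n)"
  proof (induction n rule: nat_induct_at_least)
    case base
    have "W 1 = 8 * C * qr 1 ^ 6" using w[of 1] by simp
    also have "\<dots> \<le> (9 * C) * qr 1 ^ 10"
      using C_ge_1 q_1 by (intro mult_mono power_increasing) auto
    finally show ?case by (simp add: K_def)
  next
    case (Suc n)
    let ?q = "qr (Suc n)"
    have q1: "1 \<le> ?q" using q_pos[of "Suc n"] by simp
    have "(qr n ^ (2 * n)) ^ 5 \<le> ?q ^ 5" using q_growth_real[of n] Suc(1) by (intro power_mono) auto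
    then have q5: "qr n ^ (10 * n) \<le> ?q ^ 5" by (simp add: power_mult[symmetric] mult.commute)
    have "W n \<le> K ^ n * ?q ^ 5"
      using Suc q5 C_ge_1 by (intro order_trans[OF Suc(2)] mult_left_mono) (auto simp: K_def)
    then have "W n * (C / t (Suc n)) \<le> K ^ n * ?q ^ 5 * (C * ?q ^ (2 * Suc n - 1))"
      using C_ge_1 by (simp add: t_eq mult_right_mono)
    also have "\<dots> = K ^ n * C * ?q ^ (5 + (2 * Suc n - 1))"
      unfolding power_add by (simp only: mult_ac)
    also have "\<dots> \<le> K ^ n * C * ?q ^ (10 * Suc n)"
      using C_ge_1 q1 Suc(1) by (intro mult_left_mono power_increasing) (auto simp: K_def)
    finally have 1: "W n * (C / t (Suc n)) \<le> K ^ n * C * ?q ^ (10 * Suc n)" .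
    have "(2::real) ^ n \<le> K ^ n" using C_ge_1 by (intro power_mono) (auto simp: K_def)
    then have 2: "4 * C * 2 ^ Suc n * ?q ^ (10 * Suc n - 4) \<le> 4 * C * (2 * K ^ n) * ?q ^ (10 * Suc n)"
      using C_ge_1 q1 by (intro mult_mono power_increasing) (auto simp: K_def)
    have "1 \<le> Suc n" by simp
    have "W (Suc n) \<le> K ^ n * C * ?q ^ (10 * Suc n) + 4 * C * (2 * K ^ n) * ?q ^ (10 * Suc n)"
      unfolding W.simps w[OF \<open>1 \<le> Suc n\<close>] by (rule add_mono[OF 1 2])
    also have "\<dots> = K ^ Suc n * ?q ^ (10 * Suc n)" by (simp add: K_def algebra_simps)
    finally show ?case .
  qed
qed

lemma H_bij: "bij (H n)" by (rule tame_bij[OF tame_H])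

lemma H_inv [simp]: "H n (inv (H n) x) = x" "inv (H n) (H n x) = x"
  using H_bij[of n] by (simp_all add: bij_is_surj surj_f_inv_f bij_is_inj)

text \<open>The later levels act in the source, before \<open>H n\<close>: \<open>G\<close> is the
  composition of \<open>g (n + 1)\<close> up to \<open>g N\<close>, and displacements of composed
  maps add up.\<close>

lemma H_tail:
  assumes "n \<le> N"
  shows "\<exists>G. bij G \<and> H N = H n \<circ> G \<and> (\<forall>x. \<bar>G x - x\<bar> \<le> (\<Sum>k=n+1..N. 1 / (2 ^ (k + 1) * qr k)))"
  using assms
proof (induction N rule: dec_induct)
  case base
  show ?case by (intro exI[of _ id] conjI allI bij_id) auto
next
  case (step N)
  then obtain G where G: "bij G" "H N = H n \<circ> G"
    "\<And>x. \<bar>G x - x\<bar> \<le> (\<Sum>k=n+1..N. 1 / (2 ^ (k + 1) * qr k))" by blast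
  note st = tower.step[OF tower_axioms, of "Suc N"]
  have "bij (g (Suc N))" using tame_bij[OF step_mapD(1)[OF st]] by simp
  moreover have "\<bar>(G \<circ> g (Suc N)) x - x\<bar> \<le> (\<Sum>k=n+1..Suc N. 1 / (2 ^ (k + 1) * qr k))" for x
    using G(3)[of "g (Suc N) x"] step_mapD(3)[OF st, of x] step(1) by simp
  moreover have "H (Suc N) = H n \<circ> (G \<circ> g (Suc N))" by (simp only: H_Suc G(2) comp_assoc)
  ultimately show ?case using G(1) bij_comp by blast
qed

definition gap :: "nat \<Rightarrow> real" where "gap n = 1 / (2 ^ (n + 1) * qr (Suc n))"

lemma tail_sum_le: "(\<Sum>k=n+1..N. 1 / (2 ^ (k + 1) * qr k)) \<le> gap n"
proof -
  have "(\<Sum>k=n+1..N. 1 / (2 ^ (k + 1) * qr k)) \<le> (\<Sum>k=n+1..N. (1 / 2) ^ (k + 1) / qr (Suc n))"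
  proof (rule sum_mono)
    fix k assume k: "k \<in> {n+1..N}"
    then have "qr (Suc n) \<le> qr k" using q_mono[of "Suc n" k] by simp
    moreover have "0 < qr (Suc n)" using q_pos by simp
    ultimately show "1 / (2 ^ (k + 1) * qr k) \<le> (1 / 2) ^ (k + 1) / qr (Suc n)"
      by (simp add: power_one_over frac_le divide_simps)
  qed
  also have "\<dots> = (\<Sum>k=n+1..N. (1 / 2) ^ (k + 1)) / qr (Suc n)" by (simp add: sum_divide_distrib)
  also have "(\<Sum>k=n+1..N. (1 / 2 :: real) ^ (k + 1)) \<le> (1 / 2) ^ (n + 1)"
  proof (cases "n \<le> N")
    case True
    have "(\<Sum>k=n+1..N. r ^ (k + 1)) = r ^ (n + 1) - r ^ (N + 1)" if "r + r = 1" for r :: real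
      using True
    proof (induction N rule: dec_induct)
      case (step N)
      have "r ^ (N + 1) = (r + r) * r ^ (N + 1)" using that by simp
      then have "r ^ (N + 1) = r ^ (Suc N + 1) + r ^ (Suc N + 1)" by (simp add: algebra_simps)
      then show ?case using step by simp
    qed simp
    from this[of "1 / 2"] show ?thesis by simp
  qed simp
  finally show ?thesis by (simp add: gap_def power_one_over divide_right_mono field_simps)
qed

text \<open>The inverse of \<open>H n\<close> is \<open>G\<close> after the inverse of
  \<open>H N\<close>, so the displacement of \<open>G\<close> enters directly, without a factor from
  the slopes of \<open>H n\<close>.\<close>

lemma inv_H_close: "n \<le> N \<Longrightarrow> \<bar>inv (H N) x - inv (H n) x\<bar> \<le> gap n"
proof -
  assume "n \<le> N"
  then obtain G where G: "bij G" "H N = H n \<circ> G" "\<And>x. \<bar>G x - x\<bar> \<le> (\<Sum>k=n+1..N. 1 / (2 ^ (k + 1) * qr k))"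
    using H_tail by blast
  have "inv (H n) x = G (inv (H N) x)"
    using H_inv(1)[of N x] H_inv(2)[of n "G (inv (H N) x)"] G(2) by simp
  then show ?thesis using G(3)[of "inv (H N) x"] tail_sum_le[of n N] by (simp add: abs_minus_commute)
qed

text \<open>Here the displacement is stretched by \<open>H n\<close>. The growth of \<open>q\<close>
  alone only compares \<open>P n\<close> with \<open>q (Suc n)\<close> and leaves
  \<open>C ^ n / 2 ^ (n + 1)\<close>; the right side is shown to be small at jumps.\<close>

lemma H_close: "n \<le> N \<Longrightarrow> \<bar>H N x - H n x\<bar> \<le> C ^ n * P n * gap n"
proof -
  assume "n \<le> N"
  then obtain G where G: "bij G" "H N = H n \<circ> G" "\<And>x. \<bar>G x - x\<bar> \<le> (\<Sum>k=n+1..N. 1 / (2 ^ (k + 1) * qr k))"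
    using H_tail by blast
  have "\<bar>H N x - H n x\<bar> \<le> C ^ n * P n * \<bar>G x - x\<bar>"
    using tame_lipschitz[OF tame_H, of n "G x" x] G(2) by simp
  also have "\<dots> \<le> C ^ n * P n * gap n"
    using G(3)[of x] tail_sum_le[of n N] C_ge_1 P_pos[of n] by (intro mult_left_mono) auto
  finally show ?thesis .
qed

lemma H_fixed_off_supports:
  assumes "\<And>k. k > n \<Longrightarrow> 1 / 2 ^ (k + 1) \<le> qr k * x - of_int \<lfloor>qr k * x\<rfloor>" "n \<le> N"
  shows "H N x = H n x"
  using assms(2)
proof (induction N rule: dec_induct)
  case (step N)
  have "g (Suc N) x = x"
    using step_mapD(2)[OF tower.step[OF tower_axioms, of "Suc N"], of x] assms(1)[of "Suc N"] step(1) by simp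
  then show ?case using step by (simp add: H_Suc)
qed simp

lemma power_ratio_le:
  assumes "1 \<le> b" "b \<le> real m" "i + k + 1 \<le> j"
  shows "b ^ k * real m ^ i / real m ^ j \<le> 1 / real m"
proof -
  have m: "1 \<le> real m" using assms by simp
  have "b ^ k * real m ^ i * real m \<le> real m ^ k * real m ^ i * real m"
    using assms by (intro mult_right_mono power_mono) auto
  also have "\<dots> = real m ^ (i + k + 1)" by (simp add: power_add)
  also have "\<dots> \<le> real m ^ j" using m assms by (intro power_increasing) auto
  finally show ?thesis using m by (simp add: field_simps)
qed

end

section \<open>Images of the supports at jumps\<close>

lemma emeasure_Union_intervals_le:
  fixes a b :: "nat \<Rightarrow> nat \<Rightarrow> real"
  assumes fin: "\<And>k. finite (I k)" and ab: "\<And>k i. i \<in> I k \<Longrightarrow> a k i \<le> b k i" and s: "0 \<le> s"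
    and le: "\<And>k. (\<Sum>i\<in>I k. b k i - a k i) \<le> s * (1/2) ^ k"
  shows "emeasure lborel (\<Union>k. \<Union>i\<in>I k. {a k i..b k i}) \<le> ennreal (2 * s)"
proof -
  have 1: "emeasure lborel (\<Union>i\<in>I k. {a k i..b k i}) \<le> ennreal (s * (1/2) ^ k)" for k
  proof -
    have "emeasure lborel (\<Union>i\<in>I k. {a k i..b k i}) \<le> (\<Sum>i\<in>I k. emeasure lborel {a k i..b k i})"
      by (rule emeasure_subadditive_finite) (auto simp: fin)
    also have "\<dots> = (\<Sum>i\<in>I k. ennreal (b k i - a k i))" using ab by (intro sum.cong) auto
    also have "\<dots> = ennreal (\<Sum>i\<in>I k. b k i - a k i)" using ab by (intro sum_ennreal) auto
    finally show ?thesis using le[of k] by (meson ennreal_leI order_trans)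
  qed
  have "emeasure lborel (\<Union>k. \<Union>i\<in>I k. {a k i..b k i}) \<le> (\<Sum>k. emeasure lborel (\<Union>i\<in>I k. {a k i..b k i}))"
    by (rule emeasure_subadditive_countably) (auto intro!: sets.finite_UN fin)
  also have "\<dots> \<le> (\<Sum>k. ennreal (s * (1/2) ^ k))" by (intro suminf_le 1) auto
  also have "\<dots> = ennreal (\<Sum>k. s * (1/2) ^ k)" using s by (intro suminf_ennreal2) (auto intro: summable_mult)
  also have "(\<Sum>k. s * (1/2) ^ k) = 2 * s" by (subst suminf_mult) (auto simp: suminf_geometric)
  finally show ?thesis .
qed

lemma step_map_zones:
  assumes "step_map C t Q n g g'"
  obtains Z where "finite Z" "card Z \<le> 4"
    "\<forall>a b. (a, b) \<in> Z \<longrightarrow> 0 \<le> a \<and> a \<le> b \<and> b \<le> 1 / real Q \<and> g b - g a \<le> 2 * t / real Q"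
    "\<forall>x y. x \<le> y \<longrightarrow> (\<forall>a b. (a, b) \<in> Z \<longrightarrow> (\<forall>l. y \<le> a + of_int l / real Q \<or> b + of_int l / real Q \<le> x)) \<longrightarrow> g' x = g' y"
  using assms unfolding step_map_def affine_off_zones_def by (elim conjE exE)

context tower
begin

definition support :: "nat \<Rightarrow> real set" where
  "support n = {x. \<exists>k>n. qr k * x - of_int \<lfloor>qr k * x\<rfloor> < 1 / 2 ^ (k + 1)}"

lemma support_cover:
  "support n \<inter> {0..<1} \<subseteq> (\<Union>j. \<Union>i<q (n+1+j).
     {real i / qr (n+1+j) .. real i / qr (n+1+j) + 1 / 2 ^ (n+1+j+1) / qr (n+1+j)})"
proof
  fix x assume "x \<in> support n \<inter> {0..<1}"
  then obtain k where k: "k > n" "qr k * x - of_int \<lfloor>qr k * x\<rfloor> < 1 / 2 ^ (k + 1)" and x: "0 \<le> x" "x < 1"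
    by (auto simp: support_def)
  define i where "i = nat \<lfloor>qr k * x\<rfloor>"
  have Q: "0 < qr k" using q_pos[of k] k by simp
  have "0 \<le> qr k * x" "qr k * x < qr k" using x Q by auto
  then have i: "of_int \<lfloor>qr k * x\<rfloor> = real i" "i < q k" unfolding i_def by (auto simp: floor_less_iff nat_less_iff)
  have "real i \<le> qr k * x" using i(1) by linarith
  moreover have "qr k * x \<le> real i + 1 / 2 ^ (k + 1)" using k(2) unfolding i(1) by linarith
  ultimately have "real i / qr k \<le> x" "x \<le> (real i + 1 / 2 ^ (k + 1)) / qr k"
    using Q by (simp_all add: pos_divide_le_eq pos_le_divide_eq mult.commute)
  then have "x \<in> {real i / qr k .. real i / qr k + 1 / 2 ^ (k+1) / qr k}"
    by (simp add: add_divide_distrib)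
  moreover obtain j where "k = n + 1 + j" using k(1) less_iff_Suc_add[of n k] by auto
  ultimately show "x \<in> (\<Union>j. \<Union>i<q (n+1+j).
     {real i / qr (n+1+j) .. real i / qr (n+1+j) + 1 / 2 ^ (n+1+j+1) / qr (n+1+j)})"
    using i(2) by blast
qed

lemma support_measure:
  "\<exists>Y\<in>sets lborel. support n \<inter> {0..<1} \<subseteq> Y \<and> emeasure lborel Y \<le> ennreal ((1/2) ^ n)"
proof (intro bexI conjI)
  let ?a = "\<lambda>j i. real i / qr (n+1+j)" and ?b = "\<lambda>j i. real i / qr (n+1+j) + 1 / 2 ^ (n+1+j+1) / qr (n+1+j)"
  show "support n \<inter> {0..<1} \<subseteq> (\<Union>j. \<Union>i<q (n+1+j). {?a j i..?b j i})" by (rule support_cover)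
  show "(\<Union>j. \<Union>i<q (n+1+j). {?a j i..?b j i}) \<in> sets lborel" by auto
  have "emeasure lborel (\<Union>j. \<Union>i\<in>{..<q (n+1+j)}. {?a j i..?b j i}) \<le> ennreal (2 * (1/2) ^ (n + 2))"
  proof (rule emeasure_Union_intervals_le)
    fix j
    have "0 < q (n+1+j)" using q_pos[of "n+1+j"] by simp
    then have "(\<Sum>i\<in>{..<q (n+1+j)}. ?b j i - ?a j i) = (1/2) ^ (n + 2) * (1/2) ^ j"
      by (simp add: power_add power_one_over field_simps)
    then show "(\<Sum>i\<in>{..<q (n+1+j)}. ?b j i - ?a j i) \<le> (1/2) ^ (n + 2) * (1/2) ^ j" by simp
  qed auto
  also have "\<dots> \<le> ennreal ((1/2) ^ n)" by (intro ennreal_leI) (simp add: power_add)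
  finally show "emeasure lborel (\<Union>j. \<Union>i<q (n+1+j). {?a j i..?b j i}) \<le> ennreal ((1/2) ^ n)" .
qed

lemma H_off_support: "x \<notin> support n \<Longrightarrow> n \<le> N \<Longrightarrow> H N x = H n x"
proof (rule H_fixed_off_supports)
  fix k assume "x \<notin> support n" "k > n"
  then have "\<not> qr k * x - of_int \<lfloor>qr k * x\<rfloor> < 1 / 2 ^ (k + 1)"
    unfolding support_def by blast
  then show "1 / 2 ^ (k + 1) \<le> qr k * x - of_int \<lfloor>qr k * x\<rfloor>" by linarith
qed

text \<open>The bound \<open>K \<le> q n\<close> turns constants to the power \<open>n\<close> into
  \<open>q n ^ n\<close>. The threshold 7 is where the exponents of \<open>jump_distortion\<close>
  fit: \<open>(2 * n + 4) + n + 1 \<le> 4 * n - 2\<close>.\<close>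

definition jump :: "nat \<Rightarrow> bool" where
  "jump n \<longleftrightarrow> 7 \<le> n \<and> K \<le> qr n \<and> qr n ^ (4 * n - 2) \<le> 2 * qr (Suc n)"

lemma C_le_K: "C \<le> K" "1 \<le> K" using C_ge_1 by (auto simp: K_def)

lemma jump_recip: "jump n \<Longrightarrow> 1 / qr (Suc n) \<le> 2 / qr n ^ (4 * n - 2)"
proof -
  assume j: "jump n"
  then have "0 < qr n" "0 < qr (Suc n)" using q_pos[of n] q_pos[of "Suc n"] by (auto simp: jump_def)
  then show ?thesis using j by (simp add: jump_def field_simps)
qed

lemma jump_ratio:
  assumes "jump n" "1 \<le> b" "b \<le> K" "i + n + 1 \<le> j"
  shows "b ^ n * qr n ^ i / qr n ^ j \<le> 1 / qr n"
  using assms by (intro power_ratio_le) (auto simp: jump_def)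

lemma jump_H_error: assumes "jump n" shows "C ^ n * P n * gap n \<le> 2 / qr n"
proof -
  have n: "1 \<le> n" "7 \<le> n" using assms by (auto simp: jump_def)
  have "(1::real) \<le> 2 ^ (n + 1)" by (rule one_le_power) simp
  then have "1 * qr (Suc n) \<le> 2 ^ (n + 1) * qr (Suc n)" by (rule mult_right_mono) simp
  then have "gap n \<le> 1 / qr (Suc n)"
    using q_pos[of "Suc n"] unfolding gap_def by (intro divide_left_mono) auto
  also have "\<dots> \<le> 2 / qr n ^ (4 * n - 2)" by (rule jump_recip[OF assms])
  finally have "C ^ n * P n * gap n \<le> C ^ n * qr n ^ (2 * n) * (2 / qr n ^ (4 * n - 2))"
    using C_ge_1 P_pos[of n] P_le[OF n(1)] by (intro mult_mono) (auto simp: gap_def)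
  also have "\<dots> = 2 * (C ^ n * qr n ^ (2 * n) / qr n ^ (4 * n - 2))" by simp
  also have "\<dots> \<le> 2 * (1 / qr n)"
    using n C_ge_1 C_le_K by (intro mult_left_mono jump_ratio[OF assms]) auto
  finally show ?thesis by simp
qed

text \<open>With \<open>n = Suc m\<close>, the map \<open>g n\<close> stretches a cell of length
  \<open>1 / q (n + 1)\<close> to at most \<open>C / t n\<close> times that length. The left side
  bounds how much the logarithm of the slope of \<open>H m\<close> varies over the stretched
  cell.\<close>

lemma jump_distortion:
  assumes "jump (Suc m)"
  shows "W m * (C / t (Suc m) * (1 / qr (Suc (Suc m)))) \<le> 1 / 2"
proof -
  let ?n = "Suc m" let ?q = "qr (Suc m)"
  have n: "7 \<le> ?n" using assms by (auto simp: jump_def)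
  have q: "7 \<le> ?q" using q_ge[of ?n] n by simp
  have "(qr m ^ (2 * m)) ^ 5 \<le> ?q ^ 5" using q_growth_real[of m] n by (intro power_mono) auto
  then have "qr m ^ (10 * m) \<le> ?q ^ 5" by (simp add: power_mult[symmetric] mult.commute)
  then have "K ^ m * qr m ^ (10 * m) \<le> K ^ m * ?q ^ 5" using C_le_K by (intro mult_left_mono) auto
  then have W: "W m \<le> K ^ m * ?q ^ 5" using W_le[of m] n by linarith
  have "C / t ?n * (1 / qr (Suc ?n)) \<le> K * ?q ^ (2 * ?n - 1) * (2 / ?q ^ (4 * ?n - 2))"
    using C_le_K C_ge_1 jump_recip[OF assms] by (intro mult_mono) (auto simp: t_eq mult_right_mono)
  from mult_mono[OF W this]
  have "W m * (C / t ?n * (1 / qr (Suc ?n))) \<le> K ^ m * ?q ^ 5 * (K * ?q ^ (2 * ?n - 1) * (2 / ?q ^ (4 * ?n - 2)))"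
    using C_ge_1 C_le_K t_pos[of ?n] by simp
  also have "\<dots> = 2 * (K ^ ?n * ?q ^ (5 + (2 * ?n - 1)) / ?q ^ (4 * ?n - 2))"
    unfolding power_add by (simp only: mult_ac power_Suc times_divide_eq_right times_divide_eq_left)
  also have "\<dots> \<le> 2 * (1 / ?q)"
    using n C_le_K by (intro mult_left_mono jump_ratio[OF assms]) auto
  also have "\<dots> \<le> 1 / 2" using q by (simp add: field_simps)
  finally show ?thesis .
qed

text \<open>With \<open>n = Suc m\<close>, the left side is the number \<open>4 * q n\<close> of
  zone translates times the bound for the image of one of them under \<open>H n\<close>, after
  widening by \<open>1 / q (n + 1)\<close> on both sides.\<close>

lemma jump_bad_bound:
  assumes "jump (Suc m)"
  shows "8 * (C ^ m * P m) * (t (Suc m) + qr (Suc m) * (1 / qr (Suc (Suc m))) * (C / t (Suc m)))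
    \<le> 24 / qr (Suc m)"
proof -
  let ?n = "Suc m" let ?q = "qr (Suc m)"
  have n: "7 \<le> ?n" using assms by (auto simp: jump_def)
  have q: "7 \<le> ?q" using q_ge[of ?n] n by simp
  have L: "C ^ m * P m \<le> C ^ ?n * ?q"
    using C_ge_1 P_le_next[of m] P_pos[of m] power_increasing[of m ?n C] by (intro mult_mono) auto
  have "C ^ m * P m * t ?n \<le> C ^ ?n * ?q * (1 / ?q ^ (2 * ?n - 1))"
    using L t_pos[of ?n] by (simp only: t_eq) (intro mult_right_mono, auto)
  also have "\<dots> = C ^ ?n * ?q ^ 1 / ?q ^ (2 * ?n - 1)" by simp
  also have "\<dots> \<le> 1 / ?q" using n C_ge_1 C_le_K by (intro jump_ratio[OF assms]) auto
  finally have 1: "C ^ m * P m * t ?n \<le> 1 / ?q" .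
  have "?q * (1 / qr (Suc ?n)) * (C / t ?n) \<le> ?q * (2 / ?q ^ (4 * ?n - 2)) * (C * ?q ^ (2 * ?n - 1))"
    using C_ge_1 jump_recip[OF assms] by (intro mult_mono) (auto simp: t_eq)
  moreover have "C ^ m * P m \<le> C ^ m * ?q"
    using C_ge_1 P_le_next[of m] by (intro mult_left_mono) auto
  ultimately have "C ^ m * P m * (?q * (1 / qr (Suc ?n)) * (C / t ?n)) \<le>
      (C ^ m * ?q) * (?q * (2 / ?q ^ (4 * ?n - 2)) * (C * ?q ^ (2 * ?n - 1)))"
    using C_ge_1 t_pos[of ?n] by (intro mult_mono[where a = "C ^ m * P m" and b = "C ^ m * ?q"]) auto
  also have "\<dots> = 2 * (C ^ ?n * ?q ^ (1 + 1 + (2 * ?n - 1)) / ?q ^ (4 * ?n - 2))"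
    unfolding power_add power_one_right by (simp only: mult_ac power_Suc times_divide_eq_right times_divide_eq_left)
  also have "\<dots> \<le> 2 * (1 / ?q)"
    using n C_ge_1 C_le_K by (intro mult_left_mono jump_ratio[OF assms]) auto
  finally have 2: "C ^ m * P m * (?q * (1 / qr (Suc ?n)) * (C / t ?n)) \<le> 2 * (1 / ?q)" .
  have "8 * (C ^ m * P m) * (t ?n + ?q * (1 / qr (Suc ?n)) * (C / t ?n))
    = 8 * (C ^ m * P m * t ?n) + 8 * (C ^ m * P m * (?q * (1 / qr (Suc ?n)) * (C / t ?n)))"
    by (simp only: distrib_left mult.assoc)
  also have "\<dots> \<le> 8 * (1 / ?q) + 8 * (2 * (1 / ?q))" using 1 2 by linarith
  finally show ?thesis by simp
qed

text \<open>The supports of the later maps are cut into cells of length \<open>1 / q k\<close>. On a good cell, one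
  inside an affine piece of \<open>g n\<close>, the map \<open>H n\<close> has distortion at most 2, so the fraction of
  the cell that is covered at most doubles. The bad cells lie near the zones of \<open>g n\<close>, whose
  images are short.\<close>

lemma jump_image_measure:
  assumes j: "jump (Suc m)"
  shows "\<exists>Y\<in>sets lborel. H (Suc m) ` (support (Suc m) \<inter> {0..<1}) \<subseteq> Y \<and>
    emeasure lborel Y \<le> ennreal ((1/2) ^ Suc m + 24 / qr (Suc m))"
proof -
  define n where "n = Suc m"
  define Q where "Q = qr n"
  define r where "r = 1 / qr (Suc n)"
  define h where "h = H n"
  have n1: "n \<ge> 1" by (simp add: n_def)
  have Q: "0 < Q" using q_pos[of n] by (simp add: Q_def n_def)
  have r: "0 < r" using q_pos[of "Suc n"] by (simp add: r_def)
  note st = step[OF n1, folded t_def]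
  have st_tame: "tame (g n) (g' n) (t n / C) (C / t n) (2 * C * 2 ^ (n + 1) * qr n / t n ^ 5)"
    by (rule step_mapD(1)[OF st])
  note gm = tame_mono[OF st_tame]
  note hm = tame_mono[OF tame_H[of n], folded h_def]
  obtain Z where Z0: "finite Z" "card Z \<le> 4"
    "\<forall>a b. (a, b) \<in> Z \<longrightarrow> 0 \<le> a \<and> a \<le> b \<and> b \<le> 1 / Q \<and> g n b - g n a \<le> 2 * t n / Q"
    "\<forall>x y. x \<le> y \<longrightarrow> (\<forall>a b. (a, b) \<in> Z \<longrightarrow> (\<forall>l. y \<le> a + of_int l / Q \<or> b + of_int l / Q \<le> x)) \<longrightarrow> g' n x = g' n y"
    by (rule step_map_zones[OF st, folded Q_def])
  note Z = Z0(1,2) Z0(3)[rule_format] Z0(4)[THEN spec, THEN spec, THEN mp, THEN mp]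
  define x where "x j i = real i / qr (n+1+j)" for j i :: nat
  define y where "y j i = x j i + 1 / 2 ^ (n+1+j+1) / qr (n+1+j)" for j i
  \<comment> \<open>The whole cell up to \<open>x j (Suc i)\<close> has to avoid the zones, not only
    its covered part up to \<open>y j i\<close>, since the two are compared.\<close>
  define good where "good j = {i. i < q (n+1+j) \<and> (\<forall>a b l. (a, b) \<in> Z \<longrightarrow>
      x j (Suc i) \<le> a + of_int l / Q \<or> b + of_int l / Q \<le> x j i)}" for j
  define G where "G = (\<Union>j. \<Union>i\<in>good j. {h (x j i)..h (y j i)})"
  \<comment> \<open>The margin \<open>r\<close> is the largest possible cell length, so a widened
    zone contains every cell that meets the zone.\<close>
  define B where "B = (\<Union>z\<in>Z \<times> {..<q n}. case z of ((a, b), l) \<Rightarrow>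
      {h (a + real l / Q - r)..h (b + real l / Q + r)})"
  have qj: "0 < qr (n+1+j)" "1 / qr (n+1+j) \<le> r" for j
  proof -
    show *: "0 < qr (n+1+j)" using q_pos[of "n+1+j"] by simp
    show "1 / qr (n+1+j) \<le> r"
      using q_mono[of "Suc n" "n+1+j"] q_pos[of "Suc n"] unfolding r_def by (intro divide_left_mono) auto
  qed
  have xs: "x j (Suc i) = x j i + 1 / qr (n+1+j)" for j i
    by (simp add: x_def add_divide_distrib)
  have xy: "x j i < y j i" "y j i \<le> x j (Suc i)" for j i
  proof -
    show "x j i < y j i" using qj(1)[of j] by (simp add: y_def)
    have "(1::real) \<le> 2 ^ (n+1+j+1)" by (rule one_le_power) simp
    then have "1 / 2 ^ (n+1+j+1) / qr (n+1+j) \<le> 1 / qr (n+1+j)"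
      using qj(1)[of j] by (intro divide_right_mono) auto
    then show "y j i \<le> x j (Suc i)" by (simp add: y_def xs)
  qed
  have good_le: "h (y j i) - h (x j i) \<le> (1/2) ^ (n+1+j) * (h (x j (Suc i)) - h (x j i))" if "i \<in> good j" for j i
  proof -
    have const: "g' n (x j i) = g' n z" if z: "x j i \<le> z" "z \<le> x j (Suc i)" for z
    proof (rule Z(4)[OF z(1)], intro allI impI)
      fix a b l assume "(a, b) \<in> Z"
      then show "z \<le> a + of_int l / Q \<or> b + of_int l / Q \<le> x j i"
        using \<open>i \<in> good j\<close> z(2) unfolding good_def by force
    qed
    \<comment> \<open>The slope of \<open>H n\<close> is \<open>H' m\<close> at \<open>g n z\<close>
      times \<open>g' n z\<close>. The second factor is constant on a good cell, and the first
      varies by at most \<open>exp (1 / 2) \<le> 2\<close>.\<close>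
    have dist: "H' n z \<le> 2 * H' n z'"
      if z: "x j i \<le> z" "z \<le> x j (Suc i)" "x j i \<le> z'" "z' \<le> x j (Suc i)" for z z'
    proof -
      have "\<bar>z - z'\<bar> \<le> r" using z qj(2)[of j] unfolding xs by linarith
      then have "\<bar>g n z - g n z'\<bar> \<le> C / t n * r"
        using tame_lipschitz[OF st_tame, of z z'] tameD(10)[OF st_tame]
        by (meson less_imp_le mult_left_mono order_trans)
      then have "W m * \<bar>g n z - g n z'\<bar> \<le> W m * (C / t n * r)"
        using tameD(2)[OF tame_H[of m]] by (rule mult_left_mono)
      also have "\<dots> \<le> 1 / 2" using jump_distortion[OF j] by (simp add: n_def r_def)
      finally have "exp (W m * \<bar>g n z - g n z'\<bar>) \<le> exp (1 / 2)" by simp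
      also have "\<dots> \<le> 2" by (rule exp_half_le2)
      finally have "exp (W m * \<bar>g n z - g n z'\<bar>) * H' m (g n z') \<le> 2 * H' m (g n z')"
        using tameD(9)[OF tame_H[of m]] by (intro mult_right_mono) (auto simp: less_imp_le)
      then have "H' m (g n z) \<le> 2 * H' m (g n z')"
        using tameD(8)[OF tame_H[of m], of "g n z" "g n z'"] by linarith
      then have "H' m (g n z) * g' n z \<le> 2 * H' m (g n z') * g' n z"
        using tameD(9)[OF st_tame] by (intro mult_right_mono) (auto simp: less_imp_le)
      also have "g' n z = g' n z'" using const z by metis
      finally show ?thesis using \<open>g' n z = g' n z'\<close> by (simp add: n_def mult.assoc)
    qed
    have D: "(h has_real_derivative H' n z) (at z)" for z
      unfolding h_def by (rule tameD(5)[OF tame_H])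
    obtain z where z: "x j i < z" "z < y j i" "h (y j i) - h (x j i) = (y j i - x j i) * H' n z"
      using MVT2[OF xy(1)[of j i], of h "H' n"] D by blast
    have "x j i < x j (Suc i)" using xy[of j i] by linarith
    then obtain z' where z': "x j i < z'" "z' < x j (Suc i)"
      "h (x j (Suc i)) - h (x j i) = (x j (Suc i) - x j i) * H' n z'"
      using MVT2[of "x j i" "x j (Suc i)" h "H' n"] D by blast
    have "h (y j i) - h (x j i) \<le> (y j i - x j i) * (2 * H' n z')"
      unfolding z(3) using dist[of z z'] z z' xy[of j i] by (intro mult_left_mono) auto
    also have "\<dots> = (1/2) ^ (n+1+j) * ((x j (Suc i) - x j i) * H' n z')"
      by (simp add: y_def xs power_one_over)
    finally show ?thesis unfolding z'(3) .
  qed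
  have "emeasure lborel G \<le> ennreal (2 * (1/2) ^ (n + 1))"
    unfolding G_def
  proof (rule emeasure_Union_intervals_le)
    fix j
    show "finite (good j)" by (simp add: good_def)
    show "h (x j i) \<le> h (y j i)" for i
      using xy(1)[of j i] by (simp add: strict_mono_less_eq[OF hm])
    have "(\<Sum>i\<in>good j. h (y j i) - h (x j i)) \<le> (\<Sum>i\<in>good j. (1/2) ^ (n+1+j) * (h (x j (Suc i)) - h (x j i)))"
      by (rule sum_mono) (rule good_le)
    also have "\<dots> \<le> (\<Sum>i<q (n+1+j). (1/2) ^ (n+1+j) * (h (x j (Suc i)) - h (x j i)))"
    proof (rule sum_mono2)
      show "good j \<subseteq> {..<q (n+1+j)}" by (auto simp: good_def)
      fix i
      have "x j i \<le> x j (Suc i)" using xy[of j i] by linarith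
      then show "0 \<le> (1/2) ^ (n+1+j) * (h (x j (Suc i)) - h (x j i))"
        by (simp add: strict_mono_less_eq[OF hm])
    qed simp
    \<comment> \<open>Over all cells the images fill the unit interval, because the lift fixes 0 and
      maps 1 to 1.\<close>
    also have "\<dots> = (1/2) ^ (n+1+j) * (h (x j (q (n+1+j))) - h (x j 0))"
      by (simp only: sum_distrib_left[symmetric] sum_lessThan_telescope[of "\<lambda>i. h (x j i)"])
    also have "\<dots> = (1/2) ^ (n + 1) * (1/2) ^ j"
    proof -
      have "x j (q (n+1+j)) = 1" "x j 0 = 0" using qj(1)[of j] by (simp_all add: x_def)
      then show ?thesis using tameD(3)[OF tame_H, of n] tameD(4)[OF tame_H, of n 0] by (simp add: h_def power_add)
    qed
    finally show "(\<Sum>i\<in>good j. h (y j i) - h (x j i)) \<le> (1/2) ^ (n + 1) * (1/2) ^ j" .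
  qed simp
  then have G: "emeasure lborel G \<le> ennreal ((1/2) ^ n)" by simp
  define L where "L = C ^ m * P m"
  \<comment> \<open>The image of a zone under \<open>g n\<close> has length at most
    \<open>2 * t n / Q\<close>, each margin adds \<open>C / t n * r\<close>, and \<open>H m\<close>
    stretches by at most \<open>L\<close>.\<close>
  define \<beta> where "\<beta> = L * (2 * t n / Q + 2 * r * (C / t n))"
  have L: "0 \<le> L" using C_ge_1 P_pos[of m] by (simp add: L_def)
  have tn: "0 < t n" using t_pos[OF n1] .
  have \<beta>: "0 \<le> \<beta>" using L tn Q r C_ge_1 by (simp add: \<beta>_def)
  have bad_le: "emeasure lborel {h (a + real l / Q - r)..h (b + real l / Q + r)} \<le> ennreal \<beta>"
    if "(a, b) \<in> Z" for a b l
  proof -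
    note z = Z(3)[OF that]
    have le: "a + real l / Q - r \<le> b + real l / Q + r" using z r by linarith
    have hg: "h u - h v \<le> L * (g n u - g n v)" if "v \<le> u" for u v
      using tame_lipschitz[OF tame_H[of m], of "g n u" "g n v"] that
        strict_mono_less_eq[OF gm, of v u] by (simp add: h_def n_def H_Suc L_def)
    have g_sh: "g n (u + real l / Q) = g n u + real l / Q" for u
      using step_mapD(4)[OF st, of u "int l"] by (simp add: Q_def)
    have "\<bar>g n (b + r) - g n b\<bar> \<le> C / t n * r" "\<bar>g n a - g n (a - r)\<bar> \<le> C / t n * r"
      using tame_lipschitz[OF st_tame, of "b + r" b] tame_lipschitz[OF st_tame, of a "a - r"] r by auto
    moreover have "2 * r * (C / t n) = 2 * (C / t n * r)" by simp
    ultimately have "g n (b + r) - g n (a - r) \<le> 2 * t n / Q + 2 * r * (C / t n)"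
      using z by linarith
    moreover have "g n (b + real l / Q + r) = g n (b + r) + real l / Q" "g n (a + real l / Q - r) = g n (a - r) + real l / Q"
      using g_sh[of "b + r"] g_sh[of "a - r"] by (simp_all add: algebra_simps)
    ultimately have "g n (b + real l / Q + r) - g n (a + real l / Q - r) \<le> 2 * t n / Q + 2 * r * (C / t n)"
      by simp
    then have "h (b + real l / Q + r) - h (a + real l / Q - r) \<le> \<beta>"
      unfolding \<beta>_def by (intro order_trans[OF hg[OF le]] mult_left_mono L)
    moreover have "h (a + real l / Q - r) \<le> h (b + real l / Q + r)"
      using le by (simp add: strict_mono_less_eq[OF hm])
    ultimately show ?thesis by (simp add: ennreal_leI)
  qed
  have "emeasure lborel B \<le> (\<Sum>z\<in>Z \<times> {..<q n}. emeasure lborel (case z of ((a, b), l) \<Rightarrow>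
      {h (a + real l / Q - r)..h (b + real l / Q + r)}))"
    unfolding B_def using Z(1) by (intro emeasure_subadditive_finite) auto
  also have "\<dots> \<le> (\<Sum>z\<in>Z \<times> {..<q n}. ennreal \<beta>)"
    by (intro sum_mono) (auto intro: bad_le)
  also have "\<dots> = ennreal (real (card (Z \<times> {..<q n})) * \<beta>)"
    using \<beta> by (simp add: ennreal_mult'' ennreal_of_nat_eq_real_of_nat)
  also have "\<dots> \<le> ennreal (4 * Q * \<beta>)"
    using Z(2) \<beta> by (intro ennreal_leI mult_right_mono) (auto simp: card_cartesian_product Q_def intro: mult_right_mono)
  also have "4 * Q * \<beta> = 8 * L * (t n + Q * r * (C / t n))"
    using Q by (simp add: \<beta>_def field_simps)
  also have "ennreal \<dots> \<le> ennreal (24 / Q)"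
    using jump_bad_bound[OF j] by (intro ennreal_leI) (simp add: L_def n_def Q_def r_def)
  finally have B: "emeasure lborel B \<le> ennreal (24 / Q)" .
  have sub: "h ` (support n \<inter> {0..<1}) \<subseteq> G \<union> B"
  proof
    fix w assume "w \<in> h ` (support n \<inter> {0..<1})"
    then obtain s where s: "s \<in> support n \<inter> {0..<1}" "w = h s" by blast
    then obtain j i where ji: "i < q (n+1+j)" "x j i \<le> s" "s \<le> y j i"
      using support_cover[of n] unfolding x_def y_def by force
    show "w \<in> G \<union> B"
    proof (cases "i \<in> good j")
      case True
      then show ?thesis using ji s(2) by (auto simp: G_def strict_mono_less_eq[OF hm])
    next
      case False
      then obtain a b l where abl: "(a, b) \<in> Z" "a + of_int l / Q < x j (Suc i)" "x j i < b + of_int l / Q"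
        using ji(1) unfolding good_def by (auto simp: not_le)
      note z = Z(3)[OF abl(1)]
      \<comment> \<open>Since the cell lies in the unit interval, the translate that it meets has
        its index between 0 and \<open>q n - 1\<close>, as the finite union \<open>B\<close>
        demands.\<close>
      have "0 \<le> x j i" by (simp add: x_def)
      then have "0 < (1 + of_int l) / Q" using abl(3) z unfolding add_divide_distrib by linarith
      then have l0: "0 \<le> l" using Q by (simp add: zero_less_divide_iff)
      have "x j (Suc i) \<le> 1" using ji(1) qj(1)[of j] unfolding x_def by (simp add: field_simps)
      then have "of_int l / Q < 1" using abl(2) z by linarith
      then have l1: "l < int (q n)" using Q by (simp add: Q_def field_simps)
      have "a + of_int l / Q - r \<le> s" using abl(2) ji qj(2)[of j] unfolding xs by linarith
      moreover have "s \<le> b + of_int l / Q + r" using abl(3) ji qj(2)[of j] xy(2)[of j i] unfolding xs by linarith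
      ultimately have "w \<in> {h (a + real (nat l) / Q - r)..h (b + real (nat l) / Q + r)}"
        using l0 s(2) by (simp add: strict_mono_less_eq[OF hm])
      moreover have "((a, b), nat l) \<in> Z \<times> {..<q n}" using abl(1) l0 l1 by auto
      ultimately show ?thesis unfolding B_def by blast
    qed
  qed
  have meas: "G \<in> sets lborel" "B \<in> sets lborel"
  proof -
    show "G \<in> sets lborel" unfolding G_def good_def by (intro sets.countable_UN' sets.finite_UN) auto
    show "B \<in> sets lborel" unfolding B_def using Z(1) by (intro sets.finite_UN) auto
  qed
  have "emeasure lborel (G \<union> B) \<le> emeasure lborel G + emeasure lborel B"
    by (rule emeasure_subadditive[OF meas])
  also have "\<dots> \<le> ennreal ((1/2) ^ n) + ennreal (24 / Q)" by (intro add_mono G B)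
  also have "\<dots> = ennreal ((1/2) ^ n + 24 / Q)" using Q by (simp add: ennreal_plus)
  finally show ?thesis using sub meas unfolding h_def n_def Q_def by blast
qed

end

section \<open>The limit homeomorphism\<close>

locale jump_tower = tower +
  assumes jumps: "\<And>N. \<exists>n\<ge>N. real (q n) ^ (4 * n - 2) \<le> 2 * real (q (n + 1))"
begin

lemma ex_jump: "\<exists>n\<ge>N. jump n"
proof -
  define N' where "N' = max N (max 7 (nat \<lceil>K\<rceil>))"
  obtain n where n: "n \<ge> N'" "qr n ^ (4 * n - 2) \<le> 2 * qr (n + 1)" using jumps by blast
  have n': "n \<ge> N" "n \<ge> 7" "n \<ge> nat \<lceil>K\<rceil>" using n(1) by (auto simp: N'_def)
  have "K \<le> real n" using n'(3) by linarith
  also have "\<dots> \<le> qr n" using q_ge[of n] n'(2) by simp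
  finally show ?thesis using n n' unfolding jump_def by auto
qed

lemma ex_jump_small:
  assumes "0 < e"
  shows "\<exists>n\<ge>N. jump n \<and> (1/2) ^ n + 24 / qr n < e"
proof -
  have "(\<lambda>n. 24 / real (Suc n)) \<longlonglongrightarrow> 0"
    using tendsto_mult_right_zero[OF LIMSEQ_inverse_real_of_nat, of 24] by (simp only: divide_inverse)
  then have "(\<lambda>n. (1/2::real) ^ n + 24 / real (Suc n)) \<longlonglongrightarrow> 0 + 0"
    by (intro tendsto_add LIMSEQ_power_zero) auto
  then have "eventually (\<lambda>n. (1/2::real) ^ n + 24 / real (Suc n) < e) sequentially"
    by (rule order_tendstoD(2)) (use assms in simp)
  then obtain N' where N': "\<And>n. n \<ge> N' \<Longrightarrow> (1/2::real) ^ n + 24 / real (Suc n) < e"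
    by (auto simp: eventually_sequentially)
  obtain n where n: "n \<ge> max N N'" "jump n" using ex_jump by blast
  then have "real (Suc n) \<le> qr n" using q_ge[of n] unfolding jump_def by simp
  then have "24 / qr n \<le> 24 / real (Suc n)" by (intro divide_left_mono) auto
  then show ?thesis using N'[of n] n by (intro exI[of _ n]) auto
qed

text \<open>A single jump index \<open>n\<close> suffices for each tolerance, because
  \<open>H_close\<close> compares every later map, at a jump or not, with
  \<open>H n\<close>.\<close>

lemma H_limit_exists: "\<exists>h. uniform_limit UNIV H h sequentially"
proof -
  have "uniformly_Cauchy_on UNIV H"
  proof (rule uniformly_Cauchy_onI)
    fix e :: real assume "0 < e"
    then obtain n where n: "jump n" "(1/2) ^ n + 24 / qr n < e" using ex_jump_small by blast
    have "2 * (2 / qr n) \<le> 24 / qr n"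
      unfolding times_divide_eq_right by (rule divide_right_mono) auto
    moreover have "(0::real) < (1/2) ^ n" by simp
    ultimately have e: "2 * (2 / qr n) < e" using n(2) by linarith
    show "\<exists>M. \<forall>x\<in>UNIV. \<forall>m\<ge>M. \<forall>k\<ge>M. dist (H m x) (H k x) < e"
    proof (intro exI ballI allI impI)
      fix x m k assume "n \<le> m" "n \<le> k"
      then have "\<bar>H m x - H n x\<bar> \<le> 2 / qr n" "\<bar>H k x - H n x\<bar> \<le> 2 / qr n"
        using order_trans[OF H_close jump_H_error[OF n(1)]] by auto
      then show "dist (H m x) (H k x) < e" using e unfolding dist_real_def by linarith
    qed
  qed
  from Cauchy_uniformly_convergent[OF this] show ?thesis
    unfolding uniformly_convergent_on_def .
qed

lemma inv_H_limit_exists: "\<exists>k. uniform_limit UNIV (\<lambda>n. inv (H n)) k sequentially"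
proof -
  have "uniformly_Cauchy_on UNIV (\<lambda>n. inv (H n))"
  proof (rule uniformly_Cauchy_onI)
    fix e :: real assume "0 < e"
    then obtain n where n: "jump n" "(1/2) ^ n + 24 / qr n < e" using ex_jump_small by blast
    have "2 * gap n \<le> (1/2) ^ n"
      using q_pos[of "Suc n"] by (simp add: gap_def power_one_over field_simps)
    moreover have "(0::real) \<le> 24 / qr n" by simp
    ultimately have e: "2 * gap n < e" using n(2) by linarith
    show "\<exists>M. \<forall>x\<in>UNIV. \<forall>m\<ge>M. \<forall>k\<ge>M. dist (inv (H m) x) (inv (H k) x) < e"
    proof (intro exI ballI allI impI)
      fix x m k assume "n \<le> m" "n \<le> k"
      then have "\<bar>inv (H m) x - inv (H n) x\<bar> \<le> gap n" "\<bar>inv (H k) x - inv (H n) x\<bar> \<le> gap n"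
        using inv_H_close[of n _ x] by auto
      then show "dist (inv (H m) x) (inv (H k) x) < e" using e unfolding dist_real_def by linarith
    qed
  qed
  from Cauchy_uniformly_convergent[OF this] show ?thesis
    unfolding uniformly_convergent_on_def .
qed

definition Hlim :: "real \<Rightarrow> real" where "Hlim = (SOME h. uniform_limit UNIV H h sequentially)"
definition Klim :: "real \<Rightarrow> real" where "Klim = (SOME k. uniform_limit UNIV (\<lambda>n. inv (H n)) k sequentially)"

lemma Hlim: "uniform_limit UNIV H Hlim sequentially"
  unfolding Hlim_def using H_limit_exists by (rule someI_ex)

lemma Klim: "uniform_limit UNIV (\<lambda>n. inv (H n)) Klim sequentially"
  unfolding Klim_def using inv_H_limit_exists by (rule someI_ex)

lemma Hlim_pointwise: "(\<lambda>n. H n x) \<longlonglongrightarrow> Hlim x"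
  by (rule tendsto_uniform_limitI[OF Hlim]) simp

lemma Klim_pointwise: "(\<lambda>n. inv (H n) x) \<longlonglongrightarrow> Klim x"
  by (rule tendsto_uniform_limitI[OF Klim]) simp

lemma Hlim_continuous: "continuous_on UNIV Hlim"
  using tame_continuous[OF tame_H] by (intro uniform_limit_theorem[OF _ Hlim] always_eventually allI) auto

lemma Klim_continuous: "continuous_on UNIV Klim"
  using tame_continuous[OF tame_inv[OF tame_H]]
  by (intro uniform_limit_theorem[OF _ Klim] always_eventually allI) auto

lemma uniform_limit_compose_pointwise:
  fixes f :: "nat \<Rightarrow> real \<Rightarrow> real"
  assumes f: "uniform_limit UNIV f F sequentially" "continuous_on UNIV F" and x: "x \<longlonglongrightarrow> y"
  shows "(\<lambda>n. f n (x n)) \<longlonglongrightarrow> F y"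
proof -
  have "(\<lambda>n. F (x n)) \<longlonglongrightarrow> F y"
    by (rule continuous_on_tendsto_compose[OF f(2) x]) auto
  moreover have "(\<lambda>n. f n (x n) - F (x n)) \<longlonglongrightarrow> 0"
  proof (rule LIMSEQ_I)
    fix r :: real assume "0 < r"
    then obtain N where "\<And>n x. n \<ge> N \<Longrightarrow> dist (f n x) (F x) < r"
      using uniform_limitD[OF f(1), of r] by (auto simp: eventually_sequentially)
    then show "\<exists>no. \<forall>n\<ge>no. norm (f n (x n) - F (x n) - 0) < r" by (auto simp: dist_real_def)
  qed
  ultimately have "(\<lambda>n. (f n (x n) - F (x n)) + F (x n)) \<longlonglongrightarrow> 0 + F y" by (intro tendsto_add)
  then show ?thesis by simp
qed

lemma Hlim_Klim [simp]: "Hlim (Klim x) = x"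
proof -
  have "(\<lambda>n. H n (inv (H n) x)) \<longlonglongrightarrow> Hlim (Klim x)"
    by (rule uniform_limit_compose_pointwise[OF Hlim Hlim_continuous Klim_pointwise])
  then show ?thesis by (simp add: LIMSEQ_const_iff)
qed

lemma Klim_Hlim [simp]: "Klim (Hlim x) = x"
proof -
  have "(\<lambda>n. inv (H n) (H n x)) \<longlonglongrightarrow> Klim (Hlim x)"
    by (rule uniform_limit_compose_pointwise[OF Klim Klim_continuous Hlim_pointwise])
  then show ?thesis by (simp add: LIMSEQ_const_iff)
qed

lemma inv_Hlim: "inv Hlim = Klim"
  by (rule inv_unique_comp) (auto simp: fun_eq_iff)

lemma Hlim_0: "Hlim 0 = 0"
  using Hlim_pointwise[of 0] unfolding tameD(3)[OF tame_H] LIMSEQ_const_iff by simp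

lemma Hlim_add_1: "Hlim (x + 1) = Hlim x + 1"
proof -
  have "(\<lambda>n. H n (x + 1)) \<longlonglongrightarrow> Hlim x + 1"
    unfolding tameD(4)[OF tame_H] by (intro tendsto_add tendsto_const Hlim_pointwise)
  then show ?thesis by (rule LIMSEQ_unique[OF Hlim_pointwise])
qed

lemma Hlim_mono: "strict_mono Hlim"
proof (rule strict_monoI)
  fix x y :: real assume "x < y"
  then have "H n x \<le> H n y" for n
    using strict_mono_less_eq[OF tame_mono[OF tame_H[of n]]] by simp
  then have "Hlim x \<le> Hlim y"
    by (intro LIMSEQ_le[OF Hlim_pointwise Hlim_pointwise]) blast
  moreover have "Hlim x \<noteq> Hlim y"
  proof
    assume "Hlim x = Hlim y"
    then have "Klim (Hlim x) = Klim (Hlim y)" by (rule arg_cong)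
    then show False using \<open>x < y\<close> by simp
  qed
  ultimately show "Hlim x < Hlim y" by simp
qed

lemma Hlim_circle_homeo: "circle_homeo Hlim"
  by (simp add: circle_homeo_def Hlim_continuous Hlim_mono Hlim_add_1)

lemma Hlim_off_support: "x \<notin> support n \<Longrightarrow> Hlim x = H n x"
proof -
  assume "x \<notin> support n"
  then have "eventually (\<lambda>N. H N x = H n x) sequentially"
    unfolding eventually_sequentially using H_off_support[of x n] by blast
  then have "(\<lambda>N. H N x) \<longlonglongrightarrow> H n x" by (rule tendsto_eventually)
  then show ?thesis by (rule LIMSEQ_unique[OF Hlim_pointwise])
qed

section \<open>Null sets under the limit map and its inverse\<close>

lemma negligible_image_tame:
  assumes "tame f f' m L w" "negligible S"
  shows "negligible (f ` S)"
proof (rule negligible_differentiable_image_negligible[OF _ assms(2)])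
  show "f differentiable_on S"
    unfolding differentiable_on_def
  proof
    fix x
    have "f field_differentiable (at x within S)"
      using has_field_derivative_at_within[OF tameD(5)[OF assms(1)]] unfolding field_differentiable_def by blast
    then show "f differentiable (at x within S)" by (rule field_differentiable_imp_differentiable)
  qed
qed simp

lemma negligible_of_covers:
  fixes S :: "real set"
  assumes "\<And>e. 0 < e \<Longrightarrow> \<exists>N Y. negligible N \<and> Y \<in> sets lborel \<and> S \<subseteq> N \<union> Y \<and> emeasure lborel Y \<le> ennreal e"
  shows "negligible S"
  unfolding negligible_outer_le
proof (intro allI impI)
  fix e :: real assume e: "0 < e"
  then obtain N Y where NY: "negligible N" "Y \<in> sets lborel" "S \<subseteq> N \<union> Y" "emeasure lborel Y \<le> ennreal e"
    using assms by blast
  have em: "emeasure lebesgue Y \<le> ennreal e" using NY(4) emeasure_completion[of Y lborel] NY(2) by simp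
  have "Y \<in> sets lebesgue" using NY(2) by simp
  then have Y: "Y \<in> lmeasurable"
    using le_less_trans[OF em ennreal_less_top] by (simp add: fmeasurable_def)
  have N: "N \<in> lmeasurable" using NY(1) by (rule negligible_imp_measurable)
  have "measure lebesgue Y \<le> e" unfolding measure_def using em e by (intro enn2real_leI) auto
  moreover have "measure lebesgue N = 0" using NY(1) by (rule negligible_imp_measure0)
  moreover have "measure lebesgue (N \<union> Y) \<le> measure lebesgue N + measure lebesgue Y"
    using Y N by (intro measure_Un_le) auto
  ultimately have "measure lebesgue (N \<union> Y) \<le> e" by linarith
  moreover have "N \<union> Y \<in> lmeasurable" using N Y by (rule fmeasurable.Un)
  ultimately show "\<exists>T. S \<subseteq> T \<and> T \<in> lmeasurable \<and> measure lebesgue T \<le> e"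
    using NY(3) by blast
qed

lemma negligible_Hlim_image:
  assumes "negligible S" "S \<subseteq> {0..<1}"
  shows "negligible (Hlim ` S)"
proof (rule negligible_of_covers)
  fix e :: real assume "0 < e"
  then obtain n where n: "jump n" "(1/2) ^ n + 24 / qr n < e" using ex_jump_small by blast
  then obtain m where m: "n = Suc m" by (cases n) (auto simp: jump_def)
  obtain Y where Y: "Y \<in> sets lborel" "H n ` (support n \<inter> {0..<1}) \<subseteq> Y"
    "emeasure lborel Y \<le> ennreal ((1/2) ^ n + 24 / qr n)"
    using jump_image_measure[OF n(1)[unfolded m]] unfolding m by (elim bexE conjE)
  have 1: "Hlim ` S \<subseteq> H n ` S \<union> Hlim ` (support n \<inter> {0..<1})"
  proof
    fix w assume "w \<in> Hlim ` S"
    then obtain s where s: "w = Hlim s" "s \<in> S" by (rule imageE)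
    show "w \<in> H n ` S \<union> Hlim ` (support n \<inter> {0..<1})"
    proof (cases "s \<in> support n")
      case True
      then show ?thesis using s assms(2) by (intro UnI2 image_eqI[of _ _ s]) auto
    next
      case False
      then show ?thesis using s Hlim_off_support[OF False] by (intro UnI1 image_eqI[of _ _ s]) auto
    qed
  qed
  \<comment> \<open>Both maps are bijections that agree off \<open>support n\<close>. A point of the
    support cannot have the same image under the limit as a point off it, so its image is attained
    by \<open>H n\<close> inside the support.\<close>
  have 2: "Hlim ` (support n \<inter> {0..<1}) \<subseteq> H n ` (support n \<inter> {0..<1})"
  proof
    fix w assume "w \<in> Hlim ` (support n \<inter> {0..<1})"
    then obtain s where "s \<in> support n \<inter> {0..<1}" and w: "w = Hlim s" by (rule imageE)
    then have s: "s \<in> support n" "0 \<le> s" "s < 1" "w = Hlim s" by simp_all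
    define z where "z = inv (H n) w"
    have Hz: "H n z = w" by (simp add: z_def)
    have "z \<in> support n"
    proof (rule ccontr)
      assume "z \<notin> support n"
      then have "Hlim z = Hlim s" using Hz s(4) Hlim_off_support[of z n] by simp
      then have "Klim (Hlim z) = Klim (Hlim s)" by (rule arg_cong)
      then have "z = s" by simp
      then show False using s(1) \<open>z \<notin> support n\<close> by simp
    qed
    moreover have "0 \<le> z" "z < 1"
    proof -
      have "Hlim 0 \<le> Hlim s" "Hlim s < Hlim (0 + 1)"
        using s by (simp_all add: strict_mono_less_eq[OF Hlim_mono] strict_mono_less[OF Hlim_mono])
      then have "0 \<le> w" "w < 1" unfolding Hlim_add_1 Hlim_0 s(4) by simp_all
      then have "H n 0 \<le> H n z" "H n z < H n (0 + 1)"
        unfolding Hz tameD(4)[OF tame_H[of n]] tameD(3)[OF tame_H[of n]] by simp_all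
      then show "0 \<le> z" "z < 1"
        unfolding strict_mono_less_eq[OF tame_mono[OF tame_H]] strict_mono_less[OF tame_mono[OF tame_H]]
        by simp_all
    qed
    ultimately show "w \<in> H n ` (support n \<inter> {0..<1})" using Hz by (intro image_eqI[of _ _ z]) simp_all
  qed
  have 3: "emeasure lborel Y \<le> ennreal e"
    using n(2) by (intro order_trans[OF Y(3)] ennreal_leI) simp
  have 4: "Hlim ` S \<subseteq> H n ` S \<union> Y" using 1 2 Y(2) by (meson Un_mono order_refl order_trans)
  have 5: "negligible (H n ` S)" by (rule negligible_image_tame[OF tame_H assms(1)])
  show "\<exists>N Y. negligible N \<and> Y \<in> sets lborel \<and> Hlim ` S \<subseteq> N \<union> Y \<and> emeasure lborel Y \<le> ennreal e"
    by (intro exI conjI, rule 5, rule Y(1), rule 4, rule 3)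
qed

text \<open>The exceptional values of \<open>Klim\<close> lie in \<open>support n\<close> itself,
  whose own measure is small; off it, \<open>Klim\<close> coincides with the tame inverse of
  \<open>H n\<close>.\<close>

lemma negligible_Klim_image:
  assumes "negligible S" "S \<subseteq> {0..<1}"
  shows "negligible (Klim ` S)"
proof (rule negligible_of_covers)
  fix e :: real assume "0 < e"
  then obtain n where n: "jump n" "(1/2) ^ n + 24 / qr n < e" using ex_jump_small by blast
  obtain Y where Y: "Y \<in> sets lborel" "support n \<inter> {0..<1} \<subseteq> Y" "emeasure lborel Y \<le> ennreal ((1/2) ^ n)"
    using support_measure by blast
  have "Klim ` S \<subseteq> inv (H n) ` S \<union> Y"
  proof
    fix w assume "w \<in> Klim ` S"
    then obtain s where s: "s \<in> S" "w = Klim s" by blast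
    have "0 \<le> s" "s < 1" using s assms(2) by auto
    then have "Hlim 0 \<le> Hlim w" "Hlim w < Hlim (0 + 1)"
      unfolding s(2) Hlim_add_1 Hlim_0 Hlim_Klim by simp_all
    then have w: "0 \<le> w" "w < 1" by (simp_all add: strict_mono_less_eq[OF Hlim_mono] strict_mono_less[OF Hlim_mono])
    show "w \<in> inv (H n) ` S \<union> Y"
    proof (cases "w \<in> support n")
      case True then show ?thesis using w Y(2) by (intro UnI2 subsetD[OF Y(2)]) simp
    next
      case False
      then have "H n w = s" using Hlim_off_support[of w n] s(2) by simp
      then have "inv (H n) s = w" using H_inv(2)[of n w] by simp
      then show ?thesis using s(1) by (intro UnI1 image_eqI[of _ _ s]) simp_all
    qed
  qed
  moreover have "emeasure lborel Y \<le> ennreal e"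
  proof -
    have "0 \<le> 24 / qr n" by simp
    then have "(1/2) ^ n \<le> e" using n(2) by linarith
    then show ?thesis by (intro order_trans[OF Y(3)] ennreal_leI)
  qed
  ultimately show "\<exists>N Y. negligible N \<and> Y \<in> sets lborel \<and> Klim ` S \<subseteq> N \<union> Y \<and> emeasure lborel Y \<le> ennreal e"
    using negligible_image_tame[OF tame_inv[OF tame_H] assms(1), of n] Y(1)
    by (intro exI[of _ "inv (H n) ` S"] exI[of _ Y] conjI)
qed

end

section \<open>Unique ergodicity of irrational rotations\<close>

lemma space_circle_lebesgue [simp]: "space circle_lebesgue = {0..<1}"
  by (simp add: circle_lebesgue_def)

lemma sets_circle_lebesgue: "A \<in> sets circle_lebesgue \<longleftrightarrow> A \<subseteq> {0..<1} \<and> A \<in> sets borel"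
  by (simp add: circle_lebesgue_def sets_restrict_space_iff)

lemma emeasure_circle_lebesgue: "A \<subseteq> {0..<1} \<Longrightarrow> emeasure circle_lebesgue A = emeasure lborel A"
  by (simp add: circle_lebesgue_def emeasure_restrict_space)

lemma prob_space_circle_lebesgue: "prob_space circle_lebesgue"
  by (rule prob_spaceI) (simp add: emeasure_circle_lebesgue)

lemma measurable_circle_lebesgue:
  assumes "f \<in> borel_measurable borel" "\<And>x. 0 \<le> x \<Longrightarrow> x < 1 \<Longrightarrow> 0 \<le> f x \<and> f x < 1"
  shows "f \<in> measurable circle_lebesgue circle_lebesgue"
proof -
  have "f \<in> measurable (restrict_space lborel {0..<1}) (restrict_space lborel {0..<1})"
    using assms by (intro measurable_restrict_space3) auto
  then show ?thesis by (simp add: circle_lebesgue_def)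
qed

text \<open>Pushed forward to the real line, both measures have the distribution function of the
  uniform law.\<close>

lemma circle_measure_eqI:
  assumes M: "prob_space M" "sets M = sets circle_lebesgue"
    and eq: "\<And>y. 0 \<le> y \<Longrightarrow> y \<le> 1 \<Longrightarrow> measure M {0..<y} = y"
  shows "M = circle_lebesgue"
proof -
  have cdf: "cdf (distr M borel (\<lambda>x. x)) x = max 0 (min 1 x)"
    if M: "prob_space M" "sets M = sets circle_lebesgue"
      and eq: "\<And>y. 0 \<le> y \<Longrightarrow> y \<le> 1 \<Longrightarrow> measure M {0..<y} = y" for M x
  proof -
    interpret prob_space M by fact
    have sp: "space M = {0..<1}" using sets_eq_imp_space_eq[OF M(2)] by simp
    have id: "(\<lambda>x. x) \<in> measurable M borel"
      using M(2) sp by (auto simp: measurable_def sets_circle_lebesgue)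
    have "cdf (distr M borel (\<lambda>x. x)) x = measure M ({..x} \<inter> {0..<1})"
      unfolding cdf_def by (subst measure_distr[OF id]) (auto simp: sp)
    also have "\<dots> = max 0 (min 1 x)"
    proof -
      consider "x < 0" | "1 \<le> x" | "0 \<le> x" "x < 1" by linarith
      then show ?thesis
      proof cases
        case 1
        then have "{..x} \<inter> {0..<1} = {}" by auto
        then show ?thesis using 1 by simp
      next
        case 2
        then have "{..x} \<inter> {0..<1} = {0..<1}" by auto
        then show ?thesis using 2 eq[of 1] by simp
      next
        case 3
        have "measure M {0..<x} \<le> measure M ({..x} \<inter> {0..<1})"
          using 3 by (intro finite_measure_mono) (auto simp: M(2) sets_circle_lebesgue)
        moreover have "measure M ({..x} \<inter> {0..<1}) \<le> x"
        \<comment> \<open>The distribution function includes the point \<open>x\<close> while the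
          hypothesis excludes it; half-open intervals up to \<open>y > x\<close> close the
          gap.\<close>
        proof (rule dense_ge_bounded[OF 3(2)])
          fix y assume y: "x < y" "y < 1"
          have "measure M ({..x} \<inter> {0..<1}) \<le> measure M {0..<y}"
            using y by (intro finite_measure_mono) (auto simp: M(2) sets_circle_lebesgue)
          then show "measure M ({..x} \<inter> {0..<1}) \<le> y" using eq[of y] y 3 by simp
        qed
        ultimately show ?thesis using eq[of x] 3 by simp
      qed
    qed
    finally show ?thesis .
  qed
  have rd: "real_distribution (distr M borel (\<lambda>x. x))" if "prob_space M" "sets M = sets circle_lebesgue" for M
  proof -
    have sp: "space M = {0..<1}" using sets_eq_imp_space_eq[OF that(2)] by simp
    have id: "(\<lambda>x. x) \<in> measurable M borel"
      using that(2) sp by (auto simp: measurable_def sets_circle_lebesgue)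
    show ?thesis
      unfolding real_distribution_def real_distribution_axioms_def
      using prob_space.prob_space_distr[OF that(1) id] by simp
  qed
  have "distr M borel (\<lambda>x. x) = distr circle_lebesgue borel (\<lambda>x. x)"
  proof (rule cdf_unique)
    show "cdf (distr M borel (\<lambda>x. x)) = cdf (distr circle_lebesgue borel (\<lambda>x. x))"
      using cdf[OF M eq] cdf[OF prob_space_circle_lebesgue refl]
      by (simp add: fun_eq_iff measure_def emeasure_circle_lebesgue)
  qed (use rd M prob_space_circle_lebesgue in auto)
  then have d: "emeasure (distr M borel (\<lambda>x. x)) A = emeasure (distr circle_lebesgue borel (\<lambda>x. x)) A" for A by simp
  show ?thesis
  proof (rule measure_eqI)
    fix A assume A: "A \<in> sets M"
    then have "A \<in> sets borel" "A \<subseteq> {0..<1}" using M(2) by (auto simp: sets_circle_lebesgue)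
    moreover have "space M = {0..<1}" using sets_eq_imp_space_eq[OF M(2)] by simp
    moreover have "(\<lambda>x. x) \<in> measurable M borel" "(\<lambda>x. x) \<in> measurable circle_lebesgue borel"
      using M(2) \<open>space M = _\<close> by (auto simp: measurable_def sets_circle_lebesgue)
    ultimately show "emeasure M A = emeasure circle_lebesgue A"
      using d[of A] by (simp add: emeasure_distr Int_absorb2)
  qed (rule M(2))
qed

lemma borel_measurable_frac_add: "(\<lambda>x::real. frac (x + a)) \<in> borel_measurable borel"
  unfolding frac_def by measurable

lemma measurable_frac_add: "(\<lambda>x. frac (x + a)) \<in> measurable circle_lebesgue circle_lebesgue"
  by (rule measurable_circle_lebesgue[OF borel_measurable_frac_add]) (auto simp: frac_lt_1)

lemma frac_diff_cases:
  fixes x b :: real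
  assumes "0 \<le> x" "x < 1" "0 \<le> b" "b < 1"
  shows "frac (x - b) = (if b \<le> x then x - b else x - b + 1)"
  using assms by (auto simp: frac_unique_iff)

lemma frac_add_frac_uminus:
  "frac (x + y) = frac (x - frac (- y))" for x y :: real
proof -
  have "x + y = (x - frac (- y)) + of_int (- \<lfloor>- y\<rfloor>)" by (simp add: frac_def)
  then show ?thesis by (metis frac_add_of_int_right)
qed

text \<open>The rotation is rewritten as subtraction of \<open>b = frac (- a)\<close>; the bound
  \<open>b + s \<le> 1\<close> says that the preimage does not wrap around.\<close>

lemma rotated_interval:
  fixes a s :: real
  defines "b \<equiv> frac (- a)"
  assumes "0 \<le> s" "b + s \<le> 1"
  shows "(\<lambda>x. frac (x + a)) -` {0..<s} \<inter> {0..<1} = {b..<b + s}"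
proof -
  have b: "0 \<le> b" "b < 1" unfolding b_def by (auto simp: frac_lt_1)
  have "frac (x + a) = (if b \<le> x then x - b else x - b + 1)" if "0 \<le> x" "x < 1" for x
    unfolding frac_add_frac_uminus[of x a] b_def[symmetric] using that b by (rule frac_diff_cases)
  then show ?thesis using assms(2,3) b by (auto simp del: frac_lt_1 split: if_splits)
qed

lemma invariant_rotation_lebesgue: "distr circle_lebesgue circle_lebesgue (\<lambda>x. frac (x + a)) = circle_lebesgue"
proof (rule circle_measure_eqI)
  show "prob_space (distr circle_lebesgue circle_lebesgue (\<lambda>x. frac (x + a)))"
    by (rule prob_space.prob_space_distr[OF prob_space_circle_lebesgue measurable_frac_add])
  fix y :: real assume y: "0 \<le> y" "y \<le> 1"
  define b where "b = frac (- a)"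
  have b: "0 \<le> b" "b < 1" by (auto simp: b_def frac_lt_1)
  have "measure (distr circle_lebesgue circle_lebesgue (\<lambda>x. frac (x + a))) {0..<y}
    = measure circle_lebesgue ((\<lambda>x. frac (x + a)) -` {0..<y} \<inter> {0..<1})"
    using y by (subst measure_distr[OF measurable_frac_add]) (auto simp: sets_circle_lebesgue)
  also have "\<dots> = measure lborel ((\<lambda>x. frac (x + a)) -` {0..<y} \<inter> {0..<1})"
    by (simp add: measure_def emeasure_circle_lebesgue)
  also have "\<dots> = y"
  proof (cases "b + y \<le> 1")
    case True
    then show ?thesis using rotated_interval[of y a] y by (simp add: b_def)
  next
    case False
    have f: "frac (x + a) = (if b \<le> x then x - b else x - b + 1)" if "0 \<le> x" "x < 1" for x
      unfolding frac_add_frac_uminus[of x a] b_def[symmetric] using that b by (rule frac_diff_cases)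
    have "(\<lambda>x. frac (x + a)) -` {0..<y} \<inter> {0..<1} = {0..<b + y - 1} \<union> {b..<1}"
      using f b y False by (auto split: if_splits)
    then have "measure lborel ((\<lambda>x. frac (x + a)) -` {0..<y} \<inter> {0..<1})
      = measure lborel {0..<b + y - 1} + measure lborel {b..<1}"
      using b y False by (simp only:) (intro measure_Union; simp)
    then show ?thesis using False b by simp
  qed
  finally show "measure (distr circle_lebesgue circle_lebesgue (\<lambda>x. frac (x + a))) {0..<y} = y" .
qed simp

locale rotation_invariant = prob_space M for M :: "real measure" +
  fixes \<alpha> :: real
  assumes sets_M: "sets M = sets circle_lebesgue"
    and irrational: "\<alpha> \<notin> \<rat>"
    and invariant: "distr M M (\<lambda>x. frac (x + \<alpha>)) = M"
begin

lemma space_M: "space M = {0..<1}"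
  using sets_eq_imp_space_eq[OF sets_M] by simp

lemma interval_in_sets: "0 \<le> x \<Longrightarrow> y \<le> 1 \<Longrightarrow> {x..<y} \<in> sets M"
  unfolding sets_M sets_circle_lebesgue by auto

lemma measurable_rot: "(\<lambda>x. frac (x + a)) \<in> measurable M M"
  using measurable_frac_add[of a] measurable_cong_sets[OF sets_M sets_M] by blast

lemma invariant_iterate: "distr M M (\<lambda>x. frac (x + real j * \<alpha>)) = M"
proof (induction j)
  case 0
  have "distr M M (\<lambda>x. frac (x + real 0 * \<alpha>)) = distr M M (\<lambda>x. x)"
    by (intro distr_cong) (auto simp: space_M)
  then show ?case by simp
next
  case (Suc j)
  have "(\<lambda>x. frac (x + real (Suc j) * \<alpha>)) = (\<lambda>x. frac (x + real j * \<alpha>)) \<circ> (\<lambda>x. frac (x + \<alpha>))"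
  proof
    fix x
    have "frac (x + \<alpha>) + real j * \<alpha> = (x + real (Suc j) * \<alpha>) + of_int (- \<lfloor>x + \<alpha>\<rfloor>)"
      by (simp add: frac_def algebra_simps)
    then show "frac (x + real (Suc j) * \<alpha>) = ((\<lambda>x. frac (x + real j * \<alpha>)) \<circ> (\<lambda>x. frac (x + \<alpha>))) x"
      by (metis comp_apply frac_add_of_int_right)
  qed
  then have "distr M M (\<lambda>x. frac (x + real (Suc j) * \<alpha>))
      = distr (distr M M (\<lambda>x. frac (x + \<alpha>))) M (\<lambda>x. frac (x + real j * \<alpha>))"
    by (simp add: distr_distr measurable_rot)
  then show ?case by (simp add: invariant Suc)
qed

text \<open>Kronecker density supplies a backward orbit point of 0 near \<open>a\<close>, and
  invariance gives intervals of equal length starting at such points equal measure, as long as they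
  do not wrap around.\<close>

lemma orbit_near:
  assumes "0 \<le> a" "a \<le> 1" "0 < e"
  obtains b where "0 \<le> b" "\<bar>b - a\<bar> < e" "\<And>s. 0 \<le> s \<Longrightarrow> b + s \<le> 1 \<Longrightarrow> measure M {b..<b + s} = measure M {0..<s}"
proof -
  have "- \<alpha> \<notin> \<rat>" using irrational by simp
  then obtain j :: nat where j: "\<bar>frac (real j * - \<alpha>) - a\<bar> < e"
    using Kronecker_approx_1_explicit[OF _ assms] by blast
  define b where "b = frac (- (real j * \<alpha>))"
  show thesis
  proof (rule that)
    show "0 \<le> b" "\<bar>b - a\<bar> < e" using j by (simp_all add: b_def)
    fix s assume s: "0 \<le> s" "b + s \<le> 1"
    have "measure M {0..<s} = measure (distr M M (\<lambda>x. frac (x + real j * \<alpha>))) {0..<s}"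
      by (simp add: invariant_iterate)
    also have "\<dots> = measure M ((\<lambda>x. frac (x + real j * \<alpha>)) -` {0..<s} \<inter> {0..<1})"
      using s \<open>0 \<le> b\<close> by (subst measure_distr[OF measurable_rot interval_in_sets]) (auto simp: space_M)
    also have "\<dots> = measure M {b..<b + s}"
      using rotated_interval[of s "real j * \<alpha>"] s by (simp add: b_def)
    finally show "measure M {b..<b + s} = measure M {0..<s}" ..
  qed
qed

text \<open>A packing argument: \<open>N\<close> disjoint copies of the interval, all of the same
  measure, fit into the circle.\<close>

lemma short_initial_interval:
  assumes N: "0 < N" and s: "0 \<le> s" "s < 1 / real N"
  shows "measure M {0..<s} \<le> 1 / real N"
proof -
  \<comment> \<open>Half the slack of one slot. A start within \<open>e\<close> of
    \<open>i / N + e\<close> lies to the right of \<open>i / N\<close>, and its copy ends before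
    \<open>(i + 1) / N\<close>.\<close>
  define e where "e = (1 / real N - s) / 2"
  have e: "0 < e" using s by (simp add: e_def)
  have half: "2 * ((z - s) / 2) + s = z" for z :: real by (simp add: field_simps)
  have "\<exists>b. 0 \<le> b \<and> \<bar>b - (real i / real N + e)\<bar> < e \<and> measure M {b..<b + s} = measure M {0..<s}" if "i < N" for i
  proof -
    have "real i + 1 \<le> real N" using that by linarith
    then have i1: "real i / real N + 1 / real N \<le> 1" using N by (simp add: field_simps)
    have "e \<le> 1 / real N" using s by (simp add: e_def)
    then have "real i / real N + e \<le> 1" using i1 by linarith
    then obtain b where b: "0 \<le> b" "\<bar>b - (real i / real N + e)\<bar> < e"
      "\<And>s. 0 \<le> s \<Longrightarrow> b + s \<le> 1 \<Longrightarrow> measure M {b..<b + s} = measure M {0..<s}"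
      using orbit_near[of "real i / real N + e" e] e by auto
    have "2 * e + s = 1 / real N" unfolding e_def by (rule half)
    then have "b + s \<le> 1" using b(2) i1 unfolding abs_less_iff by linarith
    then show ?thesis using b s by blast
  qed
  then obtain b where b: "\<And>i. i < N \<Longrightarrow> 0 \<le> b i \<and> \<bar>b i - (real i / real N + e)\<bar> < e \<and> measure M {b i..<b i + s} = measure M {0..<s}"
    by metis
  have loc: "real i / real N < b i" "b i + s < real (Suc i) / real N" if "i < N" for i
  proof -
    have "real (Suc i) / real N = real i / real N + 1 / real N" by (simp add: add_divide_distrib)
    moreover have "2 * e + s = 1 / real N" unfolding e_def by (rule half)
    ultimately show "real i / real N < b i" "b i + s < real (Suc i) / real N"
      using b[OF that] by (auto simp: abs_less_iff)
  qed
  have in_sets: "{b i..<b i + s} \<in> sets M" if "i < N" for i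
  proof -
    have "real (Suc i) / real N \<le> 1" using that by simp
    then have "b i + s \<le> 1" using loc(2)[OF that] by linarith
    then show ?thesis using b[OF that] by (intro interval_in_sets) simp_all
  qed
  have "(\<Sum>i<N. measure M {b i..<b i + s}) = measure M (\<Union>i<N. {b i..<b i + s})"
  proof (rule finite_measure_finite_Union[symmetric])
    show "(\<lambda>i. {b i..<b i + s}) ` {..<N} \<subseteq> sets M"
      using in_sets by blast
    show "disjoint_family_on (\<lambda>i. {b i..<b i + s}) {..<N}"
      unfolding disjoint_family_on_def
    proof (intro ballI impI)
      fix i k assume ik: "i \<in> {..<N}" "k \<in> {..<N}" "i \<noteq> k"
      have "{b i..<b i + s} \<inter> {b k..<b k + s} = {}" if "i < k" "k < N" for i k
      proof -
        have "real (Suc i) / real N \<le> real k / real N" using that by (intro divide_right_mono) auto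
        then show ?thesis using loc[of i] loc[of k] that by auto
      qed
      then show "{b i..<b i + s} \<inter> {b k..<b k + s} = {}"
        using ik by (metis Int_commute lessThan_iff linorder_neqE_nat)
    qed
  qed simp
  also have "\<dots> \<le> 1" by (rule prob_le_1)
  finally have "real N * measure M {0..<s} \<le> 1" using b by simp
  then show ?thesis using N by (simp add: field_simps)
qed

text \<open>The interval is extended slightly to the left until it starts at a point from
  \<open>orbit_near\<close>. The choice of \<open>e\<close> keeps that point nonnegative and the
  length below \<open>1 / N\<close>.\<close>

lemma short_interval:
  assumes N: "0 < N" and xy: "0 \<le> x" "x \<le> y" "y \<le> 1" "y - x < 1 / real N"
  shows "measure M {x..<y} \<le> 1 / real N"
proof (cases "x = 0")
  case True
  then show ?thesis using short_initial_interval[OF N, of y] xy by simp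
next
  case False
  define e where "e = min x (1 / real N - (y - x)) / 2"
  have e: "0 < e" "2 * e \<le> x" "2 * e \<le> 1 / real N - (y - x)" using False xy by (auto simp: e_def)
  have "0 \<le> x - e" "x - e \<le> 1" using e xy by auto
  then obtain b where b: "0 \<le> b" "\<bar>b - (x - e)\<bar> < e"
    "\<And>s. 0 \<le> s \<Longrightarrow> b + s \<le> 1 \<Longrightarrow> measure M {b..<b + s} = measure M {0..<s}"
    using orbit_near[of "x - e" e] e by auto
  have "b < x" "x - 2 * e < b" using b(2) by (auto simp: abs_less_iff)
  then have s: "0 \<le> y - b" "y - b < 1 / real N" using xy e by auto
  have "measure M {x..<y} \<le> measure M {b..<b + (y - b)}"
    using \<open>b < x\<close> b(1) xy by (intro finite_measure_mono interval_in_sets) auto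
  also have "\<dots> = measure M {0..<y - b}" using s xy by (intro b(3)) auto
  also have "\<dots> \<le> 1 / real N" by (rule short_initial_interval[OF N s])
  finally show ?thesis .
qed

text \<open>The interval is cut into \<open>m\<close> pieces shorter than \<open>1 / N\<close>.
  Since \<open>m\<close> exceeds \<open>N * (y - x)\<close> by at most 1, the total error is
  \<open>1 / N\<close>.\<close>

lemma interval_le:
  assumes xy: "0 \<le> x" "x \<le> y" "y \<le> 1"
  shows "measure M {x..<y} \<le> y - x"
proof (rule field_le_epsilon)
  fix e :: real assume "0 < e"
  then obtain N :: nat where N: "0 < N" "1 / real N < e"
    by (metis gr0I inverse_eq_divide real_arch_inverse)
  define m where "m = Suc (nat \<lfloor>real N * (y - x)\<rfloor>)"
  define d where "d = (y - x) / real m"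
  have "0 \<le> real N * (y - x)" using xy by simp
  then have m: "real N * (y - x) < real m" "real m \<le> real N * (y - x) + 1"
    unfolding m_def by linarith+
  have m0: "0 < real m" by (simp add: m_def)
  have d: "0 \<le> d" "d < 1 / real N" using xy m m0 N by (auto simp: d_def field_simps)
  have md: "real m * d = y - x" using m0 by (simp add: d_def)
  have "measure M {x..<x + real k * d} \<le> real k / real N" if "k \<le> m" for k
    using that
  proof (induction k)
    case (Suc k)
    have "real (Suc k) * d \<le> real m * d" using Suc(2) d(1) by (intro mult_right_mono) auto
    then have up: "x + real (Suc k) * d \<le> 1" using md xy by simp
    have "x + real k * d \<le> x + real (Suc k) * d" using d(1) by (simp add: algebra_simps)
    then have up': "x + real k * d \<le> 1" using up by linarith
    have k0: "0 \<le> x + real k * d" using xy d by simp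
    have "{x..<x + real (Suc k) * d} \<subseteq> {x..<x + real k * d} \<union> {x + real k * d..<x + real (Suc k) * d}" by auto
    then have "measure M {x..<x + real (Suc k) * d} \<le> measure M ({x..<x + real k * d} \<union> {x + real k * d..<x + real (Suc k) * d})"
      using up up' k0 xy by (intro finite_measure_mono sets.Un interval_in_sets) auto
    also have "\<dots> \<le> measure M {x..<x + real k * d} + measure M {x + real k * d..<x + real (Suc k) * d}"
      using up up' k0 xy by (intro measure_Un_le interval_in_sets) auto
    also have "\<dots> \<le> real k / real N + 1 / real N"
      using Suc k0 up d by (intro add_mono short_interval[OF N(1)]) (auto simp: algebra_simps)
    finally show ?case by (simp add: add_divide_distrib)
  qed simp
  from this[of m] have "measure M {x..<y} \<le> real m / real N" using md by simp
  also have "\<dots> \<le> (real N * (y - x) + 1) / real N" using m(2) by (intro divide_right_mono) auto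
  also have "\<dots> = (y - x) + 1 / real N" using N by (simp add: field_simps)
  finally show "measure M {x..<y} \<le> y - x + e" using N(2) by linarith
qed

text \<open>Upper bounds suffice: on two complementary intervals the bounds add up to 1, the total
  mass, so both are attained.\<close>

theorem eq_lebesgue: "M = circle_lebesgue"
proof (rule circle_measure_eqI)
  fix y :: real assume y: "0 \<le> y" "y \<le> 1"
  have "{0..<y} \<union> {y..<1} = space M" using y by (auto simp: space_M)
  moreover have "measure M ({0..<y} \<union> {y..<1}) = measure M {0..<y} + measure M {y..<1}"
    using y by (intro finite_measure_Union interval_in_sets) auto
  ultimately have "measure M {0..<y} + measure M {y..<1} = 1" by (simp add: prob_space)
  then show "measure M {0..<y} = y" using interval_le[of 0 y] interval_le[of y 1] y by simp
qed (use prob_space_axioms sets_M in auto)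

end

section \<open>Distances and conjugacies of circle maps\<close>

lemma circle_dist_add_of_int: "circle_dist (x + of_int k) y = circle_dist x y"
proof -
  have "x + of_int k - y = (x - y) + of_int k" by simp
  then show ?thesis unfolding circle_dist_def by (metis frac_add_of_int_right)
qed

lemma circle_dist_nonneg: "0 \<le> circle_dist x y"
  by (simp add: circle_dist_def less_imp_le[OF frac_lt_1])

lemma circle_dist_le_1: "circle_dist x y \<le> 1"
  unfolding circle_dist_def using frac_lt_1[of "x - y"] by linarith

lemma circle_dist_le: "circle_dist x y \<le> \<bar>x - y\<bar>"
proof (cases "0 \<le> x - y")
  case True
  then have "frac (x - y) \<le> \<bar>x - y\<bar>" by (simp add: frac_def)
  then show ?thesis unfolding circle_dist_def by linarith
next
  case False
  then have "\<lfloor>x - y\<rfloor> \<le> - 1" by linarith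
  then have "1 - frac (x - y) \<le> \<bar>x - y\<bar>" using False unfolding frac_def by linarith
  then show ?thesis unfolding circle_dist_def by linarith
qed

lemma circle_dist_attained: "\<exists>k::int. circle_dist x y = \<bar>x - y - of_int k\<bar>"
proof (cases "frac (x - y) \<le> 1 - frac (x - y)")
  case True
  then have "circle_dist x y = \<bar>x - y - of_int \<lfloor>x - y\<rfloor>\<bar>" by (simp add: circle_dist_def frac_def)
  then show ?thesis ..
next
  case False
  then have "circle_dist x y = 1 - frac (x - y)" by (simp add: circle_dist_def)
  also have "\<dots> = \<bar>x - y - of_int (\<lfloor>x - y\<rfloor> + 1)\<bar>"
    using frac_lt_1[of "x - y"] unfolding frac_def by simp
  finally have "circle_dist x y = \<bar>x - y - of_int (\<lfloor>x - y\<rfloor> + 1)\<bar>" .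
  then show ?thesis ..
qed

lemma circle_dist_triangle: "circle_dist x z \<le> \<bar>x - y\<bar> + circle_dist y z"
proof -
  obtain k :: int where k: "circle_dist y z = \<bar>y - z - of_int k\<bar>" using circle_dist_attained by blast
  have "circle_dist x z = circle_dist (x + of_int (- k)) z" by (rule circle_dist_add_of_int[symmetric])
  also have "\<dots> \<le> \<bar>x + of_int (- k) - z\<bar>" by (rule circle_dist_le)
  also have "\<dots> \<le> \<bar>x - y\<bar> + \<bar>y - z - of_int k\<bar>" by simp
  finally show ?thesis using k by simp
qed

lemma circle_dist_eq_0D: "circle_dist x y = 0 \<Longrightarrow> x - y \<in> \<int>"
proof -
  assume "circle_dist x y = 0"
  moreover obtain k :: int where "circle_dist x y = \<bar>x - y - of_int k\<bar>" using circle_dist_attained by blast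
  ultimately have "x - y = of_int k" by simp
  then show ?thesis by simp
qed

lemma circle_dist_limit_eq_0:
  assumes "(\<lambda>n. circle_dist (x n) z) \<longlonglongrightarrow> 0" "x \<longlonglongrightarrow> y"
  shows "y - z \<in> \<int>"
proof (rule circle_dist_eq_0D)
  have "(\<lambda>n. \<bar>y - x n\<bar> + circle_dist (x n) z) \<longlonglongrightarrow> \<bar>y - y\<bar> + 0"
    by (intro tendsto_intros assms)
  then have "circle_dist y z \<le> \<bar>y - y\<bar> + 0"
    by (rule LIMSEQ_le_const) (use circle_dist_triangle in blast)
  then show "circle_dist y z = 0" using circle_dist_nonneg[of y z] by simp
qed

lemma Ck_dist_0: "Ck_dist 0 F G = (SUP x. circle_dist (F x) (G x))"
  by (simp add: Ck_dist_def)

lemma bdd_above_circle_dist: "bdd_above (range (\<lambda>x. circle_dist (F x) (G x)))"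
  by (rule bdd_aboveI2[where M = 1]) (rule circle_dist_le_1)

lemma circle_dist_le_Ck_dist: "circle_dist (F x) (G x) \<le> Ck_dist k F G"
proof -
  have "circle_dist (F x) (G x) \<le> (SUP x. circle_dist (F x) (G x))"
    by (rule cSUP_upper[OF UNIV_I bdd_above_circle_dist])
  also have "\<dots> \<le> Ck_dist k F G" unfolding Ck_dist_def by (rule Max_ge) (auto simp: image_iff intro!: bexI[of _ 0])
  finally show ?thesis .
qed

lemma Ck_dist_nonneg: "0 \<le> Ck_dist k F G"
  using circle_dist_nonneg circle_dist_le_Ck_dist order_trans by blast

lemma Ck_dist_0_le: "(\<And>x. \<bar>F x - G x\<bar> \<le> e) \<Longrightarrow> Ck_dist 0 F G \<le> e"
  unfolding Ck_dist_0 by (rule cSUP_least) (auto intro: order_trans[OF circle_dist_le])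

text \<open>The common bound \<open>B\<close> makes the supremum in \<open>Ck_dist\<close> a genuine
  one: a real \<open>SUP\<close> is an upper bound only for sets that are bounded above.\<close>

lemma deriv_le_Ck_dist:
  assumes F: "\<And>x. (F has_real_derivative F' x) (at x)" "\<And>x. \<bar>F' x\<bar> \<le> B"
    and G: "\<And>x. (G has_real_derivative G' x) (at x)" "\<And>x. \<bar>G' x\<bar> \<le> B"
  shows "\<bar>F' x - G' x\<bar> \<le> Ck_dist 1 F G"
proof -
  have d: "deriv (\<lambda>y. F y - G y) x = F' x - G' x" for x
    by (rule DERIV_imp_deriv) (intro DERIV_diff F G)
  have "\<bar>F' x - G' x\<bar> \<le> (SUP x. \<bar>F' x - G' x\<bar>)"
  proof (rule cSUP_upper[OF UNIV_I])
    show "bdd_above (range (\<lambda>x. \<bar>F' x - G' x\<bar>))"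
    proof (rule bdd_aboveI2)
      show "\<bar>F' x - G' x\<bar> \<le> 2 * B" for x using F(2)[of x] G(2)[of x] by linarith
    qed
  qed
  also have "\<dots> \<le> Ck_dist 1 F G"
    unfolding Ck_dist_def
  proof (rule Max_ge)
    show "(SUP x. \<bar>F' x - G' x\<bar>) \<in> (\<lambda>i. SUP x. if i = 0 then circle_dist (F x) (G x)
        else \<bar>(deriv ^^ i) (\<lambda>y. F y - G y) x\<bar>) ` {..1}"
      by (rule image_eqI[of _ _ 1]) (simp_all add: d)
  qed simp
  finally show ?thesis .
qed

lemma Diff_converges_Ck:
  assumes "Diff_converges F G"
  shows "(\<lambda>n. Ck_dist k (F n) G) \<longlonglongrightarrow> 0"
proof (rule tendsto_sandwich[OF _ _ tendsto_const])
  show "(\<lambda>n. diff_dist k (F n) G) \<longlonglongrightarrow> 0" using assms by (simp add: Diff_converges_def)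
qed (simp_all add: diff_dist_def Ck_dist_nonneg)

lemma Diff_converges_pointwise:
  assumes "Diff_converges F G"
  shows "(\<lambda>n. circle_dist (F n x) (G x)) \<longlonglongrightarrow> 0"
  by (rule tendsto_sandwich[OF _ _ tendsto_const Diff_converges_Ck[OF assms, of 0]])
    (simp_all add: circle_dist_nonneg circle_dist_le_Ck_dist)

lemma circle_homeo_add_of_int: "circle_homeo F \<Longrightarrow> F (x + of_int k) = F x + of_int k"
  by (rule lift_add_of_int) (simp add: circle_homeo_def)

lemma frac_circle_homeo:
  assumes "circle_homeo H" "H 0 = 0"
  shows "frac (H y) = H (frac y)"
proof -
  have H: "strict_mono H" using assms by (simp add: circle_homeo_def)
  have H1: "H 1 = 1" using circle_homeo_add_of_int[OF assms(1), of 0 1] assms(2) by simp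
  have "H y = H (frac y) + of_int \<lfloor>y\<rfloor>"
    using circle_homeo_add_of_int[OF assms(1), of "frac y" "\<lfloor>y\<rfloor>"] by (simp add: frac_def)
  moreover have "0 \<le> H (frac y)" "H (frac y) < 1"
    using strict_mono_less_eq[OF H, of 0 "frac y"] strict_mono_less[OF H, of "frac y" 1] assms(2) H1
    by (simp_all add: frac_lt_1)
  ultimately show ?thesis by (simp add: frac_unique_iff)
qed

section \<open>Invariant measures under a conjugacy to a rotation\<close>

locale circle_conjugacy =
  fixes H K T :: "real \<Rightarrow> real" and \<alpha> :: real
  assumes H_homeo: "circle_homeo H" and H_0: "H 0 = 0"
    and K_cont: "continuous_on UNIV K"
    and HK: "\<And>x. H (K x) = x" and KH: "\<And>x. K (H x) = x"
    and conj: "\<And>x. T x - H (K x + \<alpha>) \<in> \<int>"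
    and irr: "\<alpha> \<notin> \<rat>"
begin

lemma H_range: "0 \<le> H x \<and> H x < 1 \<longleftrightarrow> 0 \<le> x \<and> x < 1"
proof -
  have H: "strict_mono H" using H_homeo by (simp add: circle_homeo_def)
  have H1: "H 1 = 1" using circle_homeo_add_of_int[OF H_homeo, of 0 1] H_0 by simp
  show ?thesis using strict_mono_less_eq[OF H, of 0 x] strict_mono_less[OF H, of x 1] H_0 H1 by simp
qed

lemma K_range: "0 \<le> K x \<and> K x < 1 \<longleftrightarrow> 0 \<le> x \<and> x < 1"
  using H_range[of "K x"] by (simp add: HK)

lemma H_meas: "H \<in> measurable circle_lebesgue circle_lebesgue"
  using H_homeo H_range
  by (intro measurable_circle_lebesgue borel_measurable_continuous_onI) (auto simp: circle_homeo_def)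

lemma K_meas: "K \<in> measurable circle_lebesgue circle_lebesgue"
  using K_cont K_range by (intro measurable_circle_lebesgue borel_measurable_continuous_onI) auto

abbreviation "R \<equiv> (\<lambda>x. frac (x + \<alpha>))"

lemma frac_T: "frac (T x) = H (R (K x))"
proof -
  obtain k :: int where "T x - H (K x + \<alpha>) = of_int k" using conj[of x] by (auto elim: Ints_cases)
  then have "T x = H (K x + \<alpha>) + of_int k" by simp
  then have "frac (T x) = frac (H (K x + \<alpha>))" by (simp only: frac_add_of_int_right)
  then show ?thesis by (simp add: frac_circle_homeo[OF H_homeo H_0])
qed

definition \<mu> :: "real measure" where "\<mu> = distr circle_lebesgue circle_lebesgue H"

lemma invariant_mu: "invariant_prob T \<mu>"
  unfolding invariant_prob_def
proof (intro conjI)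
  show "prob_space \<mu>" unfolding \<mu>_def
    by (rule prob_space.prob_space_distr[OF prob_space_circle_lebesgue H_meas])
  show s: "sets \<mu> = sets circle_lebesgue" by (simp add: \<mu>_def)
  note R = measurable_frac_add[of \<alpha>]
  have "distr \<mu> \<mu> (\<lambda>x. frac (T x)) = distr \<mu> circle_lebesgue (H \<circ> (R \<circ> K))"
    by (rule distr_cong) (simp_all add: s frac_T)
  also have "\<dots> = distr circle_lebesgue circle_lebesgue ((H \<circ> (R \<circ> K)) \<circ> H)"
    unfolding \<mu>_def by (intro distr_distr measurable_comp[OF _ H_meas] measurable_comp[OF K_meas R] H_meas)
  also have "(H \<circ> (R \<circ> K)) \<circ> H = H \<circ> R" by (simp add: fun_eq_iff KH)
  also have "distr circle_lebesgue circle_lebesgue (H \<circ> R) = distr (distr circle_lebesgue circle_lebesgue R) circle_lebesgue H"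
    by (rule distr_distr[symmetric, OF H_meas R])
  also have "\<dots> = \<mu>" by (simp add: invariant_rotation_lebesgue \<mu>_def)
  finally show "distr \<mu> \<mu> (\<lambda>x. frac (T x)) = \<mu>" .
qed

text \<open>Pushing \<open>M\<close> forward by \<open>K\<close> yields a measure invariant under
  the irrational rotation, hence Lebesgue measure; pushing back by \<open>H\<close> recovers
  \<open>M\<close>.\<close>

lemma invariant_unique: assumes "invariant_prob T M" shows "M = \<mu>"
proof -
  have M: "prob_space M" "sets M = sets circle_lebesgue" "distr M M (\<lambda>x. frac (T x)) = M"
    using assms by (auto simp: invariant_prob_def)
  have meas: "f \<in> measurable M circle_lebesgue" if "f \<in> measurable circle_lebesgue circle_lebesgue" for f
    using that measurable_cong_sets[OF M(2) refl] by blast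
  note R = measurable_frac_add[of \<alpha>]
  have HRK: "H \<circ> (R \<circ> K) \<in> measurable circle_lebesgue circle_lebesgue"
    by (intro measurable_comp[OF _ H_meas] measurable_comp[OF K_meas R])
  have M': "distr M circle_lebesgue (H \<circ> (R \<circ> K)) = M"
    using M(3) by (subst M(3)[symmetric], intro distr_cong) (simp_all add: M(2) frac_T)
  define \<nu> where "\<nu> = distr M circle_lebesgue K"
  have "distr \<nu> \<nu> R = distr \<nu> circle_lebesgue R" by (rule distr_cong) (simp_all add: \<nu>_def)
  also have "\<dots> = distr M circle_lebesgue (R \<circ> K)" unfolding \<nu>_def by (rule distr_distr[OF R meas[OF K_meas]])
  also have "R \<circ> K = K \<circ> (H \<circ> (R \<circ> K))" by (simp add: fun_eq_iff KH)
  also have "distr M circle_lebesgue (K \<circ> (H \<circ> (R \<circ> K))) = distr (distr M circle_lebesgue (H \<circ> (R \<circ> K))) circle_lebesgue K"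
    by (rule distr_distr[symmetric, OF K_meas meas[OF HRK]])
  also have "\<dots> = \<nu>" by (simp only: M' \<nu>_def)
  finally have inv: "distr \<nu> \<nu> R = \<nu>" .
  have "prob_space \<nu>" unfolding \<nu>_def by (rule prob_space.prob_space_distr[OF M(1) meas[OF K_meas]])
  then interpret rotation_invariant \<nu> \<alpha>
    using inv irr by (intro rotation_invariant.intro rotation_invariant_axioms.intro) (auto simp: \<nu>_def)
  have "\<mu> = distr \<nu> circle_lebesgue H" by (simp add: \<mu>_def flip: eq_lebesgue)
  also have "\<dots> = distr M circle_lebesgue (H \<circ> K)"
    unfolding \<nu>_def by (rule distr_distr[OF H_meas meas[OF K_meas]])
  also have "H \<circ> K = (\<lambda>x. x)" by (simp add: fun_eq_iff HK)
  also have "distr M circle_lebesgue (\<lambda>x. x) = M" by (rule distr_id2) (simp add: M(2))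
  finally show ?thesis ..
qed

lemma invariant_measure_eq: "invariant_measure T = \<mu>"
  unfolding invariant_measure_def using invariant_mu invariant_unique by (rule the_equality)

lemma null_sets_circle_lebesgue_iff:
  "A \<in> null_sets circle_lebesgue \<longleftrightarrow> A \<in> sets circle_lebesgue \<and> negligible A"
proof (cases "A \<in> sets circle_lebesgue")
  case True
  then have A: "A \<subseteq> {0..<1}" "A \<in> sets lborel" by (auto simp: sets_circle_lebesgue)
  then have "emeasure circle_lebesgue A = emeasure lebesgue A"
    by (simp add: emeasure_circle_lebesgue emeasure_completion)
  then show ?thesis using True A negligible_iff_emeasure0[of A] by (simp add: null_sets_def)
qed (auto simp: null_sets_def)

lemma absolutely_continuous:
  assumes H_null: "\<And>S. negligible S \<Longrightarrow> S \<subseteq> {0..<1} \<Longrightarrow> negligible (H ` S)"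
    and K_null: "\<And>S. negligible S \<Longrightarrow> S \<subseteq> {0..<1} \<Longrightarrow> negligible (K ` S)"
  shows "absolutely_continuous_conjugacy \<alpha> T H"
  unfolding absolutely_continuous_conjugacy_def
proof (intro conjI allI)
  show "circle_homeo H" by (rule H_homeo)
  have "inv H = K" by (rule inv_unique_comp) (auto simp: fun_eq_iff HK KH)
  then show "T x - (H \<circ> rotation \<alpha> \<circ> inv H) x \<in> \<int>" for x
    using conj[of x] by (simp add: rotation_def)
  show "\<exists>!M. invariant_prob T M" using invariant_mu invariant_unique by blast
  show "null_sets (invariant_measure T) = null_sets circle_lebesgue"
    unfolding invariant_measure_eq
  proof (rule set_eqI)
    fix A
    show "A \<in> null_sets \<mu> \<longleftrightarrow> A \<in> null_sets circle_lebesgue"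
    proof (cases "A \<in> sets circle_lebesgue")
      case True
      then have A: "A \<subseteq> {0..<1}" by (simp add: sets_circle_lebesgue)
      define B where "B = H -` A \<inter> {0..<1}"
      have B: "B \<in> sets circle_lebesgue" using measurable_sets[OF H_meas True] by (simp add: B_def)
      have KA: "B = K ` A"
      proof
        show "B \<subseteq> K ` A"
        proof
          fix x assume "x \<in> B"
          then show "x \<in> K ` A" by (intro image_eqI[of _ _ "H x"]) (simp_all add: B_def KH)
        qed
        show "K ` A \<subseteq> B" using A K_range by (auto simp: B_def HK subset_iff)
      qed
      have HB: "A = H ` B" unfolding KA by (simp add: image_image HK)
      have "A \<in> null_sets \<mu> \<longleftrightarrow> B \<in> null_sets circle_lebesgue"
        using True B by (simp add: null_sets_def \<mu>_def emeasure_distr[OF H_meas] B_def)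
      also have "\<dots> \<longleftrightarrow> negligible B" using B by (simp add: null_sets_circle_lebesgue_iff)
      also have "\<dots> \<longleftrightarrow> negligible A"
      proof
        assume "negligible B"
        then have "negligible (H ` B)" by (rule H_null) (simp add: B_def)
        then show "negligible A" by (subst HB)
      next
        assume "negligible A"
        then have "negligible (K ` A)" using A by (rule K_null)
        then show "negligible B" by (subst KA)
      qed
      also have "\<dots> \<longleftrightarrow> A \<in> null_sets circle_lebesgue" using True by (simp add: null_sets_circle_lebesgue_iff)
      finally show ?thesis .
    qed (auto simp: null_sets_def \<mu>_def)
  qed
qed

end

section \<open>Jumps of the denominators\<close>

text \<open>The slope of \<open>T\<close> is positive because the chain rule for
  \<open>inv T\<close> after \<open>T\<close> excludes a zero. It is continuous and periodic, so it
  attains its extrema on one period.\<close>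

lemma circle_diffeo_deriv_bounds:
  assumes "circle_diffeo T"
  shows "\<exists>c B. 0 < c \<and> (\<forall>x. c \<le> deriv T x \<and> deriv T x \<le> B \<and> (T has_real_derivative deriv T x) (at x))"
proof -
  have hom: "circle_homeo T" and sm: "smooth T" "smooth (inv T)"
    using assms by (auto simp: circle_diffeo_def)
  have mono: "strict_mono T" using hom by (simp add: circle_homeo_def)
  have D: "(T has_real_derivative deriv T x) (at x)" for x
    using smooth_deriv[OF sm(1), of 0] by simp
  have DI: "(inv T has_real_derivative deriv (inv T) x) (at x)" for x
    using smooth_deriv[OF sm(2), of 0] by simp
  have "((deriv T) has_real_derivative deriv (deriv T) x) (at x)" for x
    using smooth_deriv[OF sm(1), of 1] by simp
  then have cont: "continuous_on {0..1} (deriv T)"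
    by (rule DERIV_continuous_on[OF has_field_derivative_at_within])
  have pos: "0 < deriv T x" for x
  proof -
    have "0 \<le> deriv T x"
      using mono_on_imp_deriv_nonneg[OF _ D, of UNIV x] strict_mono_mono[OF mono] by simp
    moreover have "deriv T x \<noteq> 0"
    proof
      assume "deriv T x = 0"
      then have "((\<lambda>y. inv T (T y)) has_real_derivative 0) (at x)"
        using DERIV_chain2[OF DI[of "T x"] D[of x]] by simp
      moreover have "(\<lambda>y. inv T (T y)) = (\<lambda>y. y)"
        using strict_mono_imp_inj_on[OF mono] by (simp add: fun_eq_iff)
      ultimately have "((\<lambda>y. y) has_real_derivative 0) (at x)" by simp
      then show False using DERIV_unique[OF DERIV_ident, of 0 x] by simp
    qed
    ultimately show ?thesis by simp
  qed
  have per: "deriv T (x + of_int k) = deriv T x" for x k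
  proof -
    have "((\<lambda>y. T (y + of_int k)) has_real_derivative deriv T (x + of_int k)) (at x)"
      using D[of "x + of_int k"] by (simp add: DERIV_shift)
    moreover have "((\<lambda>y. T y + of_int k) has_real_derivative deriv T x + 0) (at x)"
      by (intro DERIV_add D DERIV_const)
    ultimately have "deriv T (x + of_int k) = deriv T x + 0"
      unfolding circle_homeo_add_of_int[OF hom] by (rule DERIV_unique)
    then show ?thesis by simp
  qed
  have red: "deriv T x = deriv T (frac x)" "frac x \<in> {0..1}" for x
    using per[of "frac x" "\<lfloor>x\<rfloor>"] frac_lt_1[of x] by (auto simp: frac_def)
  obtain u where u: "u \<in> {0..1}" "\<And>y. y \<in> {0..1} \<Longrightarrow> deriv T u \<le> deriv T y"
    using continuous_attains_inf[OF _ _ cont] by auto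
  obtain v where v: "v \<in> {0..1}" "\<And>y. y \<in> {0..1} \<Longrightarrow> deriv T y \<le> deriv T v"
    using continuous_attains_sup[OF _ _ cont] by auto
  show ?thesis
  proof (intro exI conjI allI)
    show "0 < deriv T u" by (rule pos)
    show "deriv T u \<le> deriv T x" for x using u(2)[OF red(2)[of x]] red(1)[of x] by simp
    show "deriv T x \<le> deriv T v" for x using v(2)[OF red(2)[of x]] red(1)[of x] by simp
  qed (rule D)
qed

context tower
begin

lemma conjugate_deriv:
  "((H n \<circ> rotation b \<circ> inv (H n)) has_real_derivative H' n (inv (H n) z + b) / H' n (inv (H n) z)) (at z)"
proof -
  have "((\<lambda>z. inv (H n) z + b) has_real_derivative 1 / H' n (inv (H n) z) + 0) (at z)"
    by (intro DERIV_add DERIV_const tameD(5)[OF tame_inv[OF tame_H]])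
  from DERIV_chain2[OF tameD(5)[OF tame_H] this, of n]
  show ?thesis by (simp add: comp_def rotation_def)
qed

text \<open>Only finiteness for fixed \<open>n\<close> matters here: it provides the bound demanded
  by \<open>deriv_le_Ck_dist\<close>.\<close>

lemma conjugate_deriv_bound: "\<bar>H' n x / H' n y\<bar> \<le> (C ^ n * P n)\<^sup>2"
proof -
  note T = tame_H[of n]
  have "0 < C ^ n * P n" using C_ge_1 P_pos[of n] by simp
  have "1 / H' n y \<le> C ^ n * P n"
    using tameD(6)[OF T, of y] tameD(9)[OF T, of y] \<open>0 < C ^ n * P n\<close> by (simp add: field_simps)
  then have "H' n x * (1 / H' n y) \<le> (C ^ n * P n) * (C ^ n * P n)"
    using tameD(7)[OF T, of x] tameD(9)[OF T, of x] tameD(9)[OF T, of y] \<open>0 < C ^ n * P n\<close>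
    by (intro mult_mono) simp_all
  then show ?thesis using tameD(9)[OF T, of x] tameD(9)[OF T, of y] by (simp add: power2_eq_square)
qed

text \<open>\<open>g (Suc m)\<close> commutes with the rotation by a multiple of its period.\<close>

lemma conjugate_eq:
  "H (Suc m) \<circ> rotation (of_int k / qr (Suc m)) \<circ> inv (H (Suc m))
    = H m \<circ> rotation (of_int k / qr (Suc m)) \<circ> inv (H m)"
proof
  fix z
  define w where "w = inv (H (Suc m)) z"
  have HS: "H (Suc m) x = H m (g (Suc m) x)" for x by (simp add: H_Suc)
  have "H (Suc m) w = z" unfolding w_def by (rule H_inv)
  then have z: "z = H m (g (Suc m) w)" unfolding HS by (rule sym)
  have w: "inv (H m) z = g (Suc m) w" unfolding z by (rule H_inv)
  have "g (Suc m) (w + of_int k / qr (Suc m)) = g (Suc m) w + of_int k / qr (Suc m)"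
    by (rule step_mapD(4)[OF step[of "Suc m"]]) simp
  then show "(H (Suc m) \<circ> rotation (of_int k / qr (Suc m)) \<circ> inv (H (Suc m))) z
    = (H m \<circ> rotation (of_int k / qr (Suc m)) \<circ> inv (H m)) z"
    unfolding comp_apply rotation_def w w_def[symmetric] HS by (rule arg_cong)
qed

text \<open>The second convergence pairs \<open>H m\<close> with the fraction of index
  \<open>Suc m\<close>; \<open>conjugate_eq\<close> moves it to level \<open>Suc m\<close>, where
  both conjugates have slopes with the same denominator \<open>H' (Suc m) y\<close>, which
  cancels.\<close>

lemma eventually_slopes_comparable:
  fixes p :: "nat \<Rightarrow> int"
  assumes T: "circle_diffeo T"
    and conv: "Diff_converges (\<lambda>n. H n \<circ> rotation \<alpha> \<circ> inv (H n)) T"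
      "Diff_converges (\<lambda>n. H n \<circ> rotation (of_int (p (n + 1)) / qr (n + 1)) \<circ> inv (H n)) T"
  shows "\<exists>n0. \<forall>m\<ge>n0. \<forall>y. H' (Suc m) (y + \<alpha>) \<le> 2 * H' (Suc m) (y + of_int (p (Suc m)) / qr (Suc m))"
proof -
  obtain c B where c: "0 < c"
    and cB0: "\<forall>x. c \<le> deriv T x \<and> deriv T x \<le> B \<and> (T has_real_derivative deriv T x) (at x)"
    using circle_diffeo_deriv_bounds[OF T] by (elim exE conjE)
  have cB: "0 < c" "c \<le> deriv T x" "deriv T x \<le> B" "(T has_real_derivative deriv T x) (at x)" for x
    using c cB0 by blast+
  have ev: "eventually (\<lambda>n. Ck_dist 1 (F n) T < c / 3) sequentially" if "Diff_converges F T" for F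
    by (rule order_tendstoD(2)[OF Diff_converges_Ck[OF that]]) (use c in simp)
  have near: "\<bar>H' n (inv (H n) z + b) / H' n (inv (H n) z) - deriv T z\<bar> \<le> Ck_dist 1 (H n \<circ> rotation b \<circ> inv (H n)) T"
    for n b z
  proof (rule deriv_le_Ck_dist[where F' = "\<lambda>z. H' n (inv (H n) z + b) / H' n (inv (H n) z)"
        and G' = "deriv T" and B = "max ((C ^ n * P n)\<^sup>2) B"])
    show "((H n \<circ> rotation b \<circ> inv (H n)) has_real_derivative H' n (inv (H n) z + b) / H' n (inv (H n) z)) (at z)" for z
      by (rule conjugate_deriv)
    show "\<bar>H' n (inv (H n) z + b) / H' n (inv (H n) z)\<bar> \<le> max ((C ^ n * P n)\<^sup>2) B" for z
      using conjugate_deriv_bound[of n] by (rule order_trans) simp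
    show "(T has_real_derivative deriv T z) (at z)" for z by (rule cB(4))
    show "\<bar>deriv T z\<bar> \<le> max ((C ^ n * P n)\<^sup>2) B" for z
      using c cB(2)[of z] cB(3)[of z] by simp
  qed
  obtain n1 where n1: "\<And>n. n \<ge> n1 \<Longrightarrow> Ck_dist 1 (H n \<circ> rotation \<alpha> \<circ> inv (H n)) T < c / 3"
    using ev[OF conv(1)] unfolding eventually_sequentially by blast
  obtain n2 where n2: "\<And>n. n \<ge> n2 \<Longrightarrow>
      Ck_dist 1 (H n \<circ> rotation (of_int (p (n + 1)) / qr (n + 1)) \<circ> inv (H n)) T < c / 3"
    using ev[OF conv(2)] unfolding eventually_sequentially by blast
  show ?thesis
  proof (intro exI allI impI)
    fix m y assume m: "max n1 n2 \<le> m"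
    define b where "b = of_int (p (Suc m)) / qr (Suc m)"
    define z where "z = H (Suc m) y"
    have z: "inv (H (Suc m)) z = y" by (simp add: z_def)
    have "\<bar>H' (Suc m) (y + \<alpha>) / H' (Suc m) y - deriv T z\<bar> < c / 3"
      using near[of "Suc m" z \<alpha>] n1[of "Suc m"] m unfolding z by simp
    moreover have "\<bar>H' (Suc m) (y + b) / H' (Suc m) y - deriv T z\<bar> < c / 3"
      using near[of "Suc m" z b] n2[of m] m unfolding z b_def conjugate_eq by simp
    \<comment> \<open>A slope \<open>s\<close> of \<open>T\<close> is at least \<open>c\<close>, so
      \<open>s + c / 3 \<le> 2 * (s - c / 3)\<close>. This fixes the tolerance
      \<open>c / 3\<close>.\<close>
    ultimately have "H' (Suc m) (y + \<alpha>) / H' (Suc m) y \<le> 2 * (H' (Suc m) (y + b) / H' (Suc m) y)"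
      using cB(2)[of z] by linarith
    then show "H' (Suc m) (y + \<alpha>) \<le> 2 * H' (Suc m) (y + b)"
      using tameD(9)[OF tame_H, of "Suc m" y] by (simp add: divide_simps split: if_splits)
  qed
qed

text \<open>The slope of \<open>H m\<close> lies between the reciprocal of
  \<open>C ^ m * P m\<close> and \<open>C ^ m * P m\<close>; dividing it out on both sides costs the
  square.\<close>

lemma step_slopes_comparable:
  assumes "H' (Suc m) (y + d) \<le> 2 * H' (Suc m) y"
  shows "g' (Suc m) (y + d) \<le> 2 * (C ^ m * P m)\<^sup>2 * g' (Suc m) y"
proof -
  note T = tame_H[of m]
  have L: "0 < C ^ m * P m" using C_ge_1 P_pos[of m] by simp
  have st: "0 < g' (Suc m) x" for x
    using tameD(9)[OF step_mapD(1)[OF step[of "Suc m"]]] by simp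
  have "1 / (C ^ m * P m) * g' (Suc m) (y + d) \<le> H' m (g (Suc m) (y + d)) * g' (Suc m) (y + d)"
    using tameD(6)[OF T] st[of "y + d"] by (intro mult_right_mono) simp_all
  also have "\<dots> \<le> 2 * (H' m (g (Suc m) y) * g' (Suc m) y)" using assms by simp
  also have "\<dots> \<le> 2 * ((C ^ m * P m) * g' (Suc m) y)"
    using tameD(7)[OF T] st[of y] by (intro mult_left_mono mult_right_mono) simp_all
  finally show ?thesis using L by (simp add: field_simps power2_eq_square)
qed

text \<open>With \<open>n = Suc m\<close>, \<open>P m \<le> q n\<close> and
  \<open>2 * C\<^sup>2 \<le> q n\<close> bound the left side by \<open>q n ^ (n + 2)\<close>,
  whereas \<open>1 / t n\<close> is \<open>q n ^ (2 * n - 1)\<close>.\<close>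

lemma eventually_comparison_small:
  "\<exists>n0. \<forall>m\<ge>n0. 2 * (C ^ m * P m)\<^sup>2 * C < 1 / t (Suc m)"
proof (intro exI allI impI)
  fix m assume "max 4 (nat \<lceil>2 * C\<^sup>2\<rceil>) \<le> m"
  then have m: "4 \<le> m" "2 * C\<^sup>2 \<le> real m" by linarith+
  let ?n = "Suc m" let ?q = "qr (Suc m)"
  have q: "2 * C\<^sup>2 \<le> ?q" "2 \<le> ?q" using m q_ge[of ?n] by simp_all
  have C2: "1 \<le> C\<^sup>2" using C_ge_1 by simp
  have e: "(C ^ m)\<^sup>2 = (C\<^sup>2) ^ m" by (metis power_mult mult.commute)
  have "C ^ m * P m \<le> C ^ m * ?q" using P_le_next[of m] C_ge_1 by (intro mult_left_mono) auto
  then have "(C ^ m * P m)\<^sup>2 \<le> (C ^ m * ?q)\<^sup>2" using C_ge_1 P_pos[of m] by (intro power_mono) simp_all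
  then have "2 * (C ^ m * P m)\<^sup>2 * C \<le> 2 * (C ^ m * ?q)\<^sup>2 * C\<^sup>2"
    using C_ge_1 self_le_power[of C 2] by (intro mult_mono) simp_all
  also have "\<dots> = 2 * (C\<^sup>2) ^ ?n * ?q ^ 2"
    unfolding power_mult_distrib e by (simp add: power2_eq_square)
  also have "\<dots> \<le> (2 * C\<^sup>2) ^ ?n * ?q ^ 2"
    using self_le_power[of "2::real" ?n] C2 unfolding power_mult_distrib[of 2 "C\<^sup>2"] by (intro mult_right_mono) simp_all
  also have "\<dots> \<le> ?q ^ ?n * ?q ^ 2" using q C2 by (intro mult_right_mono power_mono) simp_all
  also have "\<dots> = ?q ^ (?n + 2)" by (simp only: power_add)
  also have "\<dots> < ?q ^ (2 * ?n - 1)" using m q by (intro power_strict_increasing) simp_all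
  also have "\<dots> = 1 / t ?n" by (simp add: t_eq)
  finally show "2 * (C ^ m * P m)\<^sup>2 * C < 1 / t ?n" .
qed

text \<open>Without jumps from some index on, consecutive approximating fractions would be closer
  than distinct fractions with these denominators can be. They would all agree, and the errors tend
  to 0, so \<alpha> would be rational.\<close>

lemma jumps_of_approximations:
  assumes irr: "\<alpha> \<notin> \<rat>"
    and approx: "\<And>n. n \<ge> n0 \<Longrightarrow> \<exists>r::int. \<bar>\<alpha> - of_int r / qr n\<bar> \<le> (t n)\<^sup>2 / (2 ^ (n + 1) * qr n)"
  shows "\<exists>n\<ge>N. qr n ^ (4 * n - 2) \<le> 2 * qr (n + 1)"
proof (rule ccontr)
  assume neg: "\<not> ?thesis"
  define N' where "N' = max (max N n0) 1"
  obtain r :: "nat \<Rightarrow> int" where r: "\<And>n. n \<ge> n0 \<Longrightarrow> \<bar>\<alpha> - of_int (r n) / qr n\<bar> \<le> (t n)\<^sup>2 / (2 ^ (n + 1) * qr n)"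
  proof -
    have "\<forall>n. \<exists>r::int. n \<ge> n0 \<longrightarrow> \<bar>\<alpha> - of_int r / qr n\<bar> \<le> (t n)\<^sup>2 / (2 ^ (n + 1) * qr n)"
      using approx by blast
    from choice[OF this] show thesis using that by blast
  qed
  have r': "\<bar>\<alpha> - of_int (r n) / qr n\<bar> \<le> 1 / (qr n ^ (4 * n - 2) * qr n)" if "n \<ge> N'" for n
  proof -
    have n: "n \<ge> 1" "n \<ge> n0" using that by (simp_all add: N'_def)
    have Q: "0 < qr n" using q_pos n by simp
    have "(qr n ^ (2 * n - 1))\<^sup>2 = qr n ^ (4 * n - 2)"
      using n by (simp flip: power_mult) (simp add: diff_mult_distrib)
    then have t2: "(t n)\<^sup>2 = 1 / qr n ^ (4 * n - 2)" using n by (simp add: t_eq power_divide)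
    have "(1::real) \<le> 2 ^ (n + 1)" by (rule one_le_power) simp
    then have "(t n)\<^sup>2 / (2 ^ (n + 1) * qr n) \<le> (t n)\<^sup>2 / (1 * qr n)"
      using Q by (intro divide_left_mono mult_right_mono) simp_all
    then show ?thesis using r[OF n(2)] by (simp add: t2)
  qed
  have same: "of_int (r (Suc n)) / qr (Suc n) = (of_int (r n) / qr n :: real)" if n: "n \<ge> N'" for n
  proof (rule ccontr)
    assume ne: "\<not> ?thesis"
    define a b where "a = qr n" and "b = qr (Suc n)"
    have n1: "n \<ge> 1" using n by (simp add: N'_def)
    have a: "2 \<le> a" using q_ge[OF n1] n1 by (simp add: a_def)
    have ab: "a \<le> b" using q_mono_Suc[OF n1] by (simp add: a_def b_def)
    have pos: "0 < a" "0 < b" using a ab by simp_all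
    have "r (Suc n) * int (q n) \<noteq> r n * int (q (Suc n))"
    proof
      assume "r (Suc n) * int (q n) = r n * int (q (Suc n))"
      then have "real_of_int (r (Suc n) * int (q n)) = real_of_int (r n * int (q (Suc n)))" by (rule arg_cong)
      then have "real_of_int (r (Suc n)) * a = of_int (r n) * b" by (simp add: a_def b_def)
      then show False using ne pos by (simp add: a_def b_def field_simps)
    qed
    then have "1 \<le> \<bar>r (Suc n) * int (q n) - r n * int (q (Suc n))\<bar>" by simp
    then have "1 \<le> real_of_int \<bar>r (Suc n) * int (q n) - r n * int (q (Suc n))\<bar>" by (simp only: of_int_1_le_iff)
    then have "1 \<le> \<bar>of_int (r (Suc n)) * a - of_int (r n) * b\<bar>" by (simp add: a_def b_def)
    then have "1 / (a * b) \<le> \<bar>of_int (r (Suc n)) * a - of_int (r n) * b\<bar> / (a * b)"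
      using pos by (intro divide_right_mono) simp_all
    also have "\<dots> = \<bar>(of_int (r (Suc n)) * a - of_int (r n) * b) / (a * b)\<bar>" using pos by (simp add: abs_divide)
    also have "(of_int (r (Suc n)) * a - of_int (r n) * b) / (a * b) = of_int (r (Suc n)) / b - of_int (r n) / a"
      using pos by (simp add: field_simps)
    finally have 1: "1 / (a * b) \<le> \<bar>of_int (r (Suc n)) / b - of_int (r n) / a\<bar>" .
    have "n \<ge> N" using n by (simp add: N'_def)
    then have "\<not> qr n ^ (4 * n - 2) \<le> 2 * qr (n + 1)" using neg by blast
    then have "2 * b < a ^ (4 * n - 2)" by (simp add: a_def b_def)
    then have "1 / (a ^ (4 * n - 2) * a) < 1 / (2 * b * a)"
      using pos by (intro divide_strict_left_mono mult_strict_right_mono) simp_all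
    then have 2: "\<bar>\<alpha> - of_int (r n) / a\<bar> < 1 / (2 * b * a)" using r'[OF n] by (simp add: a_def)
    \<comment> \<open>The error at level \<open>Suc n\<close> is at most half of
      \<open>1 / (a * b)\<close> by size alone; the absence of a jump was spent on the error at
      level \<open>n\<close>.\<close>
    have "2 * a \<le> b * b" using a ab by (intro mult_mono) simp_all
    also have "\<dots> = b ^ 2" by (simp add: power2_eq_square)
    also have "\<dots> \<le> b ^ (4 * Suc n - 2)" using a ab by (intro power_increasing) simp_all
    finally have "1 / (b ^ (4 * Suc n - 2) * b) \<le> 1 / (2 * a * b)"
      using pos by (intro divide_left_mono mult_right_mono) simp_all
    then have 3: "\<bar>\<alpha> - of_int (r (Suc n)) / b\<bar> \<le> 1 / (2 * a * b)"
      using r'[of "Suc n"] n by (simp add: b_def)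
    have "1 / (2 * b * a) + 1 / (2 * a * b) = 1 / (a * b)" by (simp add: field_simps)
    then show False using 1 2 3 by linarith
  qed
  have const: "of_int (r n) / qr n = (of_int (r N') / qr N' :: real)" if "n \<ge> N'" for n
    using that
  proof (induction n rule: dec_induct)
    case (step n) then show ?case using same[of n] by simp
  qed simp
  have "\<bar>\<alpha> - of_int (r N') / qr N'\<bar> \<le> e" if "0 < e" for e
  proof -
    obtain k :: nat where k: "1 / real (Suc k) < e" by (rule nat_approx_posE[OF \<open>0 < e\<close>])
    define n where "n = max N' k"
    have n: "n \<ge> N'" "n \<ge> k" "n \<ge> 1" by (simp_all add: n_def N'_def)
    have q: "real (Suc k) \<le> qr n" using q_ge[OF n(3)] n(2) by simp
    have "1 * qr n \<le> qr n ^ (4 * n - 2) * qr n"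
      using q by (intro mult_right_mono one_le_power) simp_all
    then have "1 / (qr n ^ (4 * n - 2) * qr n) \<le> 1 / (1 * qr n)"
      using q by (intro divide_left_mono) simp_all
    also have "\<dots> \<le> 1 / real (Suc k)" using q by (intro divide_left_mono) simp_all
    finally show ?thesis using r'[OF n(1)] k const[OF n(1)] by simp
  qed
  then have "\<bar>\<alpha> - of_int (r N') / qr N'\<bar> \<le> 0" by (rule field_le_epsilon) simp
  then have "\<alpha> = of_int (r N') / qr N'" by simp
  then show False using irr by simp
qed

end

section \<open>Identification of the limit and the main result\<close>

context jump_tower
begin

lemma diff_dist_Hlim: "(\<lambda>n. diff_dist 0 (H n) Hlim) \<longlonglongrightarrow> 0"
proof (rule LIMSEQ_I)
  fix e :: real assume e: "0 < e"
  obtain n1 where n1: "\<And>n x. n \<ge> n1 \<Longrightarrow> dist (H n x) (Hlim x) < e / 2"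
    using uniform_limitD[OF Hlim, of "e / 2"] e by (auto simp: eventually_sequentially)
  obtain n2 where n2: "\<And>n x. n \<ge> n2 \<Longrightarrow> dist (inv (H n) x) (Klim x) < e / 2"
    using uniform_limitD[OF Klim, of "e / 2"] e by (auto simp: eventually_sequentially)
  show "\<exists>no. \<forall>n\<ge>no. norm (diff_dist 0 (H n) Hlim - 0) < e"
  proof (intro exI allI impI)
    fix n assume n: "max n1 n2 \<le> n"
    have "Ck_dist 0 (H n) Hlim \<le> e / 2"
      using n1[of n] n by (intro Ck_dist_0_le) (simp add: dist_real_def less_imp_le)
    moreover have "Ck_dist 0 (inv (H n)) (inv Hlim) \<le> e / 2"
      using n2[of n] n unfolding inv_Hlim by (intro Ck_dist_0_le) (simp add: dist_real_def less_imp_le)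
    ultimately have "diff_dist 0 (H n) Hlim \<le> e / 2" by (simp add: diff_dist_def)
    moreover have "0 \<le> diff_dist 0 (H n) Hlim" by (simp add: diff_dist_def Ck_dist_nonneg le_max_iff_disj)
    ultimately show "norm (diff_dist 0 (H n) Hlim - 0) < e" using e by simp
  qed
qed

text \<open>Circle distance determines a lift only modulo integers. The difference of two limits is
  continuous and integer-valued, hence constant, and the normalization at 0 makes it vanish.\<close>

lemma Hlim_unique:
  assumes h: "circle_homeo h" "h 0 = 0" and lim: "(\<lambda>n. diff_dist 0 (H n) h) \<longlonglongrightarrow> 0"
  shows "h = Hlim"
proof
  fix x
  have int: "Hlim x - h x \<in> \<int>" for x
  proof (rule circle_dist_limit_eq_0[OF _ Hlim_pointwise])
    show "(\<lambda>n. circle_dist (H n x) (h x)) \<longlonglongrightarrow> 0"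
    proof (rule tendsto_sandwich[OF _ _ tendsto_const lim])
      have "circle_dist (H n x) (h x) \<le> diff_dist 0 (H n) h" for n
        unfolding diff_dist_def using circle_dist_le_Ck_dist[of "H n" x h 0] by linarith
      then show "eventually (\<lambda>n. circle_dist (H n x) (h x) \<le> diff_dist 0 (H n) h) sequentially" by simp
    qed (simp add: circle_dist_nonneg)
  qed
  have "(\<lambda>x. Hlim x - h x) constant_on UNIV"
  proof (rule continuous_discrete_range_constant)
    show "continuous_on UNIV (\<lambda>x. Hlim x - h x)"
      using h(1) Hlim_continuous by (intro continuous_on_diff) (auto simp: circle_homeo_def)
    fix x :: real
    show "\<exists>e>0. \<forall>y. y \<in> UNIV \<and> (Hlim y - h y) \<noteq> (Hlim x - h x) \<longrightarrow> e \<le> norm ((Hlim y - h y) - (Hlim x - h x))"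
    proof (intro exI[of _ 1] conjI allI impI)
      fix y assume "y \<in> UNIV \<and> (Hlim y - h y) \<noteq> (Hlim x - h x)"
      moreover have "(Hlim y - h y) - (Hlim x - h x) \<in> \<int>" by (intro Ints_diff int)
      ultimately show "1 \<le> norm ((Hlim y - h y) - (Hlim x - h x))"
        using Ints_nonzero_abs_ge1[of "Hlim y - h y - (Hlim x - h x)"] by simp
    qed simp
  qed simp
  then obtain c where "\<And>x. Hlim x - h x = c" unfolding constant_on_def by blast
  from this[of x] this[of 0] have "Hlim x - h x = Hlim 0 - h 0" by simp
  then show "h x = Hlim x" by (simp add: Hlim_0 h(2))
qed

lemma conjugates_tendsto:
  "(\<lambda>n. (H n \<circ> rotation \<alpha> \<circ> inv (H n)) x) \<longlonglongrightarrow> Hlim (Klim x + \<alpha>)"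
  unfolding comp_def rotation_def
  by (intro uniform_limit_compose_pointwise[OF Hlim Hlim_continuous] tendsto_add tendsto_const Klim_pointwise)

end

theorem lemma5p3:
  fixes \<alpha> :: real
    and \<psi> :: "real \<Rightarrow> real"
    and p :: "nat \<Rightarrow> int"
    and q :: "nat \<Rightarrow> nat"
    and T :: "(nat \<Rightarrow> bool) \<Rightarrow> real \<Rightarrow> real"
  assumes "liouville \<alpha>"
    and "cutoff \<psi>"
    and "\<And>n. n \<ge> 1 \<Longrightarrow> q n > 0"
    and "\<And>n. n \<ge> 1 \<Longrightarrow> t_param (q n) n < 1 / 10"
    and "(\<lambda>n. \<bar>\<alpha> - of_int (p n) / real (q n)\<bar>) \<longlonglongrightarrow> 0"
    and "\<And>n. n \<ge> 1 \<Longrightarrow>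
      \<bar>\<alpha> - of_int (p (n + 1)) / real (q (n + 1))\<bar> \<le> \<bar>\<alpha> - of_int (p n) / real (q n)\<bar>"
    and "\<And>n. n \<ge> 1 \<Longrightarrow> q (n + 1) \<ge> q n ^ (2 * n)"
    and "\<And>a. T a \<in> diffeos_with_rotation_number \<alpha>"
    and "\<And>a. Diff_converges
      (\<lambda>n. H_seq \<psi> q a n \<circ> rotation (of_int (p (n + 1)) / real (q (n + 1))) \<circ> inv (H_seq \<psi> q a n))
      (T a)"
    and "\<And>a. Diff_converges (\<lambda>n. H_seq \<psi> q a n \<circ> rotation \<alpha> \<circ> inv (H_seq \<psi> q a n)) (T a)"
  shows "\<forall>a. absolutely_continuous_conjugacy \<alpha> (T a) (H_lim \<psi> q a)"
proof
  fix a
  have irr: "\<alpha> \<notin> \<rat>" using assms(1) by (simp add: liouville_def)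
  obtain M where "bounded_cutoff \<psi> (deriv \<psi>) M" using bounded_cutoff_of_cutoff[OF assms(2)] by blast
  then interpret bounded_cutoff \<psi> "deriv \<psi>" M .
  \<comment> \<open>The factor 9 is that of the upper slope bound \<open>9 * M / t\<close> of the
    block.\<close>
  define C where "C = 9 * M"
  have C: "1 \<le> C" using M_ge_1 by (simp add: C_def)
  have lev: "level \<psi> (deriv \<psi>) M (t_param (q n) n) (q n) n" if n: "n \<ge> 1" for n
  proof unfold_locales
    show "0 < t_param (q n) n" using assms(3)[OF n] by (simp add: t_param_def)
  qed (use n assms(3,4)[OF n] in simp_all)
  have ex: "\<exists>g'. step_map C (t_param (q n) n) (q n) n (h_seq \<psi> q a n) g'" if n: "n \<ge> 1" for a n
    using level.step_map_g[OF lev[OF n]] level.step_map_inv[OF lev[OF n]]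
    unfolding h_seq_def C_def by (cases "a n") auto
  have tow: "\<exists>g'. tower C q (h_seq \<psi> q a) g' (H_seq \<psi> q a)" for a
  proof -
    have "\<forall>n. \<exists>g'. n \<ge> 1 \<longrightarrow> step_map C (t_param (q n) n) (q n) n (h_seq \<psi> q a n) g'" using ex by blast
    from choice[OF this] obtain g'
      where g': "\<forall>n. n \<ge> 1 \<longrightarrow> step_map C (t_param (q n) n) (q n) n (h_seq \<psi> q a n) (g' n)" ..
    have "tower C q (h_seq \<psi> q a) g' (H_seq \<psi> q a)"
      by (intro tower.intro C assms(3,4,7) H_seq.simps g'[rule_format])
    then show ?thesis by (rule exI[of "\<lambda>g'. tower C q (h_seq \<psi> q a) g' (H_seq \<psi> q a)"])
  qed
  \<comment> \<open>For this sequence every factor is \<open>h_bar\<close> itself, whose steep and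
    moderate parts are the ones treated by \<open>near_period_of_slope_comparison\<close>.\<close>
  define a0 :: "nat \<Rightarrow> bool" where "a0 = (\<lambda>_. False)"
  obtain g0 where "tower C q (h_seq \<psi> q a0) g0 (H_seq \<psi> q a0)" using tow[of a0] ..
  then interpret T0: tower C q "h_seq \<psi> q a0" g0 "H_seq \<psi> q a0" .
  have "circle_diffeo (T a0)" using assms(8)[of a0] by (simp add: diffeos_with_rotation_number_def)
  from T0.eventually_slopes_comparable[OF this assms(10) assms(9)]
  obtain n1 where n1: "\<And>m y. m \<ge> n1 \<Longrightarrow> T0.H' (Suc m) (y + \<alpha>) \<le> 2 * T0.H' (Suc m) (y + of_int (p (Suc m)) / real (q (Suc m)))"
    by blast
  obtain n2 where n2: "\<And>m. m \<ge> n2 \<Longrightarrow> 2 * (C ^ m * T0.P m)\<^sup>2 * C < 1 / T0.t (Suc m)"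
    using T0.eventually_comparison_small by blast
  have approx: "\<exists>r::int. \<bar>\<alpha> - of_int r / real (q n)\<bar> \<le> (T0.t n)\<^sup>2 / (2 ^ (n + 1) * real (q n))"
    if n: "n \<ge> Suc (max n1 n2)" for n
  proof -
    obtain m where m: "n = Suc m" "m \<ge> n1" "m \<ge> n2" using n by (cases n) auto
    interpret lv: level \<psi> "deriv \<psi>" M "t_param (q n) n" "q n" n by (rule lev) (simp add: m)
    have "h_seq \<psi> q a0 n = lv.g" by (simp add: h_seq_def a0_def)
    moreover have "(h_seq \<psi> q a0 n has_real_derivative g0 n x) (at x)" for x
      by (rule tameD(5)[OF step_mapD(1)[OF T0.step]]) (simp add: m)
    ultimately have "(lv.g has_real_derivative g0 n x) (at x)" for x by simp
    \<comment> \<open>The slopes \<open>g0\<close> were obtained by choice; uniqueness of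
      derivatives identifies them with the explicit formula.\<close>
    then have g0: "g0 n x = lv.g' x" for x by (rule DERIV_unique[OF _ lv.g_deriv])
    define d where "d = \<alpha> - of_int (p n) / real (q n)"
    \<comment> \<open>Evaluating the comparison at \<open>y - p n / q n\<close> replaces the two
      shifts by the single shift \<open>d\<close>.\<close>
    have "lv.g' (y + d) \<le> 2 * (C ^ m * T0.P m)\<^sup>2 * lv.g' y" for y
      using T0.step_slopes_comparable[of m y d] n1[OF m(2), of "y - of_int (p n) / real (q n)"]
      unfolding g0[symmetric] by (simp add: d_def m(1) algebra_simps)
    moreover have "2 * (C ^ m * T0.P m)\<^sup>2 * (3 * M) < 1 / t_param (q n) n"
    proof (rule le_less_trans)
      show "2 * (C ^ m * T0.P m)\<^sup>2 * (3 * M) \<le> 2 * (C ^ m * T0.P m)\<^sup>2 * C"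
        using M_ge_1 by (intro mult_left_mono) (simp_all add: C_def)
      show "2 * (C ^ m * T0.P m)\<^sup>2 * C < 1 / t_param (q n) n"
        using n2[OF m(3)] by (simp add: T0.t_def m(1))
    qed
    ultimately obtain k :: int where k: "\<bar>d - of_int k / real (q n)\<bar> \<le> (t_param (q n) n)\<^sup>2 / (lv.c * real (q n))"
      using lv.near_period_of_slope_comparison[of "2 * (C ^ m * T0.P m)\<^sup>2" d] by auto
    have "\<alpha> - of_int (p n + k) / real (q n) = d - of_int k / real (q n)"
      by (simp add: d_def add_divide_distrib)
    then have "\<bar>\<alpha> - of_int (p n + k) / real (q n)\<bar> \<le> (T0.t n)\<^sup>2 / (2 ^ (n + 1) * real (q n))"
      using k by (simp only: T0.t_def lv.c_def)
    then show ?thesis ..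
  qed
  have jumps: "\<exists>n\<ge>N. real (q n) ^ (4 * n - 2) \<le> 2 * real (q (n + 1))" for N
    using irr approx by (rule T0.jumps_of_approximations)
  obtain ga where "tower C q (h_seq \<psi> q a) ga (H_seq \<psi> q a)" using tow[of a] ..
  then interpret J: jump_tower C q "h_seq \<psi> q a" ga "H_seq \<psi> q a"
    using jumps by (intro jump_tower.intro jump_tower_axioms.intro)
  have H_lim: "H_lim \<psi> q a = J.Hlim"
    unfolding H_lim_def
  proof (rule the_equality)
    show "circle_homeo J.Hlim \<and> J.Hlim 0 = 0 \<and> (\<lambda>n. diff_dist 0 (H_seq \<psi> q a n) J.Hlim) \<longlonglongrightarrow> 0"
      using J.Hlim_circle_homeo J.Hlim_0 J.diff_dist_Hlim by blast
    show "h = J.Hlim" if "circle_homeo h \<and> h 0 = 0 \<and> (\<lambda>n. diff_dist 0 (H_seq \<psi> q a n) h) \<longlonglongrightarrow> 0" for h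
      using that J.Hlim_unique by blast
  qed
  \<comment> \<open>The conjugates of the rotation by \<alpha> converge pointwise to the conjugate
    under the limit map and, modulo integers, to \<open>T a\<close>.\<close>
  have int: "J.Hlim (J.Klim x + \<alpha>) - T a x \<in> \<int>" for x
    by (rule circle_dist_limit_eq_0[OF Diff_converges_pointwise[OF assms(10)] J.conjugates_tendsto])
  interpret circle_conjugacy J.Hlim J.Klim "T a" \<alpha>
  proof
    show "T a x - J.Hlim (J.Klim x + \<alpha>) \<in> \<int>" for x using Ints_minus[OF int[of x]] by simp
  qed (simp_all add: J.Hlim_circle_homeo J.Hlim_0 J.Klim_continuous irr)
  show "absolutely_continuous_conjugacy \<alpha> (T a) (H_lim \<psi> q a)"
    unfolding H_lim by (rule absolutely_continuous[OF J.negligible_Hlim_image J.negligible_Klim_image])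
qed

end
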